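(* Let $(M,L)$ be a Finsler manifold and $g$ the Finsler metric defined by $L$, regarded as a metric on the pullback bundle $\pi^{-1}(TM)$. For each scalar 1-form $A$ on $\pi^{-1}(TM)$ there exists a unique regular connection $\overline{D}$ on $\pi^{-1}(TM)$, with horizontal map $\bar\beta$, (h)h-torsion $\overline{Q}$ and (h)hv-torsion $\overline{T}$, such that for all $\overline{X},\overline{Y},\overline{Z}\in\mathfrak{X}(\pi(M))$: (C1) $\overline{D}_{\bar\beta\overline{X}}\,g=A(\overline{X})\,g$; (C2) $\overline{D}_{\gamma\overline{X}}\,g=0$; (C3) $\overline{Q}=0$; (C4) $g(\overline{T}(\overline{X},\overline{Y}),\overline{Z})=g(\overline{T}(\overline{X},\overline{Z}),\overline{Y})$.
   Context: $M$ is a smooth manifold, $\pi:\mathcal{T}M\to M$ its slit tangent bundle (nonzero tangent vectors), $\pi^{-1}(TM)$ the pullback of $TM$ to $\mathcal{T}M$, and $\mathfrak{X}(\pi(M))$ the module of its smooth sections ($\pi$-vector fields, written with bars). The fundamental $\pi$-vector field is $\overline\eta(u)=(u,u)$. The bundle maps of the exact sequence $0\to\pi^{-1}(TM)\xrightarrow{\gamma}T(\mathcal{T}M)\xrightarrow{\rho}\pi^{-1}(TM)\to 0$ are $\gamma(u,v)=\frac{d}{dt}\big|_{t=0}(u+tv)$ and $\rho(X)=(u,d\pi(X))$ for $X\in T_u(\mathcal{T}M)$. A scalar 1-form on $\pi^{-1}(TM)$ (scalar ($\pi$)1-form) is a smooth section of the dual bundle of $\pi^{-1}(TM)$. Finsler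 structure: $L:TM\to[0,\infty)$ is smooth and positive on $\mathcal{T}M$, positively 1-homogeneous on fibres, and $g_u(v,w)=\frac12\frac{\partial^2}{\partial s\,\partial t}\big|_{s=t=0}L^2(u+sv+tw)$ is a metric on $\pi^{-1}(TM)$. Let $D$ be a linear connection on $\pi^{-1}(TM)$. Its connection map is $K(X)=D_X\overline\eta$; put $V_u=\ker d\pi|_u$ and $H_u=\{X\in T_u(\mathcal{T}M):K(X)=0\}$. $D$ is regular if $T_u(\mathcal{T}M)=V_u\oplus H_u$ for all $u\in\mathcal{T}M$; then its horizontal map is $\beta=(\rho|_{H})^{-1}$. Its (classical) torsion is $\mathbf{T}(X,Y)=D_X\rho Y-D_Y\rho X-\rho[X,Y]$. The (h)h-torsion and (h)hv-torsion are $Q(\overline X,\overline Y)=\mathbf{T}(\beta\overline X,\beta\overline Y)$ and $T(\overline X,\overline Y)=\mathbf{T}(\gamma\overline X,\beta\overline Y)$. *)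

theory Defs
  imports "HOL-Analysis.Analysis"
begin

section \<open>Smooth maps between open subsets of Euclidean spaces\<close>

primrec Ck_on :: "nat \<Rightarrow> ('e::euclidean_space \<Rightarrow> 'f::real_normed_vector) \<Rightarrow> 'e set \<Rightarrow> bool" where
  "Ck_on 0 f S = continuous_on S f"
| "Ck_on (Suc k) f S =
     ((\<forall>x\<in>S. f differentiable (at x)) \<and> (\<forall>h. Ck_on k (\<lambda>x. frechet_derivative f (at x) h) S))"

definition smooth_on :: "('e::euclidean_space \<Rightarrow> 'f::real_normed_vector) \<Rightarrow> 'e set \<Rightarrow> bool" where
  "smooth_on f S \<longleftrightarrow> (\<forall>k. Ck_on k f S)"


section \<open>Smooth manifolds and tangent vectors\<close>

text \<open>A chart is a domain together with a coordinate map; only the values of the map on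
  the domain matter.  \<open>coord_rep c f\<close> is \<open>f\<close> expressed in the coordinates \<open>c\<close>.\<close>

type_synonym ('a, 'e) chart = "'a set \<times> ('a \<Rightarrow> 'e)"

abbreviation dom_c :: "('a, 'e) chart \<Rightarrow> 'a set" where "dom_c \<equiv> fst"
abbreviation map_c :: "('a, 'e) chart \<Rightarrow> 'a \<Rightarrow> 'e" where "map_c \<equiv> snd"

definition coord_rep :: "('a, 'e) chart \<Rightarrow> ('a \<Rightarrow> 'b) \<Rightarrow> 'e \<Rightarrow> 'b" where
  "coord_rep c f = f \<circ> inv_into (dom_c c) (map_c c)"

definition smooth_manifold :: "'m topology \<Rightarrow> ('m, 'e::euclidean_space) chart set \<Rightarrow> bool" where
  "smooth_manifold M \<A> \<longleftrightarrow>
     Hausdorff_space M \<and> second_countable M \<and>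
     (\<Union>c\<in>\<A>. dom_c c) = topspace M \<and>
     (\<forall>c\<in>\<A>. openin M (dom_c c) \<and> open (map_c c ` dom_c c) \<and>
        homeomorphic_map (subtopology M (dom_c c)) (top_of_set (map_c c ` dom_c c)) (map_c c)) \<and>
     (\<forall>c\<in>\<A>. \<forall>d\<in>\<A>. smooth_on (coord_rep c (map_c d)) (map_c c ` (dom_c c \<inter> dom_c d)))"

definition charts_at :: "('a, 'e) chart set \<Rightarrow> 'a \<Rightarrow> ('a, 'e) chart set" where
  "charts_at \<A> p = {c \<in> \<A>. p \<in> dom_c c}"

definition some_chart_at :: "('a, 'e) chart set \<Rightarrow> 'a \<Rightarrow> ('a, 'e) chart" where
  "some_chart_at \<A> p = (SOME c. c \<in> charts_at \<A> p)"

text \<open>A tangent vector at \<open>p\<close> is the family of its components in the charts around \<open>p\<close>,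
  related by the derivatives of the coordinate changes.  Components in all other charts
  are set to \<open>0\<close>, so that equality of tangent vectors is equality of families and
  the vector space structure is the pointwise one.\<close>

type_synonym ('a, 'e) tvec = "('a, 'e) chart \<Rightarrow> 'e"

definition trans_deriv ::
    "('a, 'e::euclidean_space) chart \<Rightarrow> ('a, 'e) chart \<Rightarrow> 'a \<Rightarrow> 'e \<Rightarrow> 'e" where
  "trans_deriv c d p = frechet_derivative (coord_rep c (map_c d)) (at (map_c c p))"

definition tangent_space :: "('a, 'e::euclidean_space) chart set \<Rightarrow> 'a \<Rightarrow> ('a, 'e) tvec set" where
  "tangent_space \<A> p =
     {v. (\<forall>c\<in>charts_at \<A> p. \<forall>d\<in>charts_at \<A> p. v d = trans_deriv c d p (v c)) \<and>
         (\<forall>c. c \<notin> charts_at \<A> p \<longrightarrow> v c = 0)}"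

definition vzero :: "'c \<Rightarrow> 'e::real_vector" where
  "vzero = (\<lambda>c. 0)"

definition vadd :: "('c \<Rightarrow> 'e::real_vector) \<Rightarrow> ('c \<Rightarrow> 'e) \<Rightarrow> 'c \<Rightarrow> 'e" where
  "vadd v w = (\<lambda>c. v c + w c)"

definition vsub :: "('c \<Rightarrow> 'e::real_vector) \<Rightarrow> ('c \<Rightarrow> 'e) \<Rightarrow> 'c \<Rightarrow> 'e" where
  "vsub v w = (\<lambda>c. v c - w c)"

definition vscale :: "real \<Rightarrow> ('c \<Rightarrow> 'e::real_vector) \<Rightarrow> 'c \<Rightarrow> 'e" where
  "vscale a v = (\<lambda>c. a *\<^sub>R v c)"

text \<open>The tangent vector at \<open>p\<close> whose component in the chart \<open>c\<close> is \<open>e\<close>.\<close>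

definition coord_vec ::
    "('a, 'e::euclidean_space) chart set \<Rightarrow> ('a, 'e) chart \<Rightarrow> 'a \<Rightarrow> 'e \<Rightarrow> ('a, 'e) tvec" where
  "coord_vec \<A> c p e = (\<lambda>d. if d \<in> charts_at \<A> p then trans_deriv c d p e else 0)"

definition velocity ::
    "('a, 'e::euclidean_space) chart set \<Rightarrow> (real \<Rightarrow> 'a) \<Rightarrow> real \<Rightarrow> ('a, 'e) tvec" where
  "velocity \<A> \<sigma> t =
     (\<lambda>c. if c \<in> charts_at \<A> (\<sigma> t) then vector_derivative (map_c c \<circ> \<sigma>) (at t) else 0)"

definition tangent_map ::
    "('a, 'e::euclidean_space) chart set \<Rightarrow> ('b, 'f::euclidean_space) chart set \<Rightarrow>
     ('a \<Rightarrow> 'b) \<Rightarrow> 'a \<Rightarrow> ('a, 'e) tvec \<Rightarrow> ('b, 'f) tvec" where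
  "tangent_map \<A> \<B> f p \<xi> =
     (let c = some_chart_at \<A> p in
      (\<lambda>d. if d \<in> charts_at \<B> (f p)
           then frechet_derivative (coord_rep c (map_c d \<circ> f)) (at (map_c c p)) (\<xi> c) else 0))"

text \<open>The derivative \<open>\<xi> f\<close> of a real function \<open>f\<close> along a tangent vector \<open>\<xi>\<close> at \<open>p\<close>.\<close>

definition dir_deriv ::
    "('a, 'e::euclidean_space) chart set \<Rightarrow> 'a \<Rightarrow> ('a, 'e) tvec \<Rightarrow> ('a \<Rightarrow> real) \<Rightarrow> real" where
  "dir_deriv \<A> p \<xi> f =
     (let c = some_chart_at \<A> p in frechet_derivative (coord_rep c f) (at (map_c c p)) (\<xi> c))"

definition smooth_function :: "('a, 'e::euclidean_space) chart set \<Rightarrow> ('a \<Rightarrow> real) \<Rightarrow> bool" where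
  "smooth_function \<A> f \<longleftrightarrow> (\<forall>c\<in>\<A>. smooth_on (coord_rep c f) (map_c c ` dom_c c))"

definition vector_fields ::
    "('a, 'e::euclidean_space) chart set \<Rightarrow> ('a \<Rightarrow> ('a, 'e) tvec) set" where
  "vector_fields \<A> =
     {X. (\<forall>p\<in>(\<Union>c\<in>\<A>. dom_c c). X p \<in> tangent_space \<A> p) \<and>
         (\<forall>c\<in>\<A>. smooth_on (coord_rep c (\<lambda>p. X p c)) (map_c c ` dom_c c))}"

text \<open>In coordinates, \<open>[X,Y]\<^sup>i = X\<^sup>j \<partial>\<^sub>j Y\<^sup>i - Y\<^sup>j \<partial>\<^sub>j X\<^sup>i\<close>.\<close>

definition lie_bracket ::
    "('a, 'e::euclidean_space) chart set \<Rightarrow> ('a \<Rightarrow> ('a, 'e) tvec) \<Rightarrow> ('a \<Rightarrow> ('a, 'e) tvec) \<Rightarrow>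
     'a \<Rightarrow> ('a, 'e) tvec" where
  "lie_bracket \<A> X Y p =
     (\<lambda>c. if c \<in> charts_at \<A> p
          then frechet_derivative (coord_rep c (\<lambda>q. Y q c)) (at (map_c c p)) (X p c)
             - frechet_derivative (coord_rep c (\<lambda>q. X q c)) (at (map_c c p)) (Y p c)
          else 0)"


section \<open>The slit tangent bundle and the pullback bundle\<close>

text \<open>Points of \<open>TM\<close> are pairs \<open>(p, v)\<close> with \<open>v \<in> T\<^sub>pM\<close>.  The slit tangent bundle is a
  manifold modelled on \<open>'e \<times> 'e\<close> through the charts \<open>(p, v) \<mapsto> (x(p), components of v)\<close>.\<close>

type_synonym ('m, 'e) tpt = "'m \<times> ('m, 'e) tvec"

type_synonym ('m, 'e) tslit = "(('m, 'e) tpt, 'e \<times> 'e) tvec"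

definition tangent_bundle :: "('m, 'e::euclidean_space) chart set \<Rightarrow> ('m, 'e) tpt set" where
  "tangent_bundle \<A> = Sigma (\<Union>c\<in>\<A>. dom_c c) (tangent_space \<A>)"

definition slit_bundle :: "('m, 'e::euclidean_space) chart set \<Rightarrow> ('m, 'e) tpt set" where
  "slit_bundle \<A> = {u \<in> tangent_bundle \<A>. snd u \<noteq> vzero}"

definition slit_chart ::
    "('m, 'e::euclidean_space) chart set \<Rightarrow> ('m, 'e) chart \<Rightarrow> (('m, 'e) tpt, 'e \<times> 'e) chart" where
  "slit_chart \<A> c = ({u \<in> slit_bundle \<A>. fst u \<in> dom_c c}, \<lambda>u. (map_c c (fst u), snd u c))"

definition slit_atlas ::
    "('m, 'e::euclidean_space) chart set \<Rightarrow> (('m, 'e) tpt, 'e \<times> 'e) chart set" where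
  "slit_atlas \<A> = slit_chart \<A> ` \<A>"

text \<open>The fibre of the pullback bundle over \<open>u = (p, y)\<close> is \<open>T\<^sub>pM\<close>; an element \<open>(u, v)\<close> of it
  is represented by \<open>v\<close>, and a section by \<open>u \<mapsto> v\<close>.  Sections are set to \<open>0\<close> outside
  the slit bundle, so that equality of functions is equality of sections.\<close>

type_synonym ('m, 'e) pi_section = "('m, 'e) tpt \<Rightarrow> ('m, 'e) tvec"

definition pi_sections :: "('m, 'e::euclidean_space) chart set \<Rightarrow> ('m, 'e) pi_section set" where
  "pi_sections \<A> =
     {X. (\<forall>u\<in>slit_bundle \<A>. X u \<in> tangent_space \<A> (fst u)) \<and>
         (\<forall>u. u \<notin> slit_bundle \<A> \<longrightarrow> X u = vzero) \<and>
         (\<forall>c\<in>\<A>. smooth_on (coord_rep (slit_chart \<A> c) (\<lambda>u. X u c))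
                   (map_c (slit_chart \<A> c) ` dom_c (slit_chart \<A> c)))}"

definition eta :: "('m, 'e::euclidean_space) chart set \<Rightarrow> ('m, 'e) pi_section" where
  "eta \<A> u = (if u \<in> slit_bundle \<A> then snd u else vzero)"

text \<open>Smoothness of a 1-form means smoothness of its components in the frames of
  coordinate vectors.\<close>

definition scalar_one_form ::
    "('m, 'e::euclidean_space) chart set \<Rightarrow> (('m, 'e) tpt \<Rightarrow> ('m, 'e) tvec \<Rightarrow> real) \<Rightarrow> bool" where
  "scalar_one_form \<A> A \<longleftrightarrow>
     (\<forall>u\<in>slit_bundle \<A>. \<forall>v\<in>tangent_space \<A> (fst u). \<forall>w\<in>tangent_space \<A> (fst u). \<forall>a b.
        A u (vadd (vscale a v) (vscale b w)) = a * A u v + b * A u w) \<and>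
     (\<forall>c\<in>\<A>. \<forall>e. smooth_on (coord_rep (slit_chart \<A> c) (\<lambda>u. A u (coord_vec \<A> c (fst u) e)))
                     (map_c (slit_chart \<A> c) ` dom_c (slit_chart \<A> c)))"

definition gamma ::
    "('m, 'e::euclidean_space) chart set \<Rightarrow> ('m, 'e) tpt \<Rightarrow> ('m, 'e) tvec \<Rightarrow> ('m, 'e) tslit" where
  "gamma \<A> u v = velocity (slit_atlas \<A>) (\<lambda>t. (fst u, vadd (snd u) (vscale t v))) 0"

definition rho ::
    "('m, 'e::euclidean_space) chart set \<Rightarrow> ('m, 'e) tpt \<Rightarrow> ('m, 'e) tslit \<Rightarrow> ('m, 'e) tvec" where
  "rho \<A> u \<xi> = tangent_map (slit_atlas \<A>) \<A> fst u \<xi>"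

definition rho_field ::
    "('m, 'e::euclidean_space) chart set \<Rightarrow> (('m, 'e) tpt \<Rightarrow> ('m, 'e) tslit) \<Rightarrow> ('m, 'e) pi_section"
  where "rho_field \<A> X = (\<lambda>u. if u \<in> slit_bundle \<A> then rho \<A> u (X u) else vzero)"


section \<open>Finsler structures\<close>

definition finsler_metric ::
    "(('m, 'e::euclidean_space) tpt \<Rightarrow> real) \<Rightarrow> ('m, 'e) tpt \<Rightarrow> ('m, 'e) tvec \<Rightarrow> ('m, 'e) tvec \<Rightarrow> real"
  where
  "finsler_metric L u v w =
     deriv (\<lambda>s. deriv (\<lambda>t. (L (fst u, vadd (snd u) (vadd (vscale s v) (vscale t w))))\<^sup>2) 0) 0 / 2"

text \<open>The metric is automatically a smooth symmetric bilinear form on the fibres, so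
  the last clause says exactly that it is a (Riemannian) bundle metric.\<close>

definition finsler_manifold ::
    "'m topology \<Rightarrow> ('m, 'e::euclidean_space) chart set \<Rightarrow> (('m, 'e) tpt \<Rightarrow> real) \<Rightarrow> bool" where
  "finsler_manifold M \<A> L \<longleftrightarrow>
     smooth_manifold M \<A> \<and>
     (\<forall>u\<in>tangent_bundle \<A>. L u \<ge> 0) \<and>
     (\<forall>u\<in>slit_bundle \<A>. L u > 0) \<and>
     smooth_function (slit_atlas \<A>) L \<and>
     (\<forall>(p, v)\<in>tangent_bundle \<A>. \<forall>a>0. L (p, vscale a v) = a * L (p, v)) \<and>
     (\<forall>u\<in>slit_bundle \<A>. \<forall>v\<in>tangent_space \<A> (fst u). v \<noteq> vzero \<longrightarrow> finsler_metric L u v v > 0)"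


section \<open>Connections on the pullback bundle\<close>

text \<open>\<open>D u \<xi> Y\<close> is the covariant derivative of the section \<open>Y\<close> along the tangent vector \<open>\<xi>\<close>
  to the slit bundle at \<open>u\<close>.  The last clause fixes the value \<open>0\<close> on all arguments on which a
  connection is not defined, so that equality of functions is equality of connections.\<close>

type_synonym ('m, 'e) pi_connection =
  "('m, 'e) tpt \<Rightarrow> ('m, 'e) tslit \<Rightarrow> ('m, 'e) pi_section \<Rightarrow> ('m, 'e) tvec"

definition linear_connection ::
    "('m, 'e::euclidean_space) chart set \<Rightarrow> ('m, 'e) pi_connection \<Rightarrow> bool" where
  "linear_connection \<A> D \<longleftrightarrow>
     (\<forall>u\<in>slit_bundle \<A>. \<forall>\<xi>\<in>tangent_space (slit_atlas \<A>) u. \<forall>Y\<in>pi_sections \<A>.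
        D u \<xi> Y \<in> tangent_space \<A> (fst u)) \<and>
     (\<forall>u\<in>slit_bundle \<A>. \<forall>\<xi>\<in>tangent_space (slit_atlas \<A>) u. \<forall>\<zeta>\<in>tangent_space (slit_atlas \<A>) u.
        \<forall>Y\<in>pi_sections \<A>. \<forall>a b.
        D u (vadd (vscale a \<xi>) (vscale b \<zeta>)) Y = vadd (vscale a (D u \<xi> Y)) (vscale b (D u \<zeta> Y))) \<and>
     (\<forall>u\<in>slit_bundle \<A>. \<forall>\<xi>\<in>tangent_space (slit_atlas \<A>) u. \<forall>Y\<in>pi_sections \<A>. \<forall>Z\<in>pi_sections \<A>.
        D u \<xi> (\<lambda>w. vadd (Y w) (Z w)) = vadd (D u \<xi> Y) (D u \<xi> Z)) \<and>
     (\<forall>u\<in>slit_bundle \<A>. \<forall>\<xi>\<in>tangent_space (slit_atlas \<A>) u. \<forall>Y\<in>pi_sections \<A>. \<forall>f.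
        smooth_function (slit_atlas \<A>) f \<longrightarrow>
        D u \<xi> (\<lambda>w. vscale (f w) (Y w)) =
          vadd (vscale (dir_deriv (slit_atlas \<A>) u \<xi> f) (Y u)) (vscale (f u) (D u \<xi> Y))) \<and>
     (\<forall>X\<in>vector_fields (slit_atlas \<A>). \<forall>Y\<in>pi_sections \<A>.
        (\<lambda>u. if u \<in> slit_bundle \<A> then D u (X u) Y else vzero) \<in> pi_sections \<A>) \<and>
     (\<forall>u \<xi> Y. \<not> (u \<in> slit_bundle \<A> \<and> \<xi> \<in> tangent_space (slit_atlas \<A>) u \<and> Y \<in> pi_sections \<A>)
        \<longrightarrow> D u \<xi> Y = vzero)"

definition connection_map ::
    "('m, 'e::euclidean_space) chart set \<Rightarrow> ('m, 'e) pi_connection \<Rightarrow>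
     ('m, 'e) tpt \<Rightarrow> ('m, 'e) tslit \<Rightarrow> ('m, 'e) tvec" where
  "connection_map \<A> D u \<xi> = D u \<xi> (eta \<A>)"

definition vertical_space ::
    "('m, 'e::euclidean_space) chart set \<Rightarrow> ('m, 'e) tpt \<Rightarrow> ('m, 'e) tslit set" where
  "vertical_space \<A> u =
     {\<xi> \<in> tangent_space (slit_atlas \<A>) u. tangent_map (slit_atlas \<A>) \<A> fst u \<xi> = vzero}"

definition horizontal_space ::
    "('m, 'e::euclidean_space) chart set \<Rightarrow> ('m, 'e) pi_connection \<Rightarrow>
     ('m, 'e) tpt \<Rightarrow> ('m, 'e) tslit set" where
  "horizontal_space \<A> D u =
     {\<xi> \<in> tangent_space (slit_atlas \<A>) u. connection_map \<A> D u \<xi> = vzero}"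

definition regular_connection ::
    "('m, 'e::euclidean_space) chart set \<Rightarrow> ('m, 'e) pi_connection \<Rightarrow> bool" where
  "regular_connection \<A> D \<longleftrightarrow>
     linear_connection \<A> D \<and>
     (\<forall>u\<in>slit_bundle \<A>.
        tangent_space (slit_atlas \<A>) u =
          {vadd \<xi> \<zeta> | \<xi> \<zeta>. \<xi> \<in> vertical_space \<A> u \<and> \<zeta> \<in> horizontal_space \<A> D u} \<and>
        vertical_space \<A> u \<inter> horizontal_space \<A> D u = {vzero})"

definition beta ::
    "('m, 'e::euclidean_space) chart set \<Rightarrow> ('m, 'e) pi_connection \<Rightarrow>
     ('m, 'e) tpt \<Rightarrow> ('m, 'e) tvec \<Rightarrow> ('m, 'e) tslit" where
  "beta \<A> D u = inv_into (horizontal_space \<A> D u) (rho \<A> u)"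

definition torsion ::
    "('m, 'e::euclidean_space) chart set \<Rightarrow> ('m, 'e) pi_connection \<Rightarrow>
     (('m, 'e) tpt \<Rightarrow> ('m, 'e) tslit) \<Rightarrow> (('m, 'e) tpt \<Rightarrow> ('m, 'e) tslit) \<Rightarrow> ('m, 'e) pi_section" where
  "torsion \<A> D X Y u =
     vsub (vsub (D u (X u) (rho_field \<A> Y)) (D u (Y u) (rho_field \<A> X)))
       (rho \<A> u (lie_bracket (slit_atlas \<A>) X Y u))"

definition hh_torsion ::
    "('m, 'e::euclidean_space) chart set \<Rightarrow> ('m, 'e) pi_connection \<Rightarrow>
     ('m, 'e) pi_section \<Rightarrow> ('m, 'e) pi_section \<Rightarrow> ('m, 'e) pi_section" where
  "hh_torsion \<A> D X Y = torsion \<A> D (\<lambda>u. beta \<A> D u (X u)) (\<lambda>u. beta \<A> D u (Y u))"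

definition hhv_torsion ::
    "('m, 'e::euclidean_space) chart set \<Rightarrow> ('m, 'e) pi_connection \<Rightarrow>
     ('m, 'e) pi_section \<Rightarrow> ('m, 'e) pi_section \<Rightarrow> ('m, 'e) pi_section" where
  "hhv_torsion \<A> D X Y = torsion \<A> D (\<lambda>u. gamma \<A> u (X u)) (\<lambda>u. beta \<A> D u (Y u))"

text \<open>\<open>(D\<^sub>\<xi> G)(Y, Z) = \<xi>(G(Y, Z)) - G(D\<^sub>\<xi> Y, Z) - G(Y, D\<^sub>\<xi> Z)\<close> at the point \<open>u\<close>.\<close>

definition cov_deriv_form ::
    "('m, 'e::euclidean_space) chart set \<Rightarrow> ('m, 'e) pi_connection \<Rightarrow>
     (('m, 'e) tpt \<Rightarrow> ('m, 'e) tvec \<Rightarrow> ('m, 'e) tvec \<Rightarrow> real) \<Rightarrow>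
     ('m, 'e) tpt \<Rightarrow> ('m, 'e) tslit \<Rightarrow> ('m, 'e) pi_section \<Rightarrow> ('m, 'e) pi_section \<Rightarrow> real" where
  "cov_deriv_form \<A> D G u \<xi> Y Z =
     dir_deriv (slit_atlas \<A>) u \<xi> (\<lambda>w. G w (Y w) (Z w))
       - G u (D u \<xi> Y) (Z u) - G u (Y u) (D u \<xi> Z)"

end

(*
  In a chart a connection is D = d + B, where B depends bilinearly on the direction and on the section.
  The conditions (C1)-(C4) at a point u become algebraic conditions on B: (C2) and (C4) say that the
  vertical part of B is half the vertical derivative of g (the Cartan tensor), which vanishes on
  the fibre coordinate y since g is 0-homogeneous; hence D is regular. The horizontal part is
  given by (C1), (C3) and the Koszul formula, in which the nonlinear connection N, itself equal to B(-, -N)y,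
  occurs. Contracting the formula twice with y removes N from it, which yields N(y), then N, and then B.
  So B exists and is unique in every chart; by uniqueness the solutions agree on overlaps.
  For a given D, bump functions show that it has the form d + B, and the regularity of D that the
  horizontal map is smooth, which the torsions need since they involve Lie brackets.
*)

theory Submission
  imports Defs
begin

section \<open>Calculus of smooth maps\<close>

text \<open>The obstacle is that (C1) and (C3) refer to horizontal lifts, which depend on the
  unknown connection, so the conditions are not linear in \<open>B\<close>.
  \<open>cartan_cond\<close> therefore quantifies over all \<open>(h, k)\<close> with
  \<open>k + B (h, k) y = 0\<close> instead of over values of \<open>beta\<close>. In the Koszul
  formula N occurs only in fibre derivatives of g taken along values of N. Such a term vanishes as
  soon as one of its two arguments is y; this is why the double contraction is free of N and a
  single one contains N(y) alone. All vectors in these formulas are given by their g-pairings, so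
  one Gram-Schmidt argument with parameters yields both their existence and their smoothness.
  Agreement on overlaps does not come from transforming the explicit formulas: the coefficients of
  one chart are carried to another by the affine rule B' = J B - S, with J and S the first and
  second derivative of the coordinate change; they satisfy \<open>cartan_cond\<close> there, and
  uniqueness applies. The torsions become algebraic because all derivatives of sections cancel
  between D and the bracket.\<close>

abbreviation fder :: "('e::real_normed_vector \<Rightarrow> 'f::real_normed_vector) \<Rightarrow> 'e \<Rightarrow> 'e \<Rightarrow> 'f" where
  "fder f x \<equiv> frechet_derivative f (at x)"

lemma fder_eq: "(f has_derivative f') (at x) \<Longrightarrow> fder f x = f'"
  using frechet_derivative_at by metis

lemma fder_works: "f differentiable (at x) \<Longrightarrow> (f has_derivative fder f x) (at x)"
  using frechet_derivative_works by blast

lemma fder_cong: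
  assumes "open S" "x \<in> S" "\<And>y. y \<in> S \<Longrightarrow> f y = g y"
  shows "fder f x = fder g x"
proof -
  have "(f has_derivative f') (at x) \<longleftrightarrow> (g has_derivative f') (at x)" for f'
    using has_derivative_transform_within_open[of f f' x UNIV S g]
      has_derivative_transform_within_open[of g f' x UNIV S f] assms by auto
  then show ?thesis by (simp add: frechet_derivative_def)
qed

lemma differentiable_cong:
  assumes "open S" "x \<in> S" "\<And>y. y \<in> S \<Longrightarrow> f y = g y" "f differentiable (at x)"
  shows "g differentiable (at x)"
  using assms has_derivative_transform_within_open[of f _ x UNIV S g]
  unfolding differentiable_def by blast

lemma Ck_on_cong:
  assumes "open S" "\<And>y. y \<in> S \<Longrightarrow> f y = g y"
  shows "Ck_on k f S = Ck_on k g S"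
  using assms
proof (induction k arbitrary: f g)
  case 0
  then show ?case by (simp cong: continuous_on_cong)
next
  case (Suc k)
  have "(\<forall>x\<in>S. f differentiable (at x)) = (\<forall>x\<in>S. g differentiable (at x))"
    using differentiable_cong[OF Suc.prems(1), of _ f g] differentiable_cong[OF Suc.prems(1), of _ g f]
      Suc.prems(2) by auto
  moreover have "Ck_on k (\<lambda>x. fder f x h) S = Ck_on k (\<lambda>x. fder g x h) S" for h
    by (rule Suc.IH) (use Suc.prems fder_cong[OF Suc.prems(1), of _ f g] in auto)
  ultimately show ?case by simp
qed

lemma Ck_on_subset: "Ck_on k f S \<Longrightarrow> T \<subseteq> S \<Longrightarrow> Ck_on k f T"
  by (induction k arbitrary: f) (auto intro: continuous_on_subset)

lemma Ck_on_Suc_imp: "Ck_on (Suc k) f S \<Longrightarrow> Ck_on k f S"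
proof (induction k arbitrary: f)
  case 0
  then show ?case
    by (simp add: differentiable_imp_continuous_on differentiable_on_def differentiable_at_withinI)
next
  case (Suc k)
  have "Ck_on (Suc k) (\<lambda>x. fder f x h) S" for h
    using Suc.prems unfolding Ck_on.simps(2)[of "Suc k"] by blast
  then have "Ck_on k (\<lambda>x. fder f x h) S" for h by (rule Suc.IH)
  then show ?case using Suc.prems by simp
qed

text \<open>The derivatives in \<open>Ck_on\<close> are taken \<open>at x\<close> without
  restriction to \<open>S\<close>, so they can be read off in any neighbourhood of \<open>x\<close>;
  only the continuity at the bottom of the recursion is relative to \<open>S\<close>.\<close>

lemma Ck_on_local:
  assumes "\<And>x. x \<in> S \<Longrightarrow> \<exists>U. open U \<and> x \<in> U \<and> Ck_on k f U"
  shows "Ck_on k f S"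
  using assms
proof (induction k arbitrary: f)
  case 0
  have "continuous (at x within S) f" if "x \<in> S" for x
    using 0[OF that] by (auto intro: continuous_at_imp_continuous_at_within
        simp: continuous_on_eq_continuous_at)
  then show ?case by (simp add: continuous_on_eq_continuous_within)
next
  case (Suc k)
  have "f differentiable (at x)" if "x \<in> S" for x
    using Suc.prems[OF that] by auto
  moreover have "Ck_on k (\<lambda>x. fder f x h) S" for h
  proof (rule Suc.IH)
    fix x assume "x \<in> S"
    then obtain U where "open U" "x \<in> U" "Ck_on (Suc k) f U" using Suc.prems by blast
    then show "\<exists>U. open U \<and> x \<in> U \<and> Ck_on k (\<lambda>x. fder f x h) U" by auto
  qed
  ultimately show ?case by simp
qed

lemma Ck_on_SucI:
  assumes "open S" "\<And>x. x \<in> S \<Longrightarrow> (f has_derivative f' x) (at x)"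
    and "\<And>h. Ck_on k (\<lambda>x. f' x h) S"
  shows "Ck_on (Suc k) f S"
proof -
  have "Ck_on k (\<lambda>x. fder f x h) S = Ck_on k (\<lambda>x. f' x h) S" for h
    by (rule Ck_on_cong[OF assms(1)]) (simp add: fder_eq[OF assms(2)])
  then show ?thesis using assms(2,3) by (auto simp: differentiable_def)
qed

lemma Ck_on_const: "Ck_on k (\<lambda>x. c) S"
  by (induction k arbitrary: c) auto

lemma Ck_on_bounded_linear:
  assumes "bounded_linear L" "open S" "Ck_on k f S"
  shows "Ck_on k (\<lambda>x. L (f x)) S"
  using assms(3)
proof (induction k arbitrary: f)
  case 0
  then show ?case using bounded_linear.continuous_on[OF assms(1)] by auto
next
  case (Suc k)
  have d: "((\<lambda>x. L (f x)) has_derivative (\<lambda>h. L (fder f x h))) (at x)" if "x \<in> S" for x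
    using Suc.prems that by (auto intro!: bounded_linear.has_derivative[OF assms(1)] fder_works)
  show ?case
    by (rule Ck_on_SucI[OF assms(2) d]) (use Suc.IH[of "\<lambda>x. fder f x _"] Suc.prems in simp_all)
qed

lemma Ck_on_add:
  assumes "open S" "Ck_on k f S" "Ck_on k g S"
  shows "Ck_on k (\<lambda>x. f x + g x) S"
  using assms(2,3)
proof (induction k arbitrary: f g)
  case 0
  then show ?case by (auto intro: continuous_on_add)
next
  case (Suc k)
  have d: "((\<lambda>x. f x + g x) has_derivative (\<lambda>h. fder f x h + fder g x h)) (at x)"
    if "x \<in> S" for x
    using Suc.prems that by (auto intro!: has_derivative_add fder_works)
  show ?case
    by (rule Ck_on_SucI[OF assms(1) d])
       (use Suc.IH[of "\<lambda>x. fder f x _" "\<lambda>x. fder g x _"] Suc.prems in simp_all)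
qed

lemma Ck_on_bounded_bilinear:
  assumes "bounded_bilinear P" "open S" "Ck_on k f S" "Ck_on k g S"
  shows "Ck_on k (\<lambda>x. P (f x) (g x)) S"
  using assms(3,4)
proof (induction k arbitrary: f g)
  case 0
  then show ?case using bounded_bilinear.continuous_on[OF assms(1)] by auto
next
  case (Suc k)
  have d: "((\<lambda>x. P (f x) (g x)) has_derivative
      (\<lambda>h. P (f x) (fder g x h) + P (fder f x h) (g x))) (at x)" if "x \<in> S" for x
    using Suc.prems that
    by (auto intro!: bounded_bilinear.FDERIV[OF assms(1)] fder_works)
  show ?case
  proof (rule Ck_on_SucI[OF assms(2) d])
    fix h
    have "Ck_on k (\<lambda>x. P (f x) (fder g x h)) S" "Ck_on k (\<lambda>x. P (fder f x h) (g x)) S"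
      using Suc.IH[OF Ck_on_Suc_imp[OF Suc.prems(1)], of "\<lambda>x. fder g x h"]
        Suc.IH[OF _ Ck_on_Suc_imp[OF Suc.prems(2)], of "\<lambda>x. fder f x h"] Suc.prems by simp_all
    then show "Ck_on k (\<lambda>x. P (f x) (fder g x h) + P (fder f x h) (g x)) S"
      by (rule Ck_on_add[OF assms(2)])
  qed simp_all
qed

lemma Ck_on_id: "Ck_on k (\<lambda>x. x) S"
proof (cases k)
  case (Suc j)
  then show ?thesis by (simp add: Ck_on_const)
qed auto

lemma Ck_on_sum:
  assumes "open S" "\<And>i. i \<in> I \<Longrightarrow> Ck_on k (f i) S"
  shows "Ck_on k (\<lambda>x. \<Sum>i\<in>I. f i x) S"
  using assms(2)
proof (induction I rule: infinite_finite_induct)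
  case (insert i I)
  then show ?case using Ck_on_add[OF assms(1), of k "f i" "\<lambda>x. \<Sum>i\<in>I. f i x"] by simp
qed (auto simp: Ck_on_const)

text \<open>The derivative of 1/f is a product of 1/f, the derivative of f and 1/f again, so the
  induction on \<open>k\<close> closes.\<close>

lemma Ck_on_inverse:
  fixes f :: "'e::euclidean_space \<Rightarrow> real"
  assumes "open S" "Ck_on k f S" "\<And>x. x \<in> S \<Longrightarrow> f x \<noteq> 0"
  shows "Ck_on k (\<lambda>x. inverse (f x)) S"
  using assms(2)
proof (induction k)
  case 0
  then show ?case using assms(3) by (auto intro: continuous_on_inverse)
next
  case (Suc k)
  have d: "((\<lambda>x. inverse (f x)) has_derivative
      (\<lambda>h. - (inverse (f x) * fder f x h * inverse (f x)))) (at x)" if "x \<in> S" for x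
    using Suc.prems that assms(3) by (auto intro!: Deriv.has_derivative_inverse fder_works)
  show ?case
  proof (rule Ck_on_SucI[OF assms(1) d])
    fix h
    have *: "Ck_on k (\<lambda>x. inverse (f x)) S" using Suc Ck_on_Suc_imp by blast
    then have "Ck_on k (\<lambda>x. inverse (f x) * fder f x h) S"
      using Suc.prems by (auto intro!: Ck_on_bounded_bilinear[OF bounded_bilinear_mult assms(1)])
    then have "Ck_on k (\<lambda>x. inverse (f x) * fder f x h * inverse (f x)) S"
      by (rule Ck_on_bounded_bilinear[OF bounded_bilinear_mult assms(1) _ *])
    then show "Ck_on k (\<lambda>x. - (inverse (f x) * fder f x h * inverse (f x))) S"
      by (rule Ck_on_bounded_linear[OF bounded_linear_minus[OF bounded_linear_ident] assms(1)])
  qed simp_all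
qed

lemma linear_basis_expansion:
  assumes "linear F"
  shows "F w = (\<Sum>b\<in>Basis. (w \<bullet> b) *\<^sub>R F b)"
proof -
  have "F w = F (\<Sum>b\<in>Basis. (w \<bullet> b) *\<^sub>R b)" by (simp add: euclidean_representation)
  then show ?thesis
    using assms by (simp add: linear_sum linear_scale)
qed

text \<open>Expanding \<open>w\<close> in the basis reduces the moving argument to finitely many
  fixed ones. Asking for smoothness at each fixed \<open>v\<close> is the substitute used throughout
  for smoothness as a map into a space of operators.\<close>

lemma Ck_on_linear_family:
  fixes w :: "'e::euclidean_space \<Rightarrow> 'v::euclidean_space"
  assumes "open S" "\<And>q. q \<in> S \<Longrightarrow> linear (F q)" "\<And>v. Ck_on k (\<lambda>q. F q v) S" "Ck_on k w S"
  shows "Ck_on k (\<lambda>q. F q (w q)) S"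
proof -
  have "Ck_on k (\<lambda>q. w q \<bullet> b) S" for b
    by (rule Ck_on_bounded_linear[OF bounded_linear_inner_left assms(1,4)])
  then have "Ck_on k (\<lambda>q. (w q \<bullet> b) *\<^sub>R F q b) S" for b
    by (rule Ck_on_bounded_bilinear[OF bounded_bilinear_scaleR assms(1) _ assms(3)])
  then have "Ck_on k (\<lambda>q. \<Sum>b\<in>Basis. (w q \<bullet> b) *\<^sub>R F q b) S"
    by (rule Ck_on_sum[OF assms(1)])
  moreover have "Ck_on k (\<lambda>q. F q (w q)) S = Ck_on k (\<lambda>q. \<Sum>b\<in>Basis. (w q \<bullet> b) *\<^sub>R F q b) S"
    by (rule Ck_on_cong[OF assms(1)]) (rule linear_basis_expansion[OF assms(2)])
  ultimately show ?thesis by simp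
qed

text \<open>By the chain rule the derivative of the composite is the linear family
  \<open>fder f (g x)\<close> evaluated at the moving vector \<open>fder g x h\<close>; the
  induction hypothesis handles the family at fixed vectors.\<close>

lemma Ck_on_compose:
  fixes g :: "'e::euclidean_space \<Rightarrow> 'v::euclidean_space"
  assumes "open S" "open T" "Ck_on k g S" "Ck_on k f T" "g ` S \<subseteq> T"
  shows "Ck_on k (\<lambda>x. f (g x)) S"
  using assms(3,4)
proof (induction k arbitrary: f)
  case 0
  then show ?case using assms(5) continuous_on_compose2[of T f S g] by auto
next
  case (Suc k)
  have d: "((\<lambda>x. f (g x)) has_derivative (\<lambda>h. fder f (g x) (fder g x h))) (at x)"
    if "x \<in> S" for x
    using diff_chain_at[of g "fder g x" x f "fder f (g x)"] Suc.prems that assms(5)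
    by (auto intro!: fder_works simp: o_def)
  show ?case
  proof (rule Ck_on_SucI[OF assms(1) d])
    fix h
    show "Ck_on k (\<lambda>x. fder f (g x) (fder g x h)) S"
    proof (rule Ck_on_linear_family[OF assms(1)])
      show "linear (fder f (g q))" if "q \<in> S" for q
        using Suc.prems that assms(5) by (auto intro!: linear_frechet_derivative)
      show "Ck_on k (\<lambda>q. fder f (g q) v) S" for v
        using Suc.IH[of "\<lambda>z. fder f z v"] Ck_on_Suc_imp[OF Suc.prems(1)] Suc.prems(2) by simp
    qed (use Suc.prems in auto)
  qed simp_all
qed

section \<open>Closure properties of smooth maps\<close>

lemma smooth_on_cong:
  "open S \<Longrightarrow> (\<And>y. y \<in> S \<Longrightarrow> f y = g y) \<Longrightarrow> smooth_on f S = smooth_on g S"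
  using Ck_on_cong[of S f g] unfolding smooth_on_def by blast

lemma smooth_on_eqI:
  assumes "open S" "smooth_on g S" "\<And>y. y \<in> S \<Longrightarrow> f y = g y"
  shows "smooth_on f S"
  using smooth_on_cong[OF assms(1), of f g] assms(2,3) by blast

lemma smooth_on_subset: "smooth_on f S \<Longrightarrow> T \<subseteq> S \<Longrightarrow> smooth_on f T"
  unfolding smooth_on_def by (blast intro: Ck_on_subset)

lemma smooth_on_local:
  assumes "\<And>x. x \<in> S \<Longrightarrow> \<exists>U. open U \<and> x \<in> U \<and> smooth_on f U"
  shows "smooth_on f S"
  unfolding smooth_on_def
proof
  show "Ck_on k f S" for k
    by (rule Ck_on_local) (use assms in \<open>force simp: smooth_on_def\<close>)
qed

lemma smooth_on_const [simp]: "smooth_on (\<lambda>x. c) S"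
  by (simp add: smooth_on_def Ck_on_const)

lemma smooth_on_id [simp]: "smooth_on (\<lambda>x. x) S"
  by (simp add: smooth_on_def Ck_on_id)

lemma smooth_on_bounded_linear:
  "bounded_linear L \<Longrightarrow> open S \<Longrightarrow> smooth_on f S \<Longrightarrow> smooth_on (\<lambda>x. L (f x)) S"
  using Ck_on_bounded_linear[of L S _ f] unfolding smooth_on_def by blast

lemma smooth_on_bounded_bilinear:
  "bounded_bilinear P \<Longrightarrow> open S \<Longrightarrow> smooth_on f S \<Longrightarrow> smooth_on g S \<Longrightarrow>
   smooth_on (\<lambda>x. P (f x) (g x)) S"
  using Ck_on_bounded_bilinear[of P S _ f g] unfolding smooth_on_def by blast

lemma smooth_on_add:
  "open S \<Longrightarrow> smooth_on f S \<Longrightarrow> smooth_on g S \<Longrightarrow> smooth_on (\<lambda>x. f x + g x) S"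
  using Ck_on_add[of S _ f g] unfolding smooth_on_def by blast

lemma smooth_on_minus: "open S \<Longrightarrow> smooth_on f S \<Longrightarrow> smooth_on (\<lambda>x. - f x) S"
  by (rule smooth_on_bounded_linear[OF bounded_linear_minus[OF bounded_linear_ident]])

lemma smooth_on_diff:
  "open S \<Longrightarrow> smooth_on f S \<Longrightarrow> smooth_on g S \<Longrightarrow> smooth_on (\<lambda>x. f x - g x) S"
  using smooth_on_add[of S f "\<lambda>x. - g x"] smooth_on_minus[of S g] by simp

lemma smooth_on_scaleR:
  "open S \<Longrightarrow> smooth_on f S \<Longrightarrow> smooth_on g S \<Longrightarrow> smooth_on (\<lambda>x. f x *\<^sub>R g x) S"
  by (rule smooth_on_bounded_bilinear[OF bounded_bilinear_scaleR])

lemma smooth_on_mult: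
  fixes f g :: "'e::euclidean_space \<Rightarrow> real"
  shows "open S \<Longrightarrow> smooth_on f S \<Longrightarrow> smooth_on g S \<Longrightarrow> smooth_on (\<lambda>x. f x * g x) S"
  by (rule smooth_on_bounded_bilinear[OF bounded_bilinear_mult])

lemma smooth_on_divide:
  fixes f g :: "'e::euclidean_space \<Rightarrow> real"
  assumes "open S" "smooth_on f S" "smooth_on g S" "\<And>x. x \<in> S \<Longrightarrow> g x \<noteq> 0"
  shows "smooth_on (\<lambda>x. f x / g x) S"
  unfolding divide_inverse
proof (rule smooth_on_mult[OF assms(1,2)])
  show "smooth_on (\<lambda>x. inverse (g x)) S"
    using Ck_on_inverse[OF assms(1) _ assms(4)] assms(3) by (simp add: smooth_on_def)
qed

lemma smooth_on_inner:
  fixes f g :: "'e::euclidean_space \<Rightarrow> 'v::real_inner"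
  shows "open S \<Longrightarrow> smooth_on f S \<Longrightarrow> smooth_on g S \<Longrightarrow> smooth_on (\<lambda>x. f x \<bullet> g x) S"
  by (rule smooth_on_bounded_bilinear[OF bounded_bilinear_inner])

lemma smooth_on_Pair:
  assumes "open S" "smooth_on f S" "smooth_on g S"
  shows "smooth_on (\<lambda>x. (f x, g x)) S"
proof -
  have "bounded_linear (\<lambda>x. (x, 0))" "bounded_linear (\<lambda>x. (0, x))"
    by (auto intro!: bounded_linear_Pair bounded_linear_ident bounded_linear_zero)
  from smooth_on_add[OF assms(1) smooth_on_bounded_linear[OF this(1) assms(1,2)]
      smooth_on_bounded_linear[OF this(2) assms(1,3)]]
  show ?thesis by simp
qed

lemma smooth_on_compose:
  fixes g :: "'e::euclidean_space \<Rightarrow> 'v::euclidean_space"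
  shows "open S \<Longrightarrow> open T \<Longrightarrow> smooth_on g S \<Longrightarrow> smooth_on f T \<Longrightarrow> g ` S \<subseteq> T \<Longrightarrow>
   smooth_on (\<lambda>x. f (g x)) S"
  using Ck_on_compose[of S T _ g f] unfolding smooth_on_def by blast

lemma smooth_on_linear_family:
  fixes w :: "'e::euclidean_space \<Rightarrow> 'v::euclidean_space"
  assumes "open S" "\<And>q. q \<in> S \<Longrightarrow> linear (F q)" "\<And>v. smooth_on (\<lambda>q. F q v) S" "smooth_on w S"
  shows "smooth_on (\<lambda>q. F q (w q)) S"
  using Ck_on_linear_family[of S F _ w] assms unfolding smooth_on_def by blast

lemma smooth_on_differentiable: "smooth_on f S \<Longrightarrow> x \<in> S \<Longrightarrow> f differentiable (at x)"
  unfolding smooth_on_def by (drule spec[of _ "Suc 0"]) simp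

lemma smooth_on_has_derivative:
  "smooth_on f S \<Longrightarrow> x \<in> S \<Longrightarrow> (f has_derivative fder f x) (at x)"
  using smooth_on_differentiable fder_works by blast

lemma smooth_on_linear_fder: "smooth_on f S \<Longrightarrow> x \<in> S \<Longrightarrow> linear (fder f x)"
  using smooth_on_differentiable linear_frechet_derivative by blast

lemma smooth_on_continuous: "smooth_on f S \<Longrightarrow> continuous_on S f"
  unfolding smooth_on_def by (drule spec[of _ 0]) simp

lemma smooth_on_fder: "smooth_on f S \<Longrightarrow> smooth_on (\<lambda>x. fder f x h) S"
  unfolding smooth_on_def
proof
  show "Ck_on k (\<lambda>x. fder f x h) S" if "\<forall>k. Ck_on k f S" for k
    using spec[OF that, of "Suc k"] by simp
qed

lemma smooth_on_fder_apply:
  fixes w :: "'e::euclidean_space \<Rightarrow> 'e"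
  assumes "open S" "smooth_on f S" "smooth_on w S"
  shows "smooth_on (\<lambda>x. fder f x (w x)) S"
  by (rule smooth_on_linear_family)
     (use assms in \<open>auto intro: smooth_on_linear_fder smooth_on_fder\<close>)

lemma smooth_on_linear:
  fixes L :: "'e::euclidean_space \<Rightarrow> 'f::real_normed_vector"
  assumes "linear L" "open S"
  shows "smooth_on L S"
  using smooth_on_bounded_linear[of L S "\<lambda>x. x"] linear_conv_bounded_linear assms by auto

text \<open>The family over all \<open>n\<close> is closed under differentiation: the derivative of
  h_n is h_(n+2) - n h_(n+1). Hence differentiability of all members gives smoothness of each. At 0
  the difference quotient of h_n is h_(n+1), which tends to 0 since the exponential beats every
  power.\<close>

lemma smooth_on_inverse_fun_exp:
  shows "smooth_on (\<lambda>t. if t \<le> 0 then 0 else exp (- inverse t) * inverse t ^ n :: real) UNIV"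
proof -
  define h :: "nat \<Rightarrow> real \<Rightarrow> real"
    where "h n t = (if t \<le> 0 then 0 else exp (- inverse t) * inverse t ^ n)" for n t
  have lim: "(h n \<longlongrightarrow> 0) (at 0)" for n
  proof -
    have "((\<lambda>x. x ^ n / exp x) \<longlongrightarrow> (0::real)) at_top" by (rule tendsto_power_div_exp_0)
    then have "((\<lambda>t. inverse t ^ n / exp (inverse t)) \<longlongrightarrow> (0::real)) (at_right 0)"
      by (rule filterlim_compose[OF _ filterlim_inverse_at_top_right])
    moreover have "\<forall>\<^sub>F t in at_right 0. inverse t ^ n / exp (inverse t) = h n t"
      unfolding eventually_at_filter h_def by (auto simp: exp_minus divide_inverse mult.commute)
    ultimately have r: "(h n \<longlongrightarrow> 0) (at_right 0)"
      using tendsto_cong by force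
    have "\<forall>\<^sub>F t in at_left 0. 0 = h n t" unfolding eventually_at_filter h_def by auto
    then have l: "(h n \<longlongrightarrow> 0) (at_left 0)" by (rule tendsto_eventually[OF eventually_mono]) auto
    show ?thesis using filterlim_split_at[OF l r] .
  qed
  have deriv: "(h n has_real_derivative (h (n + 2) t - real n * h (n + 1) t)) (at t)" for n t
  proof -
    consider "t < 0" | "t = 0" | "t > 0" by linarith
    then show ?thesis
    proof cases
      case 1
      have "((\<lambda>t. 0) has_real_derivative 0) (at t)" by simp
      then have "(h n has_real_derivative 0) (at t)"
        by (rule has_field_derivative_transform_within_open[where S="{..<0}"]) (use 1 in \<open>auto simp: h_def\<close>)
      then show ?thesis using 1 by (simp add: h_def)
    next
      case 2
      have "(\<lambda>x. (h n x - h n 0) / (x - 0)) \<midarrow>0\<rightarrow> 0"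
        using lim[of "Suc n"]
        by (rule Lim_transform_eventually)
           (auto simp: eventually_at_filter h_def divide_inverse)
      then show ?thesis using 2 by (simp add: has_field_derivative_iff h_def)
    next
      case 3
      have "((\<lambda>t. exp (- inverse t) * inverse t ^ n) has_real_derivative
          (h (n + 2) t - real n * h (n + 1) t)) (at t)"
        using 3
        by (auto intro!: derivative_eq_intros simp: h_def field_simps power2_eq_square)
           (cases n; simp add: field_simps)
      then show ?thesis
        by (rule has_field_derivative_transform_within_open[where S="{0<..}"]) (use 3 in \<open>auto simp: h_def\<close>)
    qed
  qed
  have hd: "(h n has_derivative (\<lambda>s. (h (n + 2) t - real n * h (n + 1) t) * s)) (at t)" for n t
    using deriv[of n t] by (simp add: has_field_derivative_def)
  have "Ck_on k (h n) UNIV" for k n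
  proof (induction k arbitrary: n)
    case 0
    then show ?case
      using hd has_derivative_continuous by (fastforce simp: continuous_on_eq_continuous_at)
  next
    case (Suc k)
    have "Ck_on k (\<lambda>t. (h (n + 2) t + - (real n * h (n + 1) t)) * s) UNIV" for s
      by (intro Ck_on_bounded_linear[where L="\<lambda>x. x * s"] Ck_on_add Suc
          Ck_on_bounded_linear[where L="\<lambda>x. - (real n * x)"] bounded_linear_minus
          bounded_linear_mult_right bounded_linear_mult_left) auto
    then show ?case using hd by (auto simp: fder_eq[OF hd] differentiable_def)
  qed
  then show ?thesis by (simp add: smooth_on_def h_def[abs_def])
qed

text \<open>The flat exponential is composed with \<open>Q\<close>, which is negative outside the
  ball and critical at \<open>x0\<close>. The vanishing derivative at \<open>x0\<close> is what
  later makes the bump function drop out of Leibniz rules at that point.\<close>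

lemma smooth_bump:
  fixes x0 :: "'e::euclidean_space"
  assumes "r > 0"
  obtains \<phi> :: "'e \<Rightarrow> real" where "smooth_on \<phi> UNIV" "\<phi> x0 = 1" "fder \<phi> x0 = (\<lambda>h. 0)"
    "\<And>x. x \<notin> cball x0 r \<Longrightarrow> \<phi> x = 0"
proof -
  define \<psi> where "\<psi> t = (if t \<le> 0 then 0 else exp (- inverse t) * inverse t ^ 0 :: real)" for t
  define Q where "Q x = r\<^sup>2 - (x - x0) \<bullet> (x - x0)" for x
  define \<phi> where "\<phi> x = inverse (\<psi> (r\<^sup>2)) *\<^sub>R \<psi> (Q x)" for x
  have sp: "smooth_on \<psi> UNIV" unfolding \<psi>_def[abs_def] by (rule smooth_on_inverse_fun_exp)
  have sq: "smooth_on Q UNIV" unfolding Q_def[abs_def]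
    by (intro smooth_on_diff smooth_on_inner smooth_on_const smooth_on_id open_UNIV)
  have dQ: "(Q has_derivative (\<lambda>h. 0)) (at x0)"
    unfolding Q_def[abs_def] by (auto intro!: derivative_eq_intros)
  have "(\<psi> has_derivative fder \<psi> (Q x0)) (at (Q x0))"
    by (rule smooth_on_has_derivative[OF sp]) simp
  from diff_chain_at[OF dQ this] have d: "((\<lambda>x. \<psi> (Q x)) has_derivative (\<lambda>h. 0)) (at x0)"
    using linear_0[OF smooth_on_linear_fder[OF sp UNIV_I, of "Q x0"]] by (simp add: o_def)
  show thesis
  proof
    show "smooth_on \<phi> UNIV" unfolding \<phi>_def[abs_def]
      by (intro smooth_on_scaleR smooth_on_const smooth_on_compose[OF _ _ sq sp]) auto
    show "\<phi> x0 = 1" using assms by (simp add: \<phi>_def Q_def \<psi>_def)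
    show "fder \<phi> x0 = (\<lambda>h. 0)"
      unfolding \<phi>_def[abs_def] by (rule fder_eq) (auto intro!: derivative_eq_intros d)
    show "\<phi> x = 0" if "x \<notin> cball x0 r" for x
    proof -
      have "r\<^sup>2 \<le> (norm (x - x0))\<^sup>2"
        using that assms by (intro power_mono) (auto simp: dist_norm norm_minus_commute)
      then show ?thesis by (simp add: \<phi>_def Q_def \<psi>_def power2_norm_eq_inner)
    qed
  qed
qed

section \<open>Symmetry of second derivatives\<close>

lemma smooth_on_has_real_derivative_along:
  fixes f :: "'e::euclidean_space \<Rightarrow> real"
  assumes "smooth_on f S" "p + t *\<^sub>R v \<in> S"
  shows "((\<lambda>t. f (p + t *\<^sub>R v)) has_real_derivative fder f (p + t *\<^sub>R v) v) (at t)"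
proof -
  have "((\<lambda>t. p + t *\<^sub>R v) has_derivative (\<lambda>s. s *\<^sub>R v)) (at t)"
    by (auto intro!: derivative_eq_intros)
  from diff_chain_at[OF this smooth_on_has_derivative[OF assms]]
  show ?thesis
    using linear_scale[OF smooth_on_linear_fder[OF assms]]
    by (simp add: o_def has_field_derivative_def mult_commute_abs)
qed

text \<open>The mean value theorem is used twice: in direction \<open>h\<close> for the difference
  \<Phi> of two translates, then in direction \<open>k\<close> for the derivative so
  obtained.\<close>

lemma second_difference:
  fixes f :: "'e::euclidean_space \<Rightarrow> real"
  assumes "smooth_on f S" "s > 0"
    and "\<And>a b. 0 \<le> a \<Longrightarrow> a \<le> s \<Longrightarrow> 0 \<le> b \<Longrightarrow> b \<le> s \<Longrightarrow> x + a *\<^sub>R h + b *\<^sub>R k \<in> S"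
  obtains a b where "0 \<le> a" "a \<le> s" "0 \<le> b" "b \<le> s"
    "f (x + s *\<^sub>R h + s *\<^sub>R k) - f (x + s *\<^sub>R h) - f (x + s *\<^sub>R k) + f x
     = s * s * fder (\<lambda>z. fder f z h) (x + a *\<^sub>R h + b *\<^sub>R k) k"
proof -
  define \<Phi> where "\<Phi> a = f (x + a *\<^sub>R h + s *\<^sub>R k) - f (x + a *\<^sub>R h)" for a
  have "\<exists>a. 0 < a \<and> a < s \<and>
      \<Phi> s - \<Phi> 0 = (s - 0) * (fder f (x + a *\<^sub>R h + s *\<^sub>R k) h - fder f (x + a *\<^sub>R h) h)"
  proof (rule MVT2[OF assms(2)])
    fix a assume a: "0 \<le> a" "a \<le> s"
    have 1: "x + s *\<^sub>R k + a *\<^sub>R h \<in> S" "x + a *\<^sub>R h \<in> S"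
      using assms(3)[of a s] assms(3)[of a 0] assms(2) a by (auto simp: algebra_simps)
    have "((\<lambda>a. f (x + s *\<^sub>R k + a *\<^sub>R h) - f (x + a *\<^sub>R h)) has_real_derivative
        fder f (x + s *\<^sub>R k + a *\<^sub>R h) h - fder f (x + a *\<^sub>R h) h) (at a)"
      by (intro DERIV_diff smooth_on_has_real_derivative_along[OF assms(1)] 1)
    then show "(\<Phi> has_real_derivative
        fder f (x + a *\<^sub>R h + s *\<^sub>R k) h - fder f (x + a *\<^sub>R h) h) (at a)"
      by (simp add: \<Phi>_def[abs_def] add.assoc add.commute add.left_commute)
  qed
  then obtain a where a: "0 < a" "a < s"
    "\<Phi> s - \<Phi> 0 = s * (fder f (x + a *\<^sub>R h + s *\<^sub>R k) h - fder f (x + a *\<^sub>R h) h)" by auto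
  have "\<exists>b. 0 < b \<and> b < s \<and>
      fder f (x + a *\<^sub>R h + s *\<^sub>R k) h - fder f (x + a *\<^sub>R h + 0 *\<^sub>R k) h
        = (s - 0) * fder (\<lambda>z. fder f z h) (x + a *\<^sub>R h + b *\<^sub>R k) k"
    by (rule MVT2[OF assms(2)])
       (use a assms in \<open>auto intro!: smooth_on_has_real_derivative_along[OF smooth_on_fder]\<close>)
  then obtain b where b: "0 < b" "b < s" "fder f (x + a *\<^sub>R h + s *\<^sub>R k) h - fder f (x + a *\<^sub>R h) h
        = s * fder (\<lambda>z. fder f z h) (x + a *\<^sub>R h + b *\<^sub>R k) k" by auto
  show thesis
    by (rule that[of a b]) (use a b in \<open>auto simp: \<Phi>_def algebra_simps\<close>)
qed

text \<open>One and the same second difference is \<open>s * s\<close> times either mixed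
  derivative, each taken at some point of a small parallelogram at \<open>x\<close>; continuity of
  both derivatives then forces equality at \<open>x\<close>.\<close>

lemma fder_fder_commute_real:
  fixes f :: "'e::euclidean_space \<Rightarrow> real"
  assumes "open S" "smooth_on f S" "x \<in> S"
  shows "fder (\<lambda>z. fder f z h) x k = fder (\<lambda>z. fder f z k) x h"
proof -
  define P where "P z = fder (\<lambda>z. fder f z h) z k" for z
  define Q where "Q z = fder (\<lambda>z. fder f z k) z h" for z
  have cP: "continuous_on S P" and cQ: "continuous_on S Q"
    unfolding P_def[abs_def] Q_def[abs_def]
    using assms smooth_on_fder smooth_on_continuous by metis+
  have "\<bar>P x - Q x\<bar> \<le> e + e" if "e > 0" for e
  proof -
    obtain d1 where d1: "d1 > 0" "\<And>z. z \<in> S \<Longrightarrow> dist z x < d1 \<Longrightarrow> dist (P z) (P x) < e"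
      using cP assms(3) \<open>e > 0\<close> unfolding continuous_on_iff by metis
    obtain d2 where d2: "d2 > 0" "\<And>z. z \<in> S \<Longrightarrow> dist z x < d2 \<Longrightarrow> dist (Q z) (Q x) < e"
      using cQ assms(3) \<open>e > 0\<close> unfolding continuous_on_iff by metis
    obtain d3 where d3: "d3 > 0" "ball x d3 \<subseteq> S"
      using assms openE by blast
    define d where "d = min d1 (min d2 d3)"
    \<comment> \<open>With this side length the parallelogram spanned by
      \<open>s *\<^sub>R h\<close> and \<open>s *\<^sub>R k\<close> lies within distance d/2 of
      \<open>x\<close>; the summand 1 keeps the denominator positive when \<open>h\<close> and
      \<open>k\<close> vanish.\<close>
    define s where "s = d / (2 * (norm h + norm k + 1))"
    have pos: "norm h + norm k + 1 > 0" by (smt (verit) norm_ge_zero)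
    have "d > 0" using d1 d2 d3 by (simp add: d_def)
    then have "s > 0" using pos by (simp add: s_def)
    have sd: "s * (norm h + norm k + 1) < d"
    proof -
      have "s * (norm h + norm k + 1) = d / 2" using pos unfolding s_def by (simp add: field_simps)
      then show ?thesis using \<open>d > 0\<close> by simp
    qed
    have near: "dist (x + a *\<^sub>R u + b *\<^sub>R v) x < d"
      if "0 \<le> a" "a \<le> s" "0 \<le> b" "b \<le> s" "norm u + norm v = norm h + norm k" for a b u v
    proof -
      have "dist (x + a *\<^sub>R u + b *\<^sub>R v) x = norm (a *\<^sub>R u + b *\<^sub>R v)" by (simp add: dist_norm)
      also have "\<dots> \<le> a * norm u + b * norm v"
        using norm_triangle_ineq[of "a *\<^sub>R u" "b *\<^sub>R v"] that by simp
      also have "\<dots> \<le> s * norm u + s * norm v"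
        using that by (intro add_mono mult_right_mono) auto
      also have "\<dots> = s * (norm h + norm k)" using that(5) by (metis distrib_left)
      also have "\<dots> \<le> s * (norm h + norm k + 1)" using \<open>s > 0\<close> by simp
      finally show ?thesis using sd by linarith
    qed
    have inS: "x + a *\<^sub>R u + b *\<^sub>R v \<in> S"
      if "0 \<le> a" "a \<le> s" "0 \<le> b" "b \<le> s" "norm u + norm v = norm h + norm k" for a b u v
      using near[OF that] d3 by (auto simp: d_def dist_commute)
    obtain a b where ab: "0 \<le> a" "a \<le> s" "0 \<le> b" "b \<le> s"
      "f (x + s *\<^sub>R h + s *\<^sub>R k) - f (x + s *\<^sub>R h) - f (x + s *\<^sub>R k) + f x
       = s * s * P (x + a *\<^sub>R h + b *\<^sub>R k)"
      unfolding P_def by (rule second_difference[OF assms(2) \<open>s > 0\<close>, of x h k]) (auto intro: inS)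
    obtain a' b' where ab': "0 \<le> a'" "a' \<le> s" "0 \<le> b'" "b' \<le> s"
      "f (x + s *\<^sub>R k + s *\<^sub>R h) - f (x + s *\<^sub>R k) - f (x + s *\<^sub>R h) + f x
       = s * s * Q (x + a' *\<^sub>R k + b' *\<^sub>R h)"
      unfolding Q_def by (rule second_difference[OF assms(2) \<open>s > 0\<close>, of x k h]) (auto intro: inS)
    have "f (x + s *\<^sub>R k + s *\<^sub>R h) - f (x + s *\<^sub>R k) - f (x + s *\<^sub>R h) + f x
        = f (x + s *\<^sub>R h + s *\<^sub>R k) - f (x + s *\<^sub>R h) - f (x + s *\<^sub>R k) + f x"
      by (simp add: add.assoc add.commute[of "s *\<^sub>R k"])
    then have "s * s * P (x + a *\<^sub>R h + b *\<^sub>R k) = s * s * Q (x + a' *\<^sub>R k + b' *\<^sub>R h)"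
      using ab(5) ab'(5) by auto
    then have PQ: "P (x + a *\<^sub>R h + b *\<^sub>R k) = Q (x + a' *\<^sub>R k + b' *\<^sub>R h)"
      using \<open>s > 0\<close> by simp
    have "dist (P (x + a *\<^sub>R h + b *\<^sub>R k)) (P x) < e"
      using near[OF ab(1-4), of h k] inS[OF ab(1-4), of h k] by (intro d1) (auto simp: d_def)
    moreover have "dist (Q (x + a' *\<^sub>R k + b' *\<^sub>R h)) (Q x) < e"
      using near[OF ab'(1-4), of k h] inS[OF ab'(1-4), of k h] by (intro d2) (auto simp: d_def)
    ultimately show ?thesis using PQ by (simp add: dist_real_def)
  qed
  then have "\<bar>P x - Q x\<bar> \<le> e" if "e > 0" for e
    using that by (metis field_sum_of_halves half_gt_zero)
  then have "\<bar>P x - Q x\<bar> \<le> 0" by (metis dense_ge)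
  then show ?thesis by (simp add: P_def Q_def)
qed

lemma fder_fder_commute:
  fixes f :: "'e::euclidean_space \<Rightarrow> 'f::euclidean_space"
  assumes "open S" "smooth_on f S" "x \<in> S"
  shows "fder (\<lambda>z. fder f z h) x k = fder (\<lambda>z. fder f z k) x h"
proof (rule euclidean_eqI)
  fix b :: 'f
  have inner: "fder (\<lambda>z. F z \<bullet> b) z v = fder F z v \<bullet> b" if "smooth_on F S" "z \<in> S" for F z v
    using fder_eq[OF has_derivative_inner_left[OF smooth_on_has_derivative[OF that], of b]] by simp
  have sm: "smooth_on (\<lambda>z. f z \<bullet> b) S"
    using assms by (intro smooth_on_inner) auto
  have *: "fder (\<lambda>z. fder f z v) x w \<bullet> b = fder (\<lambda>z. fder (\<lambda>z. f z \<bullet> b) z v) x w" for v w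
    using inner[OF smooth_on_fder[OF assms(2)] assms(3)]
      fder_cong[OF assms(1,3), of "\<lambda>z. fder (\<lambda>z. f z \<bullet> b) z v" "\<lambda>z. fder f z v \<bullet> b"]
      inner[OF assms(2)]
    by metis
  show "fder (\<lambda>z. fder f z h) x k \<bullet> b = fder (\<lambda>z. fder f z k) x h \<bullet> b"
    unfolding * by (rule fder_fder_commute_real[OF assms(1) sm assms(3)])
qed

section \<open>Linear systems depending smoothly on parameters\<close>

locale inner_form =
  fixes g :: "'e::euclidean_space \<Rightarrow> 'e \<Rightarrow> real"
  assumes g_linear: "linear (\<lambda>v. g v w)"
    and g_sym: "g v w = g w v"
    and g_pos: "v \<noteq> 0 \<Longrightarrow> g v v > 0"
begin

lemma g_simps:
  "g (u + v) w = g u w + g v w" "g w (u + v) = g w u + g w v"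
  "g (u - v) w = g u w - g v w" "g w (u - v) = g w u - g w v"
  "g (- v) w = - g v w" "g w (- v) = - g w v"
  "g (a *\<^sub>R v) w = a * g v w" "g w (a *\<^sub>R v) = a * g w v"
  "g 0 w = 0" "g w 0 = 0"
proof -
  show 1: "g (u + v) w = g u w + g v w" "g (u - v) w = g u w - g v w" "g (- v) w = - g v w"
    "g (a *\<^sub>R v) w = a * g v w" "g 0 w = 0" for u v w a
    using linear_add[OF g_linear[of w]] linear_diff[OF g_linear[of w]] linear_neg[OF g_linear[of w]]
      linear_scale[OF g_linear[of w]] linear_0[OF g_linear[of w]] by simp_all
  show "g w (u + v) = g w u + g w v" "g w (u - v) = g w u - g w v" "g w (- v) = - g w v"
    "g w (a *\<^sub>R v) = a * g w v" "g w 0 = 0"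
    by (simp_all add: g_sym[of w] 1)
qed

lemma g_linear2: "linear (g v)"
  by (rule linearI) (simp_all add: g_simps)

lemma g_cancel: "(\<And>Z. g v Z = g w Z) \<Longrightarrow> v = w"
  using g_pos[of "v - w"] by (auto simp: g_simps)

end

text \<open>Gram-Schmidt with parameters: each basis vector \<open>b\<close> is replaced by its
  component orthogonal to the span of the earlier ones, and the only division is by its squared
  length. The induction runs over all \<open>l\<close>, because the hypothesis is needed for
  \<open>l\<close> itself and for the functional \<open>g q b\<close>.\<close>

lemma smooth_on_solution_span:
  fixes g :: "'q::euclidean_space \<Rightarrow> 'e::euclidean_space \<Rightarrow> 'e \<Rightarrow> real"
  assumes "open S" "\<And>q. q \<in> S \<Longrightarrow> inner_form (g q)" "\<And>v w. smooth_on (\<lambda>q. g q v w) S"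
    and "finite B" "independent B"
    and "\<And>q. q \<in> S \<Longrightarrow> linear (l q)" "\<And>Z. smooth_on (\<lambda>q. l q Z) S"
  shows "\<exists>w. smooth_on w S \<and> (\<forall>q\<in>S. w q \<in> span B \<and> (\<forall>Z\<in>span B. g q (w q) Z = l q Z))"
  using assms(4-)
proof (induction B arbitrary: l rule: finite_induct)
  case empty
  have "g q 0 0 = l q 0" if "q \<in> S" for q
    using inner_form.g_simps(9)[OF assms(2)[OF that]] linear_0[OF empty(2)[OF that]] by simp
  then show ?case by (intro exI[of _ "\<lambda>q. 0"]) auto
next
  case (insert b B)
  have ind: "independent B" and bB: "b \<notin> span B"
    using insert.prems(1) insert.hyps by (auto simp: independent_insert)
  obtain w0 where w0: "smooth_on w0 S" "\<And>q. q \<in> S \<Longrightarrow> w0 q \<in> span B"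
    "\<And>q Z. q \<in> S \<Longrightarrow> Z \<in> span B \<Longrightarrow> g q (w0 q) Z = l q Z"
    using insert.IH[OF ind insert.prems(2,3)] by blast
  have gb_lin: "linear (g q b)" if "q \<in> S" for q
    by (rule inner_form.g_linear2[OF assms(2)[OF that]])
  obtain w1 where w1: "smooth_on w1 S" "\<And>q. q \<in> S \<Longrightarrow> w1 q \<in> span B"
    "\<And>q Z. q \<in> S \<Longrightarrow> Z \<in> span B \<Longrightarrow> g q (w1 q) Z = g q b Z"
    using insert.IH[OF ind gb_lin assms(3)] by blast
  \<comment> \<open>\<open>w1\<close> is the g-orthogonal projection of \<open>b\<close> to the span
    of \<open>B\<close>, so \<open>n\<close> is the normal to that span; it is nonzero because
    \<open>b\<close> is independent of \<open>B\<close>.\<close>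
  define n where "n q = b - w1 q" for q
  have n_smooth: "smooth_on n S" unfolding n_def[abs_def]
    by (intro smooth_on_diff w1 assms) auto
  have gn: "smooth_on (\<lambda>q. g q v (n q)) S" for v
  proof (rule smooth_on_linear_family[OF assms(1) _ assms(3) n_smooth])
    show "linear (g q v)" if "q \<in> S" for q
      by (rule inner_form.g_linear2[OF assms(2)[OF that]])
  qed
  have gnn: "smooth_on (\<lambda>q. g q (n q) (n q)) S"
    by (rule smooth_on_linear_family[OF assms(1) _ gn n_smooth])
       (rule inner_form.g_linear[OF assms(2)])
  have ln: "smooth_on (\<lambda>q. l q (n q)) S"
    by (rule smooth_on_linear_family[OF assms(1) insert.prems(2,3) n_smooth])
  have n0: "n q \<noteq> 0" if "q \<in> S" for q
    using w1(2)[OF that] bB by (auto simp: n_def)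
  have nn: "g q (n q) (n q) \<noteq> 0" if "q \<in> S" for q
    using inner_form.g_pos[OF assms(2)[OF that] n0[OF that]] by simp
  define w where "w q = w0 q + (l q (n q) / g q (n q) (n q)) *\<^sub>R n q" for q
  have "smooth_on w S" unfolding w_def[abs_def]
    by (intro smooth_on_add smooth_on_scaleR smooth_on_divide assms(1) w0 ln gnn nn n_smooth)
  moreover have "w q \<in> span (insert b B)" if "q \<in> S" for q
  proof -
    have "span B \<subseteq> span (insert b B)" by (rule span_mono) auto
    then show ?thesis unfolding w_def n_def using w0(2)[OF that] w1(2)[OF that]
      by (intro span_add span_scale span_diff) (auto intro: span_base)
  qed
  moreover have "g q (w q) Z = l q Z" if qS: "q \<in> S" and ZS: "Z \<in> span (insert b B)" for q Z
  proof -
    interpret inner_form "g q" by (rule assms(2)[OF qS])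
    obtain c where "Z - c *\<^sub>R b \<in> span B" using ZS by (auto simp: span_insert)
    define s where "s = Z - c *\<^sub>R n q"
    have s: "s \<in> span B"
    proof -
      have "s = (Z - c *\<^sub>R b) + c *\<^sub>R w1 q" by (simp add: s_def n_def algebra_simps)
      then show ?thesis using \<open>Z - c *\<^sub>R b \<in> span B\<close> w1(2)[OF qS]
        by (simp add: span_add span_scale)
    qed
    have perp: "g q (n q) t = 0" if "t \<in> span B" for t
      using w1(3)[OF qS that] by (simp add: n_def g_simps)
    have "g q (n q) s = 0" "g q (w0 q) (n q) = 0"
      using perp s w0(2)[OF qS] g_sym by metis+
    moreover have "Z = s + c *\<^sub>R n q" by (simp add: s_def)
    moreover have "l q (s + c *\<^sub>R n q) = l q s + c * l q (n q)"
      using linear_add[OF insert.prems(2)[OF qS]] linear_scale[OF insert.prems(2)[OF qS]]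
      by simp
    ultimately show ?thesis
      using nn[OF qS] w0(3)[OF qS s] by (simp add: w_def g_simps)
  qed
  ultimately show ?case by blast
qed

lemma smooth_on_solution:
  fixes g :: "'q::euclidean_space \<Rightarrow> 'e::euclidean_space \<Rightarrow> 'e \<Rightarrow> real"
  assumes "open S" "\<And>q. q \<in> S \<Longrightarrow> inner_form (g q)" "\<And>v w. smooth_on (\<lambda>q. g q v w) S"
    and "\<And>q. q \<in> S \<Longrightarrow> linear (l q)" "\<And>Z. smooth_on (\<lambda>q. l q Z) S"
  obtains w where "smooth_on w S" "\<And>q Z. q \<in> S \<Longrightarrow> g q (w q) Z = l q Z"
  using smooth_on_solution_span[OF assms(1-3) finite_Basis independent_Basis assms(4,5)] that
  by fastforce

definition riesz :: "('e::euclidean_space \<Rightarrow> 'e \<Rightarrow> real) \<Rightarrow> ('e \<Rightarrow> real) \<Rightarrow> 'e" where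
  "riesz g l = (SOME w. \<forall>Z. g w Z = l Z)"

lemma (in inner_form) g_riesz:
  assumes "linear l"
  shows "g (riesz g l) Z = l Z"
proof -
  \<comment> \<open>A single form is treated as a constant family over a dummy parameter.\<close>
  obtain w :: "real \<Rightarrow> 'e" where "\<And>q Z. q \<in> UNIV \<Longrightarrow> g (w q) Z = l Z"
    by (rule smooth_on_solution[of UNIV "\<lambda>_. g" "\<lambda>_. l"]) (use assms inner_form_axioms in auto)
  then have "\<exists>w. \<forall>Z. g w Z = l Z" by auto
  from someI_ex[OF this] show ?thesis unfolding riesz_def by blast
qed

text \<open>A vector is determined by its g-pairings, so \<open>w\<close> coincides with the smooth
  solution of the linear system having these pairings as right-hand side. This is how smoothness is
  proved for vectors defined by \<open>riesz\<close>.\<close>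

lemma smooth_on_of_form:
  fixes g :: "'q::euclidean_space \<Rightarrow> 'e::euclidean_space \<Rightarrow> 'e \<Rightarrow> real"
  assumes "open S" "\<And>q. q \<in> S \<Longrightarrow> inner_form (g q)" "\<And>v w. smooth_on (\<lambda>q. g q v w) S"
    and "\<And>Z. smooth_on (\<lambda>q. g q (w q) Z) S"
  shows "smooth_on w S"
proof -
  have lin: "linear (g q (w q))" if "q \<in> S" for q
    by (rule inner_form.g_linear2[OF assms(2)[OF that]])
  obtain w' where w': "smooth_on w' S" "\<And>q Z. q \<in> S \<Longrightarrow> g q (w' q) Z = g q (w q) Z"
    by (rule smooth_on_solution[OF assms(1-3) lin assms(4)]) (assumption | rule that)+
  have "w q = w' q" if "q \<in> S" for q
    by (rule inner_form.g_cancel[OF assms(2)[OF that]]) (simp add: w'(2)[OF that])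
  then show ?thesis using smooth_on_cong[OF assms(1), of w w'] w'(1) by simp
qed

section \<open>The connection coefficients at a point\<close>

definition vert :: "('e::euclidean_space \<Rightarrow> 'e \<Rightarrow> real) \<Rightarrow> ('e \<times> 'e \<Rightarrow> 'e \<Rightarrow> 'e \<Rightarrow> real) \<Rightarrow> 'e \<Rightarrow> 'e \<Rightarrow> 'e"
  where "vert g dg k v = riesz g (\<lambda>Z. dg (0, k) v Z / 2)"

text \<open>The value N(y), with all fibre derivatives of g gone by homogeneity. For A = 0 it
  consists of the formal Christoffel symbols of g contracted twice with y, that is, of the
  coefficients of the geodesic spray.\<close>

definition spray where
  "spray g dg A y = riesz g (\<lambda>Z. (2 * dg (y, 0) y Z - dg (Z, 0) y y) / 2
      - (2 * A y * g y Z - A Z * g y y) / 2)"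

text \<open>The Koszul expression with \<open>v = y\<close>. Of the three horizontal derivatives of
  g only the one along y keeps its fibre part, since the other two have y among their
  arguments.\<close>

definition nonlin where
  "nonlin g dg A y h = riesz g (\<lambda>Z.
      (dg (h, 0) y Z + dg (y, - spray g dg A y) h Z - dg (Z, 0) h y) / 2
      - (A h * g y Z + A y * g h Z - A Z * g h y) / 2)"

text \<open>The Koszul formula for a symmetric connection with derivative A(h) g of the metric, as
  for a Weyl connection; the coordinate derivatives are replaced by those along the horizontal
  vectors \<open>(h, - n h)\<close>.\<close>

definition christoffel where
  "christoffel g dg A n h v = riesz g (\<lambda>Z.
      (dg (h, - n h) v Z + dg (v, - n v) h Z - dg (Z, - n Z) h v) / 2
      - (A h * g v Z + A v * g h Z - A Z * g h v) / 2)"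

text \<open>The direction is split into the horizontal \<open>(h, - n h)\<close> and the vertical
  rest \<open>(0, k + n h)\<close>.\<close>

definition conn where
  "conn g dg A y \<xi> v = christoffel g dg A (nonlin g dg A y) (fst \<xi>) v
     + vert g dg (snd \<xi> + nonlin g dg A y (fst \<xi>)) v"

text \<open>\<open>g\<close> and \<open>dg\<close> stand for the metric and its derivative at a point of the slit bundle with
  fibre coordinate \<open>y\<close>, and \<open>B\<close> for the coefficients of a connection: (C1)--(C4) amount to these
  four clauses. A tangent vector \<open>(h, k)\<close> is horizontal if \<open>k + B (h, k) y = 0\<close>.\<close>

definition cartan_cond ::
  "('e::euclidean_space \<Rightarrow> 'e \<Rightarrow> real) \<Rightarrow> ('e \<times> 'e \<Rightarrow> 'e \<Rightarrow> 'e \<Rightarrow> real) \<Rightarrow> ('e \<Rightarrow> real) \<Rightarrow> 'e \<Rightarrow>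
   ('e \<times> 'e \<Rightarrow> 'e \<Rightarrow> 'e) \<Rightarrow> bool" where
  "cartan_cond g dg A y B \<longleftrightarrow>
     (\<forall>h k v w. k + B (h, k) y = 0 \<longrightarrow>
        dg (h, k) v w - g (B (h, k) v) w - g v (B (h, k) w) = A h * g v w) \<and>
     (\<forall>k v w. dg (0, k) v w - g (B (0, k) v) w - g v (B (0, k) w) = 0) \<and>
     (\<forall>h k h' k'. k + B (h, k) y = 0 \<longrightarrow> k' + B (h', k') y = 0 \<longrightarrow> B (h, k) h' = B (h', k') h) \<and>
     (\<forall>k v w. g (B (0, k) v) w = g (B (0, k) w) v)"

text \<open>The last assumption is the pointwise form of 0-homogeneity: the derivative of g along
  the fibre annihilates y. It is what breaks the circle between \<open>B\<close> and the nonlinear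
  connection.\<close>

locale cartan_data = inner_form g for g :: "'e::euclidean_space \<Rightarrow> 'e \<Rightarrow> real" +
  fixes dg :: "'e \<times> 'e \<Rightarrow> 'e \<Rightarrow> 'e \<Rightarrow> real" and A :: "'e \<Rightarrow> real" and y :: 'e
  assumes dg_linear1: "linear (\<lambda>\<xi>. dg \<xi> v w)"
    and dg_linear2: "linear (\<lambda>v. dg \<xi> v w)"
    and dg_sym: "dg \<xi> v w = dg \<xi> w v"
    and A_linear: "linear A"
    and dg_y: "dg (0, k) y w = 0"
begin

definition "P h v w = dg (h, 0) v w"
definition "V k v w = dg (0, k) v w"

lemma dg_split: "dg (h, k) v w = P h v w + V k v w"
  using linear_add[OF dg_linear1[of v w], of "(h, 0)" "(0, k)"] by (simp add: P_def V_def)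

lemma P_linear: "linear (\<lambda>h. P h v w)" "linear (\<lambda>v. P h v w)" "linear (P h v)"
  and V_linear: "linear (\<lambda>h. V h v w)" "linear (\<lambda>v. V h v w)" "linear (V h v)"
proof -
  have 1: "linear (\<lambda>h::'e. (h, 0::'e))" "linear (\<lambda>h::'e. (0::'e, h))" by (auto intro!: linearI)
  have 2: "linear (dg \<xi> v)" for \<xi> v
  proof -
    have "dg \<xi> v = (\<lambda>w. dg \<xi> w v)" by (rule ext) (rule dg_sym)
    then show ?thesis using dg_linear2 by simp
  qed
  show "linear (\<lambda>h. P h v w)" "linear (\<lambda>v. P h v w)" "linear (P h v)"
    "linear (\<lambda>h. V h v w)" "linear (\<lambda>v. V h v w)" "linear (V h v)"
    using linear_compose[OF 1(1) dg_linear1] linear_compose[OF 1(2) dg_linear1] dg_linear2 2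
    unfolding P_def[abs_def] V_def[abs_def] o_def by blast+
qed

lemma V_y: "V h y w = 0" "V h v y = 0"
  using dg_y dg_sym by (simp_all add: V_def)

lemmas P_simps = P_linear[THEN linear_add] P_linear[THEN linear_scale, unfolded real_scaleR_def]
  P_linear[THEN linear_0]
lemmas V_simps = V_linear[THEN linear_add] V_linear[THEN linear_scale, unfolded real_scaleR_def]
  V_linear[THEN linear_0] V_linear(1)[THEN linear_neg] V_y

lemma P_sym: "P h v w = P h w v" unfolding P_def by (rule dg_sym)
lemma V_sym: "V h v w = V h w v" unfolding V_def by (rule dg_sym)

lemma A_simps: "A (v + w) = A v + A w" "A (a *\<^sub>R v) = a * A v"
  using linear_add[OF A_linear] linear_scale[OF A_linear] by auto

lemmas lin = g_simps P_simps V_simps A_simps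

lemma g_vert: "g (vert g dg k v) Z = V k v Z / 2"
  unfolding vert_def by (subst g_riesz) (auto intro!: linearI simp: dg_split lin field_simps)

lemma g_spray: "g (spray g dg A y) Z = (2 * P y y Z - P Z y y) / 2 - (2 * A y * g y Z - A Z * g y y) / 2"
  unfolding spray_def by (subst g_riesz) (auto intro!: linearI simp: dg_split lin field_simps)

lemma g_nonlin: "g (nonlin g dg A y h) Z =
   (P h y Z + P y h Z - V (spray g dg A y) h Z - P Z h y) / 2
      - (A h * g y Z + A y * g h Z - A Z * g h y) / 2"
  unfolding nonlin_def by (subst g_riesz) (auto intro!: linearI simp: dg_split lin field_simps)

lemma g_christoffel:
  assumes "linear n"
  shows "g (christoffel g dg A n h v) Z =
     (P h v Z - V (n h) v Z + P v h Z - V (n v) h Z - P Z h v + V (n Z) h v) / 2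
      - (A h * g v Z + A v * g h Z - A Z * g h v) / 2"
  unfolding christoffel_def using linear_add[OF assms] linear_scale[OF assms]
  by (subst g_riesz) (auto intro!: linearI simp: dg_split lin field_simps)

lemma linear_nonlin: "linear (nonlin g dg A y)"
  by (rule linearI; rule g_cancel) (simp_all add: g_nonlin lin, simp_all add: field_simps)

lemma g_conn: "g (conn g dg A y (h, k) v) Z =
   (let n = nonlin g dg A y in
     (P h v Z - V (n h) v Z + P v h Z - V (n v) h Z - P Z h v + V (n Z) h v) / 2
      - (A h * g v Z + A v * g h Z - A Z * g h v) / 2 + (V k v Z + V (n h) v Z) / 2)"
  by (simp add: conn_def Let_def g_simps g_christoffel[OF linear_nonlin] g_vert V_simps)

lemma nonlin_y: "nonlin g dg A y y = spray g dg A y"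
  by (rule g_cancel) (simp add: g_nonlin g_spray lin field_simps)

lemma bilinear_conn: "bilinear (conn g dg A y)"
proof -
  note n = linear_add[OF linear_nonlin] linear_scale[OF linear_nonlin]
  have "linear (conn g dg A y \<xi>)" for \<xi>
    by (cases \<xi>; rule linearI; rule g_cancel)
       (simp_all add: g_conn lin n Let_def, simp_all add: field_simps)
  moreover have "linear (\<lambda>\<xi>. conn g dg A y \<xi> v)" for v
  proof (rule linearI; rule g_cancel)
    fix \<xi> \<zeta> :: "'e \<times> 'e" and Z and a :: real
    obtain h k h' k' where "\<xi> = (h, k)" "\<zeta> = (h', k')" by fastforce
    then show "g (conn g dg A y (\<xi> + \<zeta>) v) Z = g (conn g dg A y \<xi> v + conn g dg A y \<zeta> v) Z"
      "g (conn g dg A y (a *\<^sub>R \<xi>) v) Z = g (a *\<^sub>R conn g dg A y \<xi> v) Z"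
      by (simp_all add: g_conn lin n Let_def, simp_all add: field_simps)
  qed
  ultimately show ?thesis by (simp add: bilinear_def)
qed

lemma conn_vert_y: "conn g dg A y (0, k) y = 0"
proof (rule g_cancel)
  have "A 0 = 0" by (rule linear_0[OF A_linear])
  then show "g (conn g dg A y (0, k) y) Z = g 0 Z" for Z
    using linear_0[OF linear_nonlin] by (simp add: g_conn lin Let_def P_sym)
qed

text \<open>Since the vertical part annihilates y, the value is independent of \<open>k\<close>.
  Hence the horizontality equation \<open>k + B (h, k) y = 0\<close> has exactly the solution
  \<open>k = - n h\<close>, and the \<open>n\<close> put into \<open>christoffel\<close> is the one
  that the finished connection induces.\<close>

lemma conn_y: "conn g dg A y (h, k) y = nonlin g dg A y h"
proof (rule g_cancel)
  show "g (conn g dg A y (h, k) y) Z = g (nonlin g dg A y h) Z" for Z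
    by (simp add: g_conn g_nonlin lin Let_def nonlin_y V_sym)
qed

text \<open>With horizontality reduced to \<open>k = - n h\<close>, the clauses are identities for
  the Koszul expression \<open>c\<close>: it is symmetric in \<open>h\<close> and \<open>v\<close>,
  and its sum with \<open>v\<close> and \<open>w\<close> exchanged is the horizontal derivative of g
  minus \<open>A h * g v w\<close>.\<close>

lemma cartan_cond_conn: "cartan_cond g dg A y (conn g dg A y)"
proof -
  let ?B = "conn g dg A y" and ?n = "nonlin g dg A y"
  have hor: "k = - ?n h" if "k + ?B (h, k) y = 0" for h k
    using that by (simp add: conn_y eq_neg_iff_add_eq_0)
  have A0: "A 0 = 0" by (rule linear_0[OF A_linear])
  have n0: "?n 0 = 0" by (rule linear_0[OF linear_nonlin])
  have c: "g (?B (h, - ?n h) v) Z =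
     (P h v Z - V (?n h) v Z + P v h Z - V (?n v) h Z - P Z h v + V (?n Z) h v) / 2
      - (A h * g v Z + A v * g h Z - A Z * g h v) / 2" for h v Z
    by (simp add: g_conn Let_def lin)
  have b: "g (?B (0, k) v) Z = V k v Z / 2" for k v Z
    by (simp add: g_conn Let_def lin A0 n0)
  have 1: "dg (h, - ?n h) v w - g (?B (h, - ?n h) v) w - g v (?B (h, - ?n h) w) = A h * g v w"
    for h v w
    by (simp add: g_sym[of v "?B _ _"] c dg_split lin)
       (simp add: P_sym[of h w v] P_sym[of w v h] P_sym[of v w h] V_sym[of _ w v] V_sym[of _ w h]
          V_sym[of _ v h] g_sym[of w v] g_sym[of w h] g_sym[of v h] field_simps)
  have 2: "dg (0, k) v w - g (?B (0, k) v) w - g v (?B (0, k) w) = 0" for k v w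
    by (simp add: g_sym[of v "?B _ _"] b dg_split lin V_sym[of k w v])
  have 3: "?B (h, - ?n h) h' = ?B (h', - ?n h') h" for h h'
    by (rule g_cancel)
       (simp add: c P_sym[of _ h' h] V_sym[of _ h' h] g_sym[of h' h] algebra_simps)
  have 4: "g (?B (0, k) v) w = g (?B (0, k) w) v" for k v w
    by (simp add: b V_sym[of k w v])
  show ?thesis
    unfolding cartan_cond_def using hor 1 2 3 4 by blast
qed

lemma cartan_cond_unique:
  assumes B: "bilinear B" and cond: "cartan_cond g dg A y B"
  shows "B = conn g dg A y"
proof -
  have l1: "linear (\<lambda>\<xi>. B \<xi> v)" for v
    using B unfolding bilinear_def by blast
  have split: "B (h, k + k') v = B (h, k) v + B (0, k') v" for h k k' v
    using linear_add[OF l1[of v], of "(h, k)" "(0, k')"] by simp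
  \<comment> \<open>(C2) fixes the part of \<open>B (0, k)\<close> that is symmetric with respect to
    g, and (C4) says that there is no skew part.\<close>
  have Bv: "g (B (0, k) v) w = V k v w / 2" for k v w
  proof -
    have "dg (0, k) v w - g (B (0, k) v) w - g v (B (0, k) w) = 0"
      "g (B (0, k) v) w = g (B (0, k) w) v" using cond by (simp_all add: cartan_cond_def)
    then show ?thesis using g_sym[of v "B (0, k) w"] by (simp add: V_def)
  qed
  have By: "B (0, k) y = 0" for k by (rule g_cancel) (simp add: Bv lin)
  \<comment> \<open>Because \<open>B (0, k) y = 0\<close>, the value of \<open>B\<close> on y
    ignores the fibre part, so \<open>- n h\<close> solves the horizontality equation over
    \<open>h\<close>.\<close>
  define n where "n h = B (h, 0) y" for h
  define G where "G h v = B (h, - n h) v" for h v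
  have hor: "- n h + B (h, - n h) y = 0" for h
    using split[of h 0 "- n h" y] by (simp add: By n_def)
  have Gy: "G h y = n h" for h using hor[of h] by (simp add: G_def add_eq_0_iff)
  have met: "P h v w - V (n h) v w - g (G h v) w - g v (G h w) = A h * g v w" for h v w
  proof -
    have "dg (h, - n h) v w - g (B (h, - n h) v) w - g v (B (h, - n h) w) = A h * g v w"
      using cond hor[of h] unfolding cartan_cond_def by blast
    then show ?thesis by (simp add: G_def dg_split lin)
  qed
  have Gsym: "G h v = G v h" for h v
    using cond hor[of h] hor[of v] unfolding cartan_cond_def G_def by blast
  \<comment> \<open>The metric identity for \<open>(h, v, Z)\<close> plus that for
    \<open>(v, h, Z)\<close> minus that for \<open>(Z, h, v)\<close>; symmetry of \<open>G\<close>
    cancels all but two equal terms.\<close>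
  have gG: "g (G h v) Z =
     (P h v Z - V (n h) v Z + P v h Z - V (n v) h Z - P Z h v + V (n Z) h v) / 2
      - (A h * g v Z + A v * g h Z - A Z * g h v) / 2" for h v Z
    using met[of h v Z] met[of v h Z] met[of Z h v] Gsym[of h v] Gsym[of h Z] Gsym[of v Z]
      g_sym[of v "G Z h"] g_sym[of h "G Z v"]
    by (simp add: field_simps)
  \<comment> \<open>For \<open>h = v = y\<close> every fibre derivative in \<open>gG\<close> has y
    as an argument and vanishes, so the right-hand side no longer contains \<open>n\<close>.\<close>
  have "n y = spray g dg A y"
    by (rule g_cancel) (simp add: Gy[symmetric] gG g_spray lin field_simps)
  \<comment> \<open>For \<open>v = y\<close> alone, the derivative along \<open>n y\<close>
    survives, and \<open>n y\<close> has just been found.\<close>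
  have n: "n = nonlin g dg A y"
  proof (rule ext, rule g_cancel)
    show "g (n h) Z = g (nonlin g dg A y h) Z" for h Z
      unfolding Gy[symmetric, of h] gG g_nonlin \<open>n y = spray g dg A y\<close> by (simp add: lin)
  qed
  show ?thesis
  proof (rule ext, rule ext, rule g_cancel)
    fix \<xi> :: "'e \<times> 'e" and v Z
    obtain h k where \<xi>: "\<xi> = (h, k)" by fastforce
    have "B \<xi> v = G h v + B (0, k + n h) v"
      using split[of h "- n h" "k + n h" v] by (simp add: \<xi> G_def)
    then show "g (B \<xi> v) Z = g (conn g dg A y \<xi> v) Z"
      by (simp add: \<xi> g_conn gG Bv lin n[symmetric] Let_def)
  qed
qed

end

text \<open>\<open>J\<close> and \<open>S\<close> stand for the first and second derivative of a
  coordinate change, so \<open>(h, k)\<close> becomes \<open>(J h, S h y + J k)\<close>. The affine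
  rule for \<open>B'\<close> makes \<open>k + B (h, k) y\<close> transform by \<open>J\<close>,
  hence preserves horizontality. In the metric clauses the \<open>S\<close> terms cancel against the
  non-tensorial part of \<open>dg\<close>, in the torsion clause by symmetry of
  \<open>S\<close>.\<close>

lemma cartan_cond_transform:
  fixes B B' :: "'e::euclidean_space \<times> 'e \<Rightarrow> 'e \<Rightarrow> 'e" and J :: "'e \<Rightarrow> 'e" and S :: "'e \<Rightarrow> 'e \<Rightarrow> 'e"
    and y :: 'e
  assumes J: "linear J" "surj J" and S: "\<And>h v. S h v = S v h"
    and g: "\<And>v w. g v w = g' (J v) (J w)" and A: "\<And>v. A v = A' (J v)"
    and lin: "inner_form g'"
    and dg: "\<And>h k v w. dg (h, k) v w =
          dg' (J h, S h y + J k) (J v) (J w) + g' (S h v) (J w) + g' (J v) (S h w)"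
    and S0: "\<And>v. S 0 v = 0"
    and B: "\<And>h k v. B' (J h, S h y + J k) (J v) = J (B (h, k) v) - S h v"
    and inj: "inj J"
    and cond: "cartan_cond g dg A y B"
  shows "cartan_cond g' dg' A' (J y) B'"
proof -
  interpret g': inner_form g' by fact
  have pre: "\<exists>k. k' = S h y + J k" for k' h :: 'e
    using surjD[OF J(2), of "k' - S h y"] by (metis add.commute diff_add_cancel)
  have hor: "k + B (h, k) y = 0" if "(S h y + J k) + B' (J h, S h y + J k) (J y) = 0" for h k
  proof -
    have "J (k + B (h, k) y) = J 0" using that by (simp add: B linear_add[OF J(1)] linear_0[OF J(1)])
    then show ?thesis using inj by (simp add: inj_eq)
  qed
  have c: "\<And>h k v w. k + B (h, k) y = 0 \<Longrightarrow>
        dg (h, k) v w - g (B (h, k) v) w - g v (B (h, k) w) = A h * g v w"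
    "\<And>k v w. dg (0, k) v w - g (B (0, k) v) w - g v (B (0, k) w) = 0"
    "\<And>h k h' k'. k + B (h, k) y = 0 \<Longrightarrow> k' + B (h', k') y = 0 \<Longrightarrow> B (h, k) h' = B (h', k') h"
    "\<And>k v w. g (B (0, k) v) w = g (B (0, k) w) v"
    using cond unfolding cartan_cond_def by blast+
  have B0: "B' (0, J k) (J v) = J (B (0, k) v)" and dg0: "dg' (0, J k) (J v) (J w) = dg (0, k) v w"
    for k v w
    using B[of 0 k v] dg[of 0 k v w] by (simp_all add: S0 linear_0[OF J(1)] g'.g_simps)
  show ?thesis unfolding cartan_cond_def
  proof (intro conjI allI impI)
    fix h' k' v' w'
    obtain h v w where "h' = J h" "v' = J v" "w' = J w" using J(2) by (metis surjD)
    moreover obtain k where "k' = S h y + J k" using pre by blast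
    moreover assume "k' + B' (h', k') (J y) = 0"
    ultimately show "dg' (h', k') v' w' - g' (B' (h', k') v') w' - g' v' (B' (h', k') w')
        = A' h' * g' v' w'"
      using c(1)[OF hor, of h k v w] by (simp add: B dg g A g'.g_simps)
  next
    fix k' v' w'
    obtain k v w where "k' = J k" "v' = J v" "w' = J w" using J(2) by (metis surjD)
    then show "dg' (0, k') v' w' - g' (B' (0, k') v') w' - g' v' (B' (0, k') w') = 0"
      "g' (B' (0, k') v') w' = g' (B' (0, k') w') v'"
      using c(2)[of k v w] c(4)[of k v w] by (simp_all add: B0 dg0 g)
  next
    fix h1 k1 h2 k2
    obtain a b where "h1 = J a" "h2 = J b" using J(2) by (metis surjD)
    moreover obtain k where "k1 = S a y + J k" using pre by blast
    moreover obtain l where "k2 = S b y + J l" using pre by blast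
    moreover assume "k1 + B' (h1, k1) (J y) = 0" "k2 + B' (h2, k2) (J y) = 0"
    ultimately show "B' (h1, k1) h2 = B' (h2, k2) h1"
      using c(3)[OF hor hor, of a k b l] S[of a b] by (simp add: B)
  qed
qed

text \<open>The pairings of \<open>spray\<close>, \<open>nonlin\<close> and \<open>conn\<close> with
  a fixed \<open>Z\<close> are polynomial in the data and in vectors of the preceding stage, so
  \<open>smooth_on_of_form\<close> can be applied in this order.\<close>

lemma smooth_on_conn:
  fixes g :: "'q::euclidean_space \<Rightarrow> 'e::euclidean_space \<Rightarrow> 'e \<Rightarrow> real"
  assumes S: "open S" and data: "\<And>q. q \<in> S \<Longrightarrow> cartan_data (g q) (dg q) (A q) (y q)"
    and g: "\<And>v w. smooth_on (\<lambda>q. g q v w) S"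
    and dg: "\<And>\<xi> v w. smooth_on (\<lambda>q. dg q \<xi> v w) S"
    and A: "\<And>v. smooth_on (\<lambda>q. A q v) S" and y: "smooth_on y S"
  shows "smooth_on (\<lambda>q. conn (g q) (dg q) (A q) (y q) \<xi> v) S"
proof -
  have inner: "inner_form (g q)" if "q \<in> S" for q
    using data[OF that] by (simp add: cartan_data_def)
  have sym: "dg q \<xi> v w = dg q \<xi> w v" if "q \<in> S" for q \<xi> v w
    by (rule cartan_data.dg_sym[OF data[OF that]])
  have gs: "smooth_on (\<lambda>q. g q (u q) (w q)) S" if "smooth_on u S" "smooth_on w S" for u w
  proof -
    have 1: "smooth_on (\<lambda>q. g q (u q) Z) S" for Z
      by (rule smooth_on_linear_family[OF S _ g that(1)]) (rule inner_form.g_linear[OF inner])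
    show ?thesis
      by (rule smooth_on_linear_family[OF S _ 1 that(2)]) (rule inner_form.g_linear2[OF inner])
  qed
  have dgs: "smooth_on (\<lambda>q. dg q (z q) (u q) (w q)) S"
    if "smooth_on z S" "smooth_on u S" "smooth_on w S" for z u w
  proof -
    have 1: "smooth_on (\<lambda>q. dg q (z q) a b) S" for a b
      by (rule smooth_on_linear_family[OF S _ dg that(1)]) (rule cartan_data.dg_linear1[OF data])
    have 2: "smooth_on (\<lambda>q. dg q (z q) (u q) b) S" for b
      by (rule smooth_on_linear_family[OF S _ 1 that(2)]) (rule cartan_data.dg_linear2[OF data])
    show ?thesis
    proof (rule smooth_on_linear_family[OF S _ 2 that(3)])
      fix q assume q: "q \<in> S"
      have "dg q (z q) (u q) = (\<lambda>v. dg q (z q) v (u q))" by (rule ext) (rule sym[OF q])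
      then show "linear (dg q (z q) (u q))" using cartan_data.dg_linear2[OF data[OF q]] by simp
    qed
  qed
  have As: "smooth_on (\<lambda>q. A q (w q)) S" if "smooth_on w S" for w
    by (rule smooth_on_linear_family[OF S _ A that]) (rule cartan_data.A_linear[OF data])
  note intros = smooth_on_diff smooth_on_add smooth_on_mult smooth_on_divide smooth_on_Pair
    gs dgs As y smooth_on_const smooth_on_minus S
  let ?s = "\<lambda>q. spray (g q) (dg q) (A q) (y q)"
  have ss: "smooth_on ?s S"
  proof (rule smooth_on_of_form[OF S inner g])
    fix Z
    have a: "smooth_on (\<lambda>q. (2 * dg q (y q, 0) (y q) Z - dg q (Z, 0) (y q) (y q)) / 2
        - (2 * A q (y q) * g q (y q) Z - A q Z * g q (y q) (y q)) / 2) S"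
      by (intro intros) simp_all
    have b: "g q (?s q) Z = (2 * dg q (y q, 0) (y q) Z - dg q (Z, 0) (y q) (y q)) / 2
        - (2 * A q (y q) * g q (y q) Z - A q Z * g q (y q) (y q)) / 2" if "q \<in> S" for q
      using cartan_data.g_spray[OF data[OF that]] by (simp add: cartan_data.P_def[OF data[OF that]])
    show "smooth_on (\<lambda>q. g q (?s q) Z) S"
      by (rule smooth_on_eqI[OF S a]) (rule b)
  qed
  let ?n = "\<lambda>q. nonlin (g q) (dg q) (A q) (y q)"
  have ns: "smooth_on (\<lambda>q. ?n q h) S" for h
  proof (rule smooth_on_of_form[OF S inner g])
    fix Z
    have a: "smooth_on (\<lambda>q. (dg q (h, 0) (y q) Z + dg q (y q, 0) h Z - dg q (0, ?s q) h Z
          - dg q (Z, 0) h (y q)) / 2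
        - (A q h * g q (y q) Z + A q (y q) * g q h Z - A q Z * g q h (y q)) / 2) S"
      by (intro intros ss) simp_all
    have b: "g q (?n q h) Z = (dg q (h, 0) (y q) Z + dg q (y q, 0) h Z - dg q (0, ?s q) h Z
          - dg q (Z, 0) h (y q)) / 2
        - (A q h * g q (y q) Z + A q (y q) * g q h Z - A q Z * g q h (y q)) / 2"
      if "q \<in> S" for q
      using cartan_data.g_nonlin[OF data[OF that]]
      by (simp add: cartan_data.P_def[OF data[OF that]] cartan_data.V_def[OF data[OF that]])
    show "smooth_on (\<lambda>q. g q (?n q h) Z) S"
      by (rule smooth_on_eqI[OF S a]) (rule b)
  qed
  obtain h k where \<xi>: "\<xi> = (h, k)" by fastforce
  show ?thesis unfolding \<xi>
  proof (rule smooth_on_of_form[OF S inner g])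
    fix Z
    let ?e = "\<lambda>q. (dg q (h, 0) v Z - dg q (0, ?n q h) v Z + dg q (v, 0) h Z - dg q (0, ?n q v) h Z
          - dg q (Z, 0) h v + dg q (0, ?n q Z) h v) / 2
        - (A q h * g q v Z + A q v * g q h Z - A q Z * g q h v) / 2
        + (dg q (0, k) v Z + dg q (0, ?n q h) v Z) / 2"
    have a: "smooth_on ?e S"
      by (intro intros ns) simp_all
    have b: "g q (conn (g q) (dg q) (A q) (y q) (h, k) v) Z = ?e q" if "q \<in> S" for q
      using cartan_data.g_conn[OF data[OF that]]
      by (simp add: cartan_data.P_def[OF data[OF that]] cartan_data.V_def[OF data[OF that]] Let_def)
    show "smooth_on (\<lambda>q. g q (conn (g q) (dg q) (A q) (y q) (h, k) v) Z) S"
      by (rule smooth_on_eqI[OF S a]) (rule b)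
  qed
qed

section \<open>Atlases and tangent vectors\<close>

lemma vsimps [simp]:
  "vzero c = 0" "vadd v w c = v c + w c" "vsub v w c = v c - w c" "vscale a v c = a *\<^sub>R v c"
  by (simp_all add: vzero_def vadd_def vsub_def vscale_def)

lemma vadd_simps [simp]: "vadd v vzero = v" "vadd vzero v = v" "vscale a vzero = vzero"
  "vscale 0 v = vzero" "vscale 1 v = v" "vsub v vzero = v"
  by (auto simp: fun_eq_iff)

text \<open>Only what the charts provide without a topology on the set of points. Thus the charts of
  the slit bundle, on which no topology is defined, form an instance just as those of M do.\<close>

locale atlas =
  fixes \<C> :: "('a, 'e::euclidean_space) chart set"
  assumes chart_inj: "c \<in> \<C> \<Longrightarrow> inj_on (map_c c) (dom_c c)"
    and overlap_open: "c \<in> \<C> \<Longrightarrow> d \<in> \<C> \<Longrightarrow> open (map_c c ` (dom_c c \<inter> dom_c d))"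
    and trans_smooth: "c \<in> \<C> \<Longrightarrow> d \<in> \<C> \<Longrightarrow>
      smooth_on (coord_rep c (map_c d)) (map_c c ` (dom_c c \<inter> dom_c d))"
begin

abbreviation "overlap c d \<equiv> map_c c ` (dom_c c \<inter> dom_c d)"

lemma charts_atD: "c \<in> charts_at \<C> p \<Longrightarrow> c \<in> \<C> \<and> p \<in> dom_c c"
  by (simp add: charts_at_def)

lemma charts_at_atlas: "c \<in> charts_at \<C> p \<Longrightarrow> c \<in> \<C>"
  by (simp add: charts_at_def)

lemma charts_atI: "c \<in> \<C> \<Longrightarrow> p \<in> dom_c c \<Longrightarrow> c \<in> charts_at \<C> p"
  by (simp add: charts_at_def)

lemma coord_rep_at: "c \<in> \<C> \<Longrightarrow> p \<in> dom_c c \<Longrightarrow> coord_rep c f (map_c c p) = f p"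
  using chart_inj by (simp add: coord_rep_def)

lemma image_open: "c \<in> \<C> \<Longrightarrow> open (map_c c ` dom_c c)"
  using overlap_open[of c c] by simp

lemma trans_has_derivative:
  assumes "c \<in> charts_at \<C> p" "d \<in> charts_at \<C> p"
  shows "(coord_rep c (map_c d) has_derivative trans_deriv c d p) (at (map_c c p))"
  unfolding trans_deriv_def
  by (rule smooth_on_has_derivative[OF trans_smooth]) (use assms charts_atD in auto)

lemma linear_trans_deriv:
  "c \<in> charts_at \<C> p \<Longrightarrow> d \<in> charts_at \<C> p \<Longrightarrow> linear (trans_deriv c d p)"
  using trans_has_derivative has_derivative_linear by blast

lemma coord_rep_change:
  assumes "c \<in> \<C>" "d \<in> \<C>" "x \<in> overlap c d"
  shows "coord_rep c f x = coord_rep d f (coord_rep c (map_c d) x)"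
  using assms by (auto simp: coord_rep_at)

lemma coord_rep_chain:
  assumes c: "c \<in> charts_at \<C> p" and d: "d \<in> charts_at \<C> p"
    and f: "coord_rep d f differentiable at (map_c d p)"
  shows "(coord_rep c f has_derivative
      (\<lambda>h. fder (coord_rep d f) (map_c d p) (trans_deriv c d p h))) (at (map_c c p))"
proof -
  note cd = charts_atD[OF c] charts_atD[OF d]
  have "(coord_rep d f has_derivative fder (coord_rep d f) (map_c d p))
      (at (coord_rep c (map_c d) (map_c c p)))"
    using fder_works[OF f] cd by (simp add: coord_rep_at)
  from diff_chain_at[OF trans_has_derivative[OF c d] this]
  have "((\<lambda>x. coord_rep d f (coord_rep c (map_c d) x)) has_derivative
      (\<lambda>h. fder (coord_rep d f) (map_c d p) (trans_deriv c d p h))) (at (map_c c p))"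
    by (simp add: o_def)
  then show ?thesis
  proof (rule has_derivative_transform_within_open[OF _ overlap_open])
    show "map_c c p \<in> overlap c d" using cd by auto
    show "coord_rep d f (coord_rep c (map_c d) x) = coord_rep c f x"
      if "x \<in> overlap c d" for x
      using coord_rep_change[OF _ _ that] cd by metis
  qed (use cd in auto)
qed

lemma trans_deriv_id:
  assumes "c \<in> charts_at \<C> p"
  shows "trans_deriv c c p h = h"
proof -
  note c = charts_atD[OF assms]
  have "fder (coord_rep c (map_c c)) (map_c c p) = fder (\<lambda>x. x) (map_c c p)"
    by (rule fder_cong[OF image_open]) (use c in \<open>auto simp: coord_rep_at\<close>)
  then show ?thesis by (simp add: trans_deriv_def)
qed

lemma trans_deriv_comp:
  assumes "c \<in> charts_at \<C> p" "d \<in> charts_at \<C> p" "e \<in> charts_at \<C> p"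
  shows "trans_deriv d e p (trans_deriv c d p h) = trans_deriv c e p h"
proof -
  have "coord_rep d (map_c e) differentiable at (map_c d p)"
    using trans_has_derivative[OF assms(2,3)] by (auto simp: differentiable_def)
  from fder_eq[OF coord_rep_chain[OF assms(1,2) this]]
  show ?thesis by (simp add: trans_deriv_def)
qed

lemma smooth_change:
  assumes "c \<in> \<C>" "d \<in> \<C>" "smooth_on (coord_rep d f) (overlap d c)"
  shows "smooth_on (coord_rep c f) (overlap c d)"
proof (rule smooth_on_eqI[OF overlap_open])
  show "smooth_on (\<lambda>x. coord_rep d f (coord_rep c (map_c d) x)) (overlap c d)"
    by (rule smooth_on_compose[OF overlap_open overlap_open trans_smooth assms(3)])
       (use assms in \<open>auto simp: coord_rep_at\<close>)
qed (use assms in \<open>auto simp: coord_rep_at\<close>)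

lemma tangent_space_component:
  "v \<in> tangent_space \<C> p \<Longrightarrow> c \<in> charts_at \<C> p \<Longrightarrow> d \<in> charts_at \<C> p \<Longrightarrow> v d = trans_deriv c d p (v c)"
  unfolding tangent_space_def by blast

lemma tangent_space_outside: "v \<in> tangent_space \<C> p \<Longrightarrow> c \<notin> charts_at \<C> p \<Longrightarrow> v c = 0"
  unfolding tangent_space_def by blast

lemma tangent_spaceI:
  assumes "\<And>c d. c \<in> charts_at \<C> p \<Longrightarrow> d \<in> charts_at \<C> p \<Longrightarrow> v d = trans_deriv c d p (v c)"
    and "\<And>c. c \<notin> charts_at \<C> p \<Longrightarrow> v c = 0"
  shows "v \<in> tangent_space \<C> p"
  unfolding tangent_space_def using assms by blast

lemma tangent_space_eqI:
  assumes "v \<in> tangent_space \<C> p" "w \<in> tangent_space \<C> p" "c \<in> charts_at \<C> p" "v c = w c"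
  shows "v = w"
proof
  fix d show "v d = w d"
  proof (cases "d \<in> charts_at \<C> p")
    case True
    then show ?thesis
      using tangent_space_component[OF assms(1,3) True] tangent_space_component[OF assms(2,3) True]
        assms(4) by simp
  next
    case False
    then show ?thesis
      using tangent_space_outside[OF assms(1)] tangent_space_outside[OF assms(2)] by simp
  qed
qed

lemma tangent_space_vadd:
  assumes "v \<in> tangent_space \<C> p" "w \<in> tangent_space \<C> p"
  shows "vadd v w \<in> tangent_space \<C> p"
proof (rule tangent_spaceI)
  fix c d assume cd: "c \<in> charts_at \<C> p" "d \<in> charts_at \<C> p"
  show "vadd v w d = trans_deriv c d p (vadd v w c)"
    using tangent_space_component[OF assms(1) cd] tangent_space_component[OF assms(2) cd]
    by (simp add: linear_add[OF linear_trans_deriv[OF cd]])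
qed (simp add: tangent_space_outside[OF assms(1)] tangent_space_outside[OF assms(2)])

lemma tangent_space_vscale:
  assumes "v \<in> tangent_space \<C> p"
  shows "vscale a v \<in> tangent_space \<C> p"
proof (rule tangent_spaceI)
  fix c d assume cd: "c \<in> charts_at \<C> p" "d \<in> charts_at \<C> p"
  show "vscale a v d = trans_deriv c d p (vscale a v c)"
    using tangent_space_component[OF assms cd]
    by (simp add: linear_scale[OF linear_trans_deriv[OF cd]])
qed (simp add: tangent_space_outside[OF assms])

lemma tangent_space_vsub:
  assumes "v \<in> tangent_space \<C> p" "w \<in> tangent_space \<C> p"
  shows "vsub v w \<in> tangent_space \<C> p"
proof -
  have "vsub v w = vadd v (vscale (- 1) w)" by (auto simp: fun_eq_iff)
  then show ?thesis using assms tangent_space_vadd tangent_space_vscale by simp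
qed

lemma tangent_space_vzero: "vzero \<in> tangent_space \<C> p"
  by (rule tangent_spaceI) (simp_all add: linear_0[OF linear_trans_deriv])

lemma coord_vec_tangent:
  assumes "c \<in> charts_at \<C> p"
  shows "coord_vec \<C> c p e \<in> tangent_space \<C> p"
  by (rule tangent_spaceI) (simp_all add: coord_vec_def trans_deriv_comp[OF assms])

lemma coord_vec_component: "c \<in> charts_at \<C> p \<Longrightarrow> coord_vec \<C> c p e c = e"
  by (simp add: coord_vec_def trans_deriv_id)

lemma coord_vec_of_component:
  "c \<in> charts_at \<C> p \<Longrightarrow> v \<in> tangent_space \<C> p \<Longrightarrow> coord_vec \<C> c p (v c) = v"
  using tangent_space_eqI coord_vec_tangent coord_vec_component by metis

lemma coord_vec_linear:
  assumes "c \<in> charts_at \<C> p"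
  shows "coord_vec \<C> c p (a *\<^sub>R v + b *\<^sub>R w)
    = vadd (vscale a (coord_vec \<C> c p v)) (vscale b (coord_vec \<C> c p w))"
  by (rule ext)
     (use assms in \<open>simp add: coord_vec_def linear_add[OF linear_trans_deriv] linear_scale[OF linear_trans_deriv]\<close>)

lemma some_chart_at: "c \<in> charts_at \<C> p \<Longrightarrow> some_chart_at \<C> p \<in> charts_at \<C> p"
  unfolding some_chart_at_def by (rule someI)

lemma dir_deriv_chart:
  assumes "c \<in> charts_at \<C> p" "\<xi> \<in> tangent_space \<C> p" "coord_rep c f differentiable at (map_c c p)"
  shows "dir_deriv \<C> p \<xi> f = fder (coord_rep c f) (map_c c p) (\<xi> c)"
proof -
  have s: "some_chart_at \<C> p \<in> charts_at \<C> p" by (rule some_chart_at[OF assms(1)])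
  show ?thesis
    unfolding dir_deriv_def Let_def fder_eq[OF coord_rep_chain[OF s assms(1,3)]]
    using tangent_space_component[OF assms(2) s assms(1)] by simp
qed

text \<open>Extension by zero: near points of \<open>K\<close> smoothness is transported from the
  chart \<open>c\<close>, and off \<open>K\<close> the function vanishes. The openness assumption
  expresses in chart \<open>d\<close> that \<open>K\<close> is closed.\<close>

lemma smooth_extend:
  assumes cd: "c \<in> \<C>" "d \<in> \<C>" and K: "K \<subseteq> dom_c c" "open (map_c d ` (dom_c d - K))"
    and f: "smooth_on (coord_rep c f) (overlap c d)"
    and f0: "\<And>p. p \<in> dom_c d - K \<Longrightarrow> f p = 0"
  shows "smooth_on (coord_rep d f) (map_c d ` dom_c d)"
proof (rule smooth_on_local)
  fix x assume "x \<in> map_c d ` dom_c d"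
  then obtain p where p: "p \<in> dom_c d" "x = map_c d p" by auto
  show "\<exists>U. open U \<and> x \<in> U \<and> smooth_on (coord_rep d f) U"
  proof (cases "p \<in> K")
    case True
    have "smooth_on (coord_rep d f) (overlap d c)"
      by (rule smooth_change[OF cd(2,1) f])
    then show ?thesis using True p K overlap_open[OF cd(2,1)] by blast
  next
    case False
    have "smooth_on (coord_rep d f) (map_c d ` (dom_c d - K))"
      by (rule smooth_on_eqI[OF K(2) smooth_on_const[of 0]])
         (use f0 cd in \<open>auto simp: coord_rep_at\<close>)
    then show ?thesis using False p K(2) by blast
  qed
qed

lemma smooth_coord_vec_extend:
  assumes cd: "c \<in> \<C>" "d \<in> \<C>" and K: "K \<subseteq> dom_c c" "open (map_c d ` (dom_c d - K))"
    and \<phi>: "smooth_on (coord_rep c \<phi>) (map_c c ` dom_c c)" "\<And>p. p \<notin> K \<Longrightarrow> \<phi> p = 0"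
  shows "smooth_on (coord_rep d (\<lambda>q. \<phi> q *\<^sub>R coord_vec \<C> c q v d)) (map_c d ` dom_c d)"
proof (rule smooth_extend[OF cd K])
  let ?S = "overlap c d"
  have S: "open ?S" by (rule overlap_open[OF cd])
  show "smooth_on (coord_rep c (\<lambda>q. \<phi> q *\<^sub>R coord_vec \<C> c q v d)) ?S"
  proof (rule smooth_on_eqI[OF S])
    show "smooth_on (\<lambda>x. coord_rep c \<phi> x *\<^sub>R fder (coord_rep c (map_c d)) x v) ?S"
      by (intro smooth_on_scaleR S smooth_on_subset[OF \<phi>(1)] smooth_on_fder trans_smooth cd) auto
    show "coord_rep c (\<lambda>q. \<phi> q *\<^sub>R coord_vec \<C> c q v d) x
        = coord_rep c \<phi> x *\<^sub>R fder (coord_rep c (map_c d)) x v" if "x \<in> ?S" for x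
      using that cd by (auto simp: coord_rep_at coord_vec_def trans_deriv_def charts_at_def)
  qed
qed (simp add: \<phi>(2))

end

lemma smooth_manifold_atlas:
  assumes "smooth_manifold M \<A>"
  shows "atlas \<A>"
proof
  fix c assume c: "c \<in> \<A>"
  have h: "homeomorphic_map (subtopology M (dom_c c)) (top_of_set (map_c c ` dom_c c)) (map_c c)"
    and o: "openin M (dom_c c)" "open (map_c c ` dom_c c)"
    using assms c by (auto simp: smooth_manifold_def)
  have ts: "topspace (subtopology M (dom_c c)) = dom_c c"
    using openin_subset[OF o(1)] by auto
  show "inj_on (map_c c) (dom_c c)"
    using homeomorphic_imp_injective_map[OF h] ts by simp
  fix d assume d: "d \<in> \<A>"
  have "openin M (dom_c d)" using assms d by (auto simp: smooth_manifold_def)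
  then have "openin (subtopology M (dom_c c)) (dom_c c \<inter> dom_c d)"
    by (auto simp: openin_subtopology)
  then have "openin (top_of_set (map_c c ` dom_c c)) (map_c c ` (dom_c c \<inter> dom_c d))"
    using homeomorphic_imp_open_map[OF h] by (auto simp: open_map_def)
  then show "open (map_c c ` (dom_c c \<inter> dom_c d))"
    using o(2) openin_open_trans by blast
  show "smooth_on (coord_rep c (map_c d)) (map_c c ` (dom_c c \<inter> dom_c d))"
    using assms c d by (auto simp: smooth_manifold_def)
qed

locale manifold =
  fixes M :: "'m topology" and \<A> :: "('m, 'e::euclidean_space) chart set"
  assumes smooth_manifold: "smooth_manifold M \<A>"
begin

sublocale atlas \<A>
  by (rule smooth_manifold_atlas[OF smooth_manifold])

text \<open>\<open>K\<close> is the preimage of a closed ball, hence compact in M, and closed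
  because M is Hausdorff. Its complement is then open in every other chart, as extension by zero
  demands.\<close>

lemma bump_function:
  assumes c: "c \<in> charts_at \<A> p"
  obtains K and \<phi> :: "'m \<Rightarrow> real" where "K \<subseteq> dom_c c" "\<And>d. d \<in> \<A> \<Longrightarrow> open (map_c d ` (dom_c d - K))"
    "\<And>q. q \<notin> K \<Longrightarrow> \<phi> q = 0" "smooth_on (coord_rep c \<phi>) (map_c c ` dom_c c)" "\<phi> p = 1"
    "fder (coord_rep c \<phi>) (map_c c p) = (\<lambda>h. 0)"
proof -
  note cA = charts_atD[OF c]
  have M: "Hausdorff_space M" and chart: "\<And>d. d \<in> \<A> \<Longrightarrow> openin M (dom_c d) \<and> open (map_c d ` dom_c d) \<and>
        homeomorphic_map (subtopology M (dom_c d)) (top_of_set (map_c d ` dom_c d)) (map_c d)"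
    using smooth_manifold by (auto simp: smooth_manifold_def)
  have "open (map_c c ` dom_c c)" "map_c c p \<in> map_c c ` dom_c c"
    using image_open cA by auto
  then obtain r where r: "r > 0" "cball (map_c c p) r \<subseteq> map_c c ` dom_c c"
    using open_contains_cball by blast
  obtain \<psi> :: "'e \<Rightarrow> real" where \<psi>: "smooth_on \<psi> UNIV" "\<psi> (map_c c p) = 1"
    "fder \<psi> (map_c c p) = (\<lambda>h. 0)" "\<And>x. x \<notin> cball (map_c c p) r \<Longrightarrow> \<psi> x = 0"
    using smooth_bump[OF r(1)] by blast
  define K where "K = {q \<in> dom_c c. map_c c q \<in> cball (map_c c p) r}"
  define \<phi> where "\<phi> q = (if q \<in> dom_c c then \<psi> (map_c c q) else 0)" for q
  obtain g where g: "homeomorphic_maps (subtopology M (dom_c c)) (top_of_set (map_c c ` dom_c c)) (map_c c) g"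
    using chart cA homeomorphic_map_maps by blast
  have ts: "topspace (subtopology M (dom_c c)) = dom_c c"
    using openin_subset[of M "dom_c c"] chart[of c] cA by auto
  have "compactin (top_of_set (map_c c ` dom_c c)) (cball (map_c c p) r)"
    using r by (auto simp: compactin_subtopology)
  then have "compactin (subtopology M (dom_c c)) (g ` cball (map_c c p) r)"
    using g image_compactin unfolding homeomorphic_maps_def by blast
  moreover have "g ` cball (map_c c p) r = K"
  proof -
    have 1: "\<And>q. q \<in> dom_c c \<Longrightarrow> g (map_c c q) = q" using g ts unfolding homeomorphic_maps_def by auto
    show ?thesis
    proof (intro equalityI subsetI)
      fix q assume "q \<in> g ` cball (map_c c p) r"
      then obtain x where x: "x \<in> cball (map_c c p) r" "q = g x" by blast
      then obtain q' where "q' \<in> dom_c c" "x = map_c c q'" using r by blast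
      then show "q \<in> K" using x 1 by (simp add: K_def)
    next
      fix q assume "q \<in> K"
      then show "q \<in> g ` cball (map_c c p) r"
        unfolding K_def using 1[of q] by (metis (no_types, lifting) imageI mem_Collect_eq)
    qed
  qed
  ultimately have "closedin M K"
    using M compactin_imp_closedin compactin_subtopology by metis
  have open_K: "open (map_c d ` (dom_c d - K))" if d: "d \<in> \<A>" for d
  proof -
    have "openin M (dom_c d - K)" using chart[OF d] \<open>closedin M K\<close> by (simp add: openin_diff)
    then have "openin (subtopology M (dom_c d)) (dom_c d - K)"
      by (auto simp: openin_subtopology)
    then have "openin (top_of_set (map_c d ` dom_c d)) (map_c d ` (dom_c d - K))"
      using homeomorphic_imp_open_map chart[OF d] by (auto simp: open_map_def)
    then show ?thesis using chart[OF d] openin_open_trans by blast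
  qed
  have rep: "coord_rep c \<phi> x = \<psi> x" if "x \<in> map_c c ` dom_c c" for x
    using that cA by (auto simp: coord_rep_at \<phi>_def)
  show thesis
  proof
    show "K \<subseteq> dom_c c" by (auto simp: K_def)
    show "open (map_c d ` (dom_c d - K))" if "d \<in> \<A>" for d by (rule open_K[OF that])
    show "\<phi> q = 0" if "q \<notin> K" for q using that \<psi>(4) by (auto simp: \<phi>_def K_def)
    show "smooth_on (coord_rep c \<phi>) (map_c c ` dom_c c)"
      by (rule smooth_on_eqI[OF image_open smooth_on_subset[OF \<psi>(1)] rep]) (use cA in auto)
    show "\<phi> p = 1" using cA \<psi> by (simp add: \<phi>_def)
    have "fder (coord_rep c \<phi>) (map_c c p) = fder \<psi> (map_c c p)"
      by (rule fder_cong[OF image_open]) (use cA rep in auto)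
    then show "fder (coord_rep c \<phi>) (map_c c p) = (\<lambda>h. 0)" using \<psi> by simp
  qed
qed

end

section \<open>The slit tangent bundle\<close>

lemma fder_partial:
  assumes "F differentiable (at (x, y))"
  shows "fder F (x, y) (h, k) = fder (\<lambda>z. F (z, y)) x h + fder (\<lambda>w. F (x, w)) y k"
proof -
  have d: "(F has_derivative fder F (x, y)) (at (x, y))" by (rule fder_works[OF assms])
  have 1: "((\<lambda>z. (z, y)) has_derivative (\<lambda>h. (h, 0))) (at x)"
    and 2: "((\<lambda>w. (x, w)) has_derivative (\<lambda>k. (0, k))) (at y)"
    by (auto intro!: derivative_eq_intros)
  have "fder (\<lambda>z. F (z, y)) x = (\<lambda>h. fder F (x, y) (h, 0))"
    by (rule fder_eq) (use diff_chain_at[OF 1 d] in \<open>simp add: o_def\<close>)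
  moreover have "fder (\<lambda>w. F (x, w)) y = (\<lambda>k. fder F (x, y) (0, k))"
    by (rule fder_eq) (use diff_chain_at[OF 2 d] in \<open>simp add: o_def\<close>)
  moreover have "fder F (x, y) ((h, 0) + (0, k)) = fder F (x, y) (h, 0) + fder F (x, y) (0, k)"
    by (rule linear_add[OF linear_frechet_derivative[OF assms]])
  ultimately show ?thesis by simp
qed

lemma fder_linear: "linear L \<Longrightarrow> fder L (x::'e::euclidean_space) = L"
  by (rule fder_eq, rule bounded_linear_imp_has_derivative) (simp add: linear_conv_bounded_linear)

definition tangent_trans :: "('e::euclidean_space \<Rightarrow> 'e) \<Rightarrow> 'e \<times> 'e \<Rightarrow> 'e \<times> 'e" where
  "tangent_trans \<tau> q = (\<tau> (fst q), fder \<tau> (fst q) (snd q))"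

lemma smooth_tangent_trans:
  assumes "open S" "open T" "smooth_on \<tau> S"
  shows "smooth_on (tangent_trans \<tau>) (S \<times> T)"
  unfolding tangent_trans_def[abs_def]
proof (intro smooth_on_Pair)
  show o: "open (S \<times> T)" by (intro open_Times assms)
  have f: "smooth_on fst (S \<times> T)" by (rule smooth_on_linear[OF linear_fst o])
  show "smooth_on (\<lambda>q. \<tau> (fst q)) (S \<times> T)"
    by (rule smooth_on_compose[OF o assms(1) f assms(3)]) auto
  show "smooth_on (\<lambda>q. fder \<tau> (fst q) (snd q)) (S \<times> T)"
  proof (rule smooth_on_linear_family[OF o, where F = "\<lambda>q. fder \<tau> (fst q)" and w = snd])
    show "linear (fder \<tau> (fst q))" if "q \<in> S \<times> T" for q
      using that by (intro smooth_on_linear_fder[OF assms(3)]) auto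
    show "smooth_on (\<lambda>q. fder \<tau> (fst q) v) (S \<times> T)" for v
      by (rule smooth_on_compose[OF o assms(1) f smooth_on_fder[OF assms(3)]]) auto
    show "smooth_on snd (S \<times> T)" by (rule smooth_on_linear[OF linear_snd o])
  qed
qed

lemma fder_tangent_trans:
  assumes "open S" "smooth_on \<tau> S" "x \<in> S"
  shows "fder (tangent_trans \<tau>) (x, y) (h, k)
    = (fder \<tau> x h, fder (\<lambda>z. fder \<tau> z y) x h + fder \<tau> x k)"
proof -
  have d: "tangent_trans \<tau> differentiable (at (x, y))"
    by (rule smooth_on_differentiable[OF smooth_tangent_trans[OF assms(1) open_UNIV assms(2)]])
       (use assms in auto)
  have "((\<lambda>z. (\<tau> z, fder \<tau> z y)) has_derivative
      (\<lambda>h. (fder \<tau> x h, fder (\<lambda>z. fder \<tau> z y) x h))) (at x)"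
    by (intro has_derivative_Pair smooth_on_has_derivative[OF _ assms(3)] smooth_on_fder assms)
  moreover have "((\<lambda>w. (\<tau> x, fder \<tau> x w)) has_derivative (\<lambda>k. (0, fder \<tau> x k))) (at y)"
    using smooth_on_linear_fder[OF assms(2,3)]
    by (intro has_derivative_Pair has_derivative_const bounded_linear_imp_has_derivative)
       (simp add: linear_conv_bounded_linear)
  ultimately show ?thesis
    using fder_partial[OF d] by (simp add: tangent_trans_def fder_eq)
qed

context manifold
begin

abbreviation "\<S> \<equiv> slit_atlas \<A>"
abbreviation "slit \<equiv> slit_bundle \<A>"
abbreviation "sc \<equiv> slit_chart \<A>"
abbreviation "point c u \<equiv> map_c (sc c) u"
abbreviation "charts u \<equiv> charts_at \<A> (fst u)"
abbreviation "fibre u \<equiv> tangent_space \<A> (fst u)"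
abbreviation "tangents u \<equiv> tangent_space \<S> u"
abbreviation "sections \<equiv> pi_sections \<A>"
abbreviation "coords c \<equiv> map_c (sc c) ` dom_c (sc c)"
abbreviation "rep c \<equiv> coord_rep (sc c)"

lemma sc_simps: "dom_c (sc c) = {u \<in> slit. fst u \<in> dom_c c}"
  "point c u = (map_c c (fst u), snd u c)"
  by (simp_all add: slit_chart_def)

lemma slit_iff: "u \<in> slit \<longleftrightarrow>
    fst u \<in> (\<Union>c\<in>\<A>. dom_c c) \<and> snd u \<in> fibre u \<and> snd u \<noteq> vzero"
  by (cases u) (auto simp: slit_bundle_def tangent_bundle_def)

lemma slitI:
  "c \<in> charts_at \<A> p \<Longrightarrow> v \<in> tangent_space \<A> p \<Longrightarrow> v c \<noteq> 0 \<Longrightarrow> (p, v) \<in> slit"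
  using charts_atD[of c p] by (auto simp: slit_iff)

lemma slit_snd: "u \<in> slit \<Longrightarrow> snd u \<in> fibre u"
  by (simp add: slit_iff)

lemma slit_component_nonzero:
  assumes "u \<in> slit" "c \<in> charts u"
  shows "snd u c \<noteq> 0"
  using assms tangent_space_eqI[OF slit_snd[OF assms(1)] tangent_space_vzero assms(2)]
  by (auto simp: slit_iff)

lemma slit_chart_exists: "u \<in> slit \<Longrightarrow> \<exists>c. c \<in> charts u"
  by (auto simp: slit_iff charts_at_def)

lemma slit_image_over:
  assumes c: "c \<in> \<A>" and U: "U \<subseteq> dom_c c"
  shows "map_c (sc c) ` {u \<in> slit. fst u \<in> U} = map_c c ` U \<times> (UNIV - {0})"
proof (intro equalityI subsetI)
  fix q assume "q \<in> map_c (sc c) ` {u \<in> slit. fst u \<in> U}"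
  then obtain u where "u \<in> slit" "fst u \<in> U" "q = point c u" by blast
  moreover from this have "snd u c \<noteq> 0"
    using U by (intro slit_component_nonzero charts_atI[OF c]) auto
  ultimately show "q \<in> map_c c ` U \<times> (UNIV - {0})" by (simp add: sc_simps)
next
  fix q :: "'e \<times> 'e" assume "q \<in> map_c c ` U \<times> (UNIV - {0})"
  then obtain p and y :: 'e where p: "p \<in> U" "q = (map_c c p, y)" "y \<noteq> 0" by auto
  have cp: "c \<in> charts_at \<A> p" using c p U by (auto simp: charts_at_def)
  define u where "u = (p, coord_vec \<A> c p y)"
  have "u \<in> slit" unfolding u_def
    by (rule slitI[OF cp coord_vec_tangent[OF cp]]) (use p in \<open>simp add: coord_vec_component[OF cp]\<close>)
  then have "u \<in> {u \<in> slit. fst u \<in> U}" "q = point c u"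
    using p by (simp_all add: sc_simps u_def coord_vec_component[OF cp])
  then show "q \<in> map_c (sc c) ` {u \<in> slit. fst u \<in> U}" by blast
qed

lemma slit_image:
  assumes "c \<in> \<A>" "d \<in> \<A>"
  shows "map_c (sc c) ` (dom_c (sc c) \<inter> dom_c (sc d)) = overlap c d \<times> (UNIV - {0})"
proof -
  have "dom_c (sc c) \<inter> dom_c (sc d) = {u \<in> slit. fst u \<in> dom_c c \<inter> dom_c d}" by (auto simp: sc_simps)
  then show ?thesis using slit_image_over[OF assms(1), of "dom_c c \<inter> dom_c d"] by simp
qed

lemma coords_eq: "c \<in> \<A> \<Longrightarrow> coords c = map_c c ` dom_c c \<times> (UNIV - {0})"
  using slit_image[of c c] by simp

lemma slit_trans:
  assumes "c \<in> \<A>" "u \<in> dom_c (sc c)" "u \<in> dom_c (sc d)" "d \<in> \<A>"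
  shows "point d u = tangent_trans (coord_rep c (map_c d)) (point c u)"
proof -
  have "c \<in> charts u" "d \<in> charts u" "u \<in> slit"
    using assms by (auto simp: sc_simps charts_at_def)
  then show ?thesis
    using assms tangent_space_component[OF slit_snd, of u c d]
    by (simp add: sc_simps tangent_trans_def coord_rep_at trans_deriv_def)
qed

lemma slit_chart_inj: "c \<in> \<A> \<Longrightarrow> inj_on (map_c (sc c)) (dom_c (sc c))"
proof (rule inj_onI)
  fix u w assume c: "c \<in> \<A>" and u: "u \<in> dom_c (sc c)" and w: "w \<in> dom_c (sc c)"
    and eq: "map_c (sc c) u = map_c (sc c) w"
  have "fst u = fst w"
    using chart_inj[OF c] u w eq by (auto simp: sc_simps dest: inj_onD)
  moreover have "snd u = snd w"
  proof (rule tangent_space_eqI)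
    show "snd u \<in> fibre u" "snd w \<in> fibre u"
      using u w slit_snd[of u] slit_snd[of w] \<open>fst u = fst w\<close> by (simp_all add: sc_simps)
    show "c \<in> charts u" using u c by (auto simp: sc_simps charts_at_def)
    show "snd u c = snd w c" using eq by (simp add: sc_simps)
  qed
  ultimately show "u = w" by (rule prod_eqI)
qed

lemma open_punctured: "open (UNIV - {0::'e})"
  by (simp add: open_Diff)

lemma rep_slit_trans:
  assumes "c \<in> \<A>" "d \<in> \<A>" "q \<in> map_c (sc c) ` (dom_c (sc c) \<inter> dom_c (sc d))"
  shows "coord_rep (sc c) (map_c (sc d)) q = tangent_trans (coord_rep c (map_c d)) q"
proof -
  obtain u where u: "u \<in> dom_c (sc c)" "u \<in> dom_c (sc d)" "q = point c u" using assms by auto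
  have "coord_rep (sc c) (map_c (sc d)) q = point d u"
    unfolding u(3) coord_rep_def o_def inv_into_f_f[OF slit_chart_inj[OF assms(1)] u(1)] ..
  then show ?thesis using slit_trans[OF assms(1) u(1,2) assms(2)] u(3) by simp
qed

lemma atlas_slit: "atlas \<S>"
proof
  fix C D assume "C \<in> \<S>"
  then obtain c where c: "C = sc c" "c \<in> \<A>" by (auto simp: slit_atlas_def)
  show "inj_on (map_c C) (dom_c C)" unfolding c by (rule slit_chart_inj[OF c(2)])
  assume "D \<in> \<S>"
  then obtain d where d: "D = sc d" "d \<in> \<A>" by (auto simp: slit_atlas_def)
  show o: "open (map_c C ` (dom_c C \<inter> dom_c D))"
    unfolding c(1) d(1) slit_image[OF c(2) d(2)]
    by (intro open_Times overlap_open c d open_punctured)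
  show "smooth_on (coord_rep C (map_c D)) (map_c C ` (dom_c C \<inter> dom_c D))"
  proof (rule smooth_on_eqI[OF o])
    show "smooth_on (tangent_trans (coord_rep c (map_c d))) (map_c C ` (dom_c C \<inter> dom_c D))"
      unfolding c(1) d(1) slit_image[OF c(2) d(2)]
      by (intro smooth_tangent_trans overlap_open trans_smooth c d open_punctured)
  qed (use rep_slit_trans[OF c(2) d(2)] c d in blast)
qed

sublocale slit: atlas \<S>
  by (rule atlas_slit)

lemma sc_in: "c \<in> \<A> \<Longrightarrow> sc c \<in> \<S>"
  by (simp add: slit_atlas_def)

lemma open_coords: "c \<in> \<A> \<Longrightarrow> open (coords c)"
  by (rule slit.image_open[OF sc_in])

lemma sc_charts_at:
  assumes "c \<in> charts u" "u \<in> slit"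
  shows "sc c \<in> charts_at \<S> u"
proof (rule slit.charts_atI)
  show "sc c \<in> \<S>" using charts_atD[OF assms(1)] by (blast intro: sc_in)
  show "u \<in> dom_c (sc c)" unfolding sc_simps using charts_atD[OF assms(1)] assms(2) by blast
qed

lemma charts_at_slitE:
  assumes "C \<in> charts_at \<S> u"
  obtains c where "C = sc c" "c \<in> charts u" "u \<in> slit"
  using assms by (auto simp: charts_at_def slit_atlas_def sc_simps)

lemma point_in_coords: "c \<in> charts u \<Longrightarrow> u \<in> slit \<Longrightarrow> point c u \<in> coords c"
  using slit.charts_atD[OF sc_charts_at, of c u] by simp

lemma rep_at: "c \<in> charts u \<Longrightarrow> u \<in> slit \<Longrightarrow> rep c f (point c u) = f u"
  using slit.charts_atD[OF sc_charts_at, of c u] slit.coord_rep_at[of "sc c" u f] by simp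

lemma coordsE:
  assumes "q \<in> coords c" "c \<in> \<A>"
  obtains u where "u \<in> slit" "c \<in> charts u" "q = point c u"
proof -
  obtain u where u: "u \<in> dom_c (sc c)" "q = point c u" using assms(1) by blast
  then have "u \<in> slit" "c \<in> charts u" using assms(2) by (auto simp: sc_simps charts_at_def)
  from this(1,2) show thesis
    by (rule that[OF _ _ u(2)])
qed

lemma trans_deriv_slit:
  assumes "u \<in> slit" "c \<in> charts u" "d \<in> charts u"
  shows "trans_deriv (sc c) (sc d) u (h, k)
    = (trans_deriv c d (fst u) h,
       fder (\<lambda>z. fder (coord_rep c (map_c d)) z (snd u c)) (map_c c (fst u)) h
         + trans_deriv c d (fst u) k)"
proof -
  note cd = charts_atD[OF assms(2)] charts_atD[OF assms(3)]
  have "fder (coord_rep (sc c) (map_c (sc d))) (point c u)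
      = fder (tangent_trans (coord_rep c (map_c d))) (point c u)"
  proof (rule fder_cong)
    show "open (slit.overlap (sc c) (sc d))"
      using cd by (intro slit.overlap_open sc_in) auto
    show "point c u \<in> slit.overlap (sc c) (sc d)"
      using cd assms(1) by (auto simp: sc_simps)
  qed (use cd rep_slit_trans in blast)
  moreover have "fder (tangent_trans (coord_rep c (map_c d))) (map_c c (fst u), snd u c) (h, k)
    = (fder (coord_rep c (map_c d)) (map_c c (fst u)) h,
       fder (\<lambda>z. fder (coord_rep c (map_c d)) z (snd u c)) (map_c c (fst u)) h
       + fder (coord_rep c (map_c d)) (map_c c (fst u)) k)"
    by (rule fder_tangent_trans[OF overlap_open trans_smooth]) (use cd in auto)
  ultimately show ?thesis by (simp add: trans_deriv_def sc_simps)
qed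

text \<open>\<open>rho\<close> is evaluated in an arbitrarily chosen chart \<open>B\<close>; the
  chain rule moves the computation to \<open>sc c\<close>, where the projection to M is
  \<open>fst\<close> in coordinates.\<close>

lemma rho_component:
  assumes "u \<in> slit" "c \<in> charts u" "\<xi> \<in> tangents u"
  shows "rho \<A> u \<xi> c = fst (\<xi> (sc c))"
proof -
  have C: "sc c \<in> charts_at \<S> u" by (rule sc_charts_at[OF assms(2,1)])
  define B where "B = some_chart_at \<S> u"
  have B: "B \<in> charts_at \<S> u" unfolding B_def by (rule slit.some_chart_at[OF C])
  note cA = charts_at_atlas[OF assms(2)]
  have "rep c (map_c c \<circ> fst) q = fst q" if "q \<in> coords c" for q
    using that by (rule coordsE[OF _ cA]) (simp add: rep_at, simp add: sc_simps)
  then have d: "(rep c (map_c c \<circ> fst) has_derivative fst) (at (point c u))"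
    by (intro has_derivative_transform_within_open[OF
        bounded_linear_imp_has_derivative[OF bounded_linear_fst]
        open_coords[OF cA] point_in_coords[OF assms(2,1)]]) simp
  have "rep c (map_c c \<circ> fst) differentiable at (point c u)"
    using d by (rule differentiableI)
  from fder_eq[OF slit.coord_rep_chain[OF B C this]]
  have "fder (coord_rep B (map_c c \<circ> fst)) (map_c B u) h = fst (trans_deriv B (sc c) u h)" for h
    by (simp add: fder_eq[OF d])
  then show ?thesis
    using slit.tangent_space_component[OF assms(3) B C] assms(2)
    by (simp add: rho_def tangent_map_def B_def[symmetric])
qed

lemma rho_tangent:
  assumes "u \<in> slit" "\<xi> \<in> tangents u"
  shows "rho \<A> u \<xi> \<in> fibre u"
proof (rule tangent_spaceI)
  fix c d assume cd: "c \<in> charts u" "d \<in> charts u"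
  obtain h k where hk: "\<xi> (sc c) = (h, k)" by fastforce
  have "\<xi> (sc d) = trans_deriv (sc c) (sc d) u (\<xi> (sc c))"
    by (rule slit.tangent_space_component[OF assms(2)]) (intro sc_charts_at cd assms)+
  then show "rho \<A> u \<xi> d = trans_deriv c d (fst u) (rho \<A> u \<xi> c)"
    using trans_deriv_slit[OF assms(1) cd, of h k]
    by (simp add: rho_component[OF assms(1) cd(1) assms(2)] rho_component[OF assms(1) cd(2) assms(2)] hk)
next
  fix c assume "c \<notin> charts u"
  then show "rho \<A> u \<xi> c = 0" by (simp add: rho_def tangent_map_def Let_def)
qed

lemma gamma_component:
  assumes "u \<in> slit" "c \<in> charts u"
  shows "gamma \<A> u v (sc c) = (0, v c)"
proof -
  have "((\<lambda>t. (map_c c (fst u), snd u c + t *\<^sub>R v c)) has_vector_derivative (0, v c)) (at 0)"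
    by (auto intro!: derivative_eq_intros has_vector_derivative_Pair)
  then show ?thesis
    using sc_charts_at[OF assms(2,1)]
    by (simp add: gamma_def velocity_def sc_simps o_def vector_derivative_at)
qed

lemma gamma_tangent:
  assumes "u \<in> slit" "v \<in> fibre u"
  shows "gamma \<A> u v \<in> tangents u"
proof (rule slit.tangent_spaceI)
  fix C D assume "C \<in> charts_at \<S> u" "D \<in> charts_at \<S> u"
  then obtain c d where c: "C = sc c" "c \<in> charts u" and d: "D = sc d" "d \<in> charts u"
    by (elim charts_at_slitE) blast
  show "gamma \<A> u v D = trans_deriv C D u (gamma \<A> u v C)"
    unfolding c(1) d(1) gamma_component[OF assms(1) c(2)] gamma_component[OF assms(1) d(2)]
      trans_deriv_slit[OF assms(1) c(2) d(2)]
    using tangent_space_component[OF assms(2) c(2) d(2)] charts_atD[OF c(2)] charts_atD[OF d(2)]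
      linear_0[OF linear_trans_deriv[OF c(2) d(2)]]
      linear_0[OF smooth_on_linear_fder[OF smooth_on_fder[OF trans_smooth]], of c d "map_c c (fst u)"]
    by auto
qed (simp add: gamma_def velocity_def)

end

section \<open>The Finsler metric in coordinates\<close>

text \<open>A product rule for evaluation. The basis expansion of \<open>w\<close> is differentiated
  termwise, and the same expansion with \<open>w\<close> frozen at \<open>q0\<close> identifies the
  first group of terms.\<close>

lemma has_derivative_linear_family:
  fixes w :: "'e::euclidean_space \<Rightarrow> 'v::euclidean_space"
    and F :: "'e \<Rightarrow> 'v \<Rightarrow> 'f::real_normed_vector"
  assumes S: "open S" "q0 \<in> S" and lin: "\<And>q. q \<in> S \<Longrightarrow> linear (F q)"
    and F: "\<And>v. smooth_on (\<lambda>q. F q v) S" and w: "w differentiable (at q0)"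
  shows "((\<lambda>q. F q (w q)) has_derivative
      (\<lambda>h. fder (\<lambda>q. F q (w q0)) q0 h + F q0 (fder w q0 h))) (at q0)"
proof -
  have dF: "((\<lambda>q. F q v) has_derivative fder (\<lambda>q. F q v) q0) (at q0)" for v
    by (rule smooth_on_has_derivative[OF F S(2)])
  have cong: "(f has_derivative D) (at q0)"
    if "(f' has_derivative D) (at q0)" "\<And>q. q \<in> S \<Longrightarrow> f q = f' q" for f f' :: "'e \<Rightarrow> 'f" and D
    by (rule has_derivative_transform_within_open[OF that(1) S]) (simp add: that(2))
  have *: "((\<lambda>q. \<Sum>b\<in>Basis. (w q \<bullet> b) *\<^sub>R F q b) has_derivative
      (\<lambda>h. \<Sum>b\<in>Basis. (w q0 \<bullet> b) *\<^sub>R fder (\<lambda>q. F q b) q0 h + (fder w q0 h \<bullet> b) *\<^sub>R F q0 b)) (at q0)"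
    by (intro has_derivative_sum has_derivative_scaleR has_derivative_inner_left dF fder_works[OF w])
  have "((\<lambda>q. \<Sum>b\<in>Basis. (w q0 \<bullet> b) *\<^sub>R F q b) has_derivative
      (\<lambda>h. \<Sum>b\<in>Basis. (w q0 \<bullet> b) *\<^sub>R fder (\<lambda>q. F q b) q0 h)) (at q0)"
    by (intro has_derivative_sum has_derivative_scaleR_right dF)
  then have "((\<lambda>q. F q (w q0)) has_derivative
      (\<lambda>h. \<Sum>b\<in>Basis. (w q0 \<bullet> b) *\<^sub>R fder (\<lambda>q. F q b) q0 h)) (at q0)"
    by (rule cong) (rule linear_basis_expansion[OF lin])
  from fder_eq[OF this] show ?thesis
    using cong[OF *, of "\<lambda>q. F q (w q)"] linear_basis_expansion[OF lin]
      linear_basis_expansion[OF lin[OF S(2)], of "fder w q0 _"]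
    by (simp add: sum.distrib)
qed

lemma has_derivative_bilinear_family:
  fixes Y Z :: "'e::euclidean_space \<Rightarrow> 'v::euclidean_space"
  assumes S: "open S" "q0 \<in> S"
    and lin: "\<And>q w. q \<in> S \<Longrightarrow> linear (\<lambda>v. G q v w)" "\<And>q v. q \<in> S \<Longrightarrow> linear (G q v)"
    and G: "\<And>v w. smooth_on (\<lambda>q. G q v w) S" and Y: "smooth_on Y S" and Z: "smooth_on Z S"
  shows "((\<lambda>q. G q (Y q) (Z q)) has_derivative
      (\<lambda>h. fder (\<lambda>q. G q (Y q0) (Z q0)) q0 h
         + G q0 (fder Y q0 h) (Z q0) + G q0 (Y q0) (fder Z q0 h))) (at q0)"
proof -
  have GY: "smooth_on (\<lambda>q. G q (Y q) v) S" for v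
    by (rule smooth_on_linear_family[OF S(1) lin(1) G Y])
  have 1: "((\<lambda>q. G q (Y q) (Z q)) has_derivative
      (\<lambda>h. fder (\<lambda>q. G q (Y q) (Z q0)) q0 h + G q0 (Y q0) (fder Z q0 h))) (at q0)"
    by (rule has_derivative_linear_family[OF S lin(2) GY smooth_on_differentiable[OF Z S(2)]])
  have 2: "((\<lambda>q. G q (Y q) (Z q0)) has_derivative
      (\<lambda>h. fder (\<lambda>q. G q (Y q0) (Z q0)) q0 h + G q0 (fder Y q0 h) (Z q0))) (at q0)"
    by (rule has_derivative_linear_family[OF S lin(1) G smooth_on_differentiable[OF Y S(2)]])
  show ?thesis using 1 unfolding fder_eq[OF 2] .
qed

locale finsler =
  fixes M :: "'m topology" and \<A> :: "('m, 'e::euclidean_space) chart set"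
    and L :: "('m, 'e) tpt \<Rightarrow> real"
  assumes finsler: "finsler_manifold M \<A> L"
begin

sublocale manifold M \<A>
  using finsler by unfold_locales (simp add: finsler_manifold_def)

definition "energy c = rep c (\<lambda>u. (L u)\<^sup>2)"

definition "gmet c q v w = fder (\<lambda>q. fder (energy c) q (0, w)) q (0, v) / 2"

definition "dgmet c q \<xi> v w = fder (\<lambda>q. gmet c q v w) q \<xi>"

lemma smooth_energy:
  assumes "c \<in> \<A>"
  shows "smooth_on (energy c) (coords c)"
proof (rule smooth_on_eqI[OF open_coords[OF assms]])
  have "smooth_on (rep c L) (coords c)"
    using finsler sc_in[OF assms] by (simp add: finsler_manifold_def smooth_function_def)
  then show "smooth_on (\<lambda>q. rep c L q * rep c L q) (coords c)"
    by (intro smooth_on_mult open_coords[OF assms])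
qed (simp add: energy_def coord_rep_def power2_eq_square)

lemma smooth_metric:
  assumes "c \<in> \<A>"
  shows "smooth_on (\<lambda>q. gmet c q v w) (coords c)"
  unfolding gmet_def divide_inverse
  by (intro smooth_on_mult open_coords[OF assms] smooth_on_fder smooth_energy[OF assms] smooth_on_const)

lemma smooth_dgmet: "c \<in> \<A> \<Longrightarrow> smooth_on (\<lambda>q. dgmet c q \<xi> v w) (coords c)"
  unfolding dgmet_def by (intro smooth_on_fder smooth_metric)

lemma metric_linear1:
  assumes "c \<in> \<A>" "q \<in> coords c"
  shows "linear (\<lambda>v. gmet c q v w)"
proof -
  have l: "linear (fder (\<lambda>q. fder (energy c) q (0, w)) q)"
    by (rule smooth_on_linear_fder[OF smooth_on_fder[OF smooth_energy[OF assms(1)]] assms(2)])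
  show ?thesis
    unfolding gmet_def
    using linear_add[OF l, of "(0, _)" "(0, _)"] linear_scale[OF l, of _ "(0, _)"]
    by (intro linearI) (simp_all add: add_divide_distrib)
qed

lemma metric_sym:
  assumes "c \<in> \<A>" "q \<in> coords c"
  shows "gmet c q v w = gmet c q w v"
  unfolding gmet_def
  using fder_fder_commute_real[OF open_coords[OF assms(1)] smooth_energy[OF assms(1)] assms(2)] by metis

lemma metric_linear2:
  assumes "c \<in> \<A>" "q \<in> coords c"
  shows "linear (gmet c q v)"
proof -
  have "gmet c q v = (\<lambda>w. gmet c q w v)" by (rule ext) (rule metric_sym[OF assms])
  then show ?thesis using metric_linear1[OF assms] by simp
qed

lemma energy_point:
  assumes "u \<in> slit" "c \<in> charts u" "v \<in> fibre u" "v c \<noteq> 0"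
  shows "(L (fst u, v))\<^sup>2 = energy c (map_c c (fst u), v c)"
proof -
  have "(fst u, v) \<in> slit" by (rule slitI[OF assms(2,3,4)])
  then show ?thesis
    using rep_at[of c "(fst u, v)" "\<lambda>u. (L u)\<^sup>2"] assms(2) by (simp add: energy_def sc_simps)
qed

lemma finsler_metric_rep:
  assumes u: "u \<in> slit" and c: "c \<in> charts u"
    and v: "v \<in> fibre u" and w: "w \<in> fibre u"
  shows "finsler_metric L u v w = gmet c (point c u) (v c) (w c)"
proof -
  define x y where "x = map_c c (fst u)" and "y = snd u c"
  have cA: "c \<in> \<A>" and xin: "x \<in> map_c c ` dom_c c"
    using charts_atD[OF c] by (auto simp: x_def)
  have y0: "y \<noteq> 0" unfolding y_def by (rule slit_component_nonzero[OF u c])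
  have tan: "vadd (snd u) (vadd (vscale s v) (vscale t w)) \<in> fibre u" for s t
    by (intro tangent_space_vadd tangent_space_vscale slit_snd u v w)
  have val: "(L (fst u, vadd (snd u) (vadd (vscale s v) (vscale t w))))\<^sup>2
      = energy c ((x, y + s *\<^sub>R v c) + t *\<^sub>R (0, w c))" if "y + s *\<^sub>R v c + t *\<^sub>R w c \<noteq> 0" for s t
    using energy_point[OF u c tan, of s t] that by (simp add: x_def y_def add.assoc)
  have inner: "deriv (\<lambda>t. (L (fst u, vadd (snd u) (vadd (vscale s v) (vscale t w))))\<^sup>2) 0
      = fder (energy c) ((x, y) + s *\<^sub>R (0, v c)) (0, w c)" if s: "y + s *\<^sub>R v c \<noteq> 0" for s
  proof (rule DERIV_imp_deriv)
    have d: "((\<lambda>t. energy c ((x, y + s *\<^sub>R v c) + t *\<^sub>R (0, w c))) has_real_derivative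
       fder (energy c) ((x, y + s *\<^sub>R v c) + 0 *\<^sub>R (0, w c)) (0, w c)) (at 0)"
      by (rule smooth_on_has_real_derivative_along[OF smooth_energy[OF cA]])
         (use s xin in \<open>simp add: coords_eq[OF cA]\<close>)
    have o: "open {t. y + s *\<^sub>R v c + t *\<^sub>R w c \<noteq> 0}"
      by (intro open_Collect_neq continuous_intros)
    have "((\<lambda>t. (L (fst u, vadd (snd u) (vadd (vscale s v) (vscale t w))))\<^sup>2) has_real_derivative
       fder (energy c) ((x, y + s *\<^sub>R v c) + 0 *\<^sub>R (0, w c)) (0, w c)) (at 0)"
      by (rule has_field_derivative_transform_within_open[OF d o]) (use s val in simp_all)
    then show "((\<lambda>t. (L (fst u, vadd (snd u) (vadd (vscale s v) (vscale t w))))\<^sup>2) has_real_derivative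
       fder (energy c) ((x, y) + s *\<^sub>R (0, v c)) (0, w c)) (at 0)" by simp
  qed
  have "deriv (\<lambda>s. deriv (\<lambda>t. (L (fst u, vadd (snd u) (vadd (vscale s v) (vscale t w))))\<^sup>2) 0) 0
      = fder (\<lambda>q. fder (energy c) q (0, w c)) (x, y) (0, v c)"
  proof (rule DERIV_imp_deriv)
    have d: "((\<lambda>s. fder (energy c) ((x, y) + s *\<^sub>R (0, v c)) (0, w c)) has_real_derivative
       fder (\<lambda>q. fder (energy c) q (0, w c)) ((x, y) + 0 *\<^sub>R (0, v c)) (0, v c)) (at 0)"
      by (rule smooth_on_has_real_derivative_along[OF smooth_on_fder[OF smooth_energy[OF cA]]])
         (use y0 xin in \<open>simp add: coords_eq[OF cA]\<close>)
    have o: "open {s. y + s *\<^sub>R v c \<noteq> 0}"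
      by (intro open_Collect_neq continuous_intros)
    have "((\<lambda>s. deriv (\<lambda>t. (L (fst u, vadd (snd u) (vadd (vscale s v) (vscale t w))))\<^sup>2) 0)
       has_real_derivative
       fder (\<lambda>q. fder (energy c) q (0, w c)) ((x, y) + 0 *\<^sub>R (0, v c)) (0, v c)) (at 0)"
      by (rule has_field_derivative_transform_within_open[OF d o]) (use y0 inner in simp_all)
    then show "((\<lambda>s. deriv (\<lambda>t. (L (fst u, vadd (snd u) (vadd (vscale s v) (vscale t w))))\<^sup>2) 0)
       has_real_derivative fder (\<lambda>q. fder (energy c) q (0, w c)) (x, y) (0, v c)) (at 0)" by simp
  qed
  then show ?thesis by (simp add: finsler_metric_def gmet_def sc_simps x_def y_def)
qed

lemma inner_form_metric:
  assumes "c \<in> \<A>" "q \<in> coords c"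
  shows "inner_form (gmet c q)"
proof (rule inner_form.intro)
  show "linear (\<lambda>v. gmet c q v w)" for w by (rule metric_linear1[OF assms])
  show "gmet c q v w = gmet c q w v" for v w by (rule metric_sym[OF assms])
  fix v :: 'e assume v: "v \<noteq> 0"
  obtain u where u: "u \<in> slit" "c \<in> charts u" "q = point c u"
    using coordsE[OF assms(2,1)] .
  define V where "V = coord_vec \<A> c (fst u) v"
  have V: "V \<in> fibre u" "V c = v"
    unfolding V_def by (rule coord_vec_tangent[OF u(2)], rule coord_vec_component[OF u(2)])
  then have "V \<noteq> vzero" using v by auto
  then have "finsler_metric L u V V > 0"
    using finsler u(1) V(1) by (simp add: finsler_manifold_def)
  then show "gmet c q v v > 0" using finsler_metric_rep[OF u(1,2) V(1) V(1)] u(3) V(2) by simp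
qed

section \<open>Homogeneity in the fibre and its Euler relations\<close>

lemma energy_homogeneous:
  assumes "c \<in> \<A>" "q \<in> coords c" "a > 0"
  shows "energy c (fst q, a *\<^sub>R snd q) = a\<^sup>2 * energy c q"
proof -
  obtain u where u: "u \<in> slit" "c \<in> charts u" "q = point c u"
    using coordsE[OF assms(2,1)] .
  have h: "L (fst u, vscale a (snd u)) = a * L u"
    using finsler u(1) assms(3) by (auto simp: finsler_manifold_def slit_bundle_def case_prod_beta)
  have "snd u c \<noteq> 0" by (rule slit_component_nonzero[OF u(1,2)])
  then have "(L (fst u, vscale a (snd u)))\<^sup>2 = energy c (fst q, a *\<^sub>R snd q)"
    using energy_point[OF u(1,2) tangent_space_vscale[OF slit_snd[OF u(1)]], of a] assms(3) u(3)
    by (simp add: sc_simps)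
  moreover have "(L u)\<^sup>2 = energy c q"
    using rep_at[OF u(2,1), of "\<lambda>u. (L u)\<^sup>2"] u(3) by (simp add: energy_def)
  ultimately show ?thesis using h by (simp add: power_mult_distrib)
qed

lemma coords_scale: "c \<in> \<A> \<Longrightarrow> q \<in> coords c \<Longrightarrow> a > 0 \<Longrightarrow> (fst q, a *\<^sub>R snd q) \<in> coords c"
  by (auto simp: coords_eq)

text \<open>Differentiating energy(x, a y) = a^2 energy(x, y) along the fibre and cancelling one
  factor a lowers the degree of homogeneity from 2 to 1.\<close>

lemma fder_energy_homogeneous:
  assumes c: "c \<in> \<A>" and q: "q \<in> coords c" and a: "a > 0"
  shows "fder (energy c) (fst q, a *\<^sub>R snd q) (0, w) = a * fder (energy c) q (0, w)"
proof -
  have "linear (\<lambda>q::'e \<times> 'e. (fst q, a *\<^sub>R snd q))"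
    by (intro linearI) (auto simp: scaleR_add_right)
  then have "((\<lambda>q::'e \<times> 'e. (fst q, a *\<^sub>R snd q)) has_derivative (\<lambda>q. (fst q, a *\<^sub>R snd q))) (at q)"
    by (intro bounded_linear_imp_has_derivative) (simp add: linear_conv_bounded_linear)
  from diff_chain_at[OF this smooth_on_has_derivative[OF smooth_energy[OF c] coords_scale[OF c q a]]]
  have d1: "((\<lambda>q. energy c (fst q, a *\<^sub>R snd q)) has_derivative
      (\<lambda>h. fder (energy c) (fst q, a *\<^sub>R snd q) (fst h, a *\<^sub>R snd h))) (at q)"
    by (simp add: o_def)
  have d2: "((\<lambda>q. a\<^sup>2 * energy c q) has_derivative (\<lambda>h. a\<^sup>2 * fder (energy c) q h)) (at q)"
    by (intro has_derivative_mult_right smooth_on_has_derivative[OF smooth_energy[OF c] q])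
  have "fder (\<lambda>q. energy c (fst q, a *\<^sub>R snd q)) q = fder (\<lambda>q. a\<^sup>2 * energy c q) q"
    by (rule fder_cong[OF open_coords[OF c] q]) (rule energy_homogeneous[OF c _ a])
  from fun_cong[OF this[unfolded fder_eq[OF d1] fder_eq[OF d2]], of "(0, w)"]
  have "fder (energy c) (fst q, a *\<^sub>R snd q) (a *\<^sub>R (0, w))
      = a\<^sup>2 * fder (energy c) q (0, w)" by simp
  moreover have "fder (energy c) (fst q, a *\<^sub>R snd q) (a *\<^sub>R (0, w))
      = a * fder (energy c) (fst q, a *\<^sub>R snd q) (0, w)"
    using linear_scale[OF smooth_on_linear_fder[OF smooth_energy[OF c] coords_scale[OF c q a]]]
    by (simp del: scaleR_Pair)
  ultimately show ?thesis using a by (simp add: power2_eq_square)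
qed

text \<open>The Euler relation for the fibre derivative of the energy, which is 1-homogeneous: both
  sides arise from its derivative along the ray through y.\<close>

lemma metric_radial:
  assumes c: "c \<in> \<A>" and q: "q \<in> coords c"
  shows "gmet c q (snd q) w = fder (energy c) q (0, w) / 2"
proof -
  let ?f = "\<lambda>q. fder (energy c) q (0, w)"
  have f: "smooth_on ?f (coords c)" by (rule smooth_on_fder[OF smooth_energy[OF c]])
  have "((\<lambda>t. (1 + t) * ?f q) has_real_derivative ?f q) (at 0)"
    by (auto intro!: derivative_eq_intros)
  then have "((\<lambda>t. ?f (q + t *\<^sub>R (0, snd q))) has_real_derivative ?f q) (at 0)"
  \<comment> \<open>On this interval the factor \<open>1 + t\<close> is positive, as homogeneity
    requires.\<close>
  proof (rule has_field_derivative_transform_within_open[where S = "{-1<..}"])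
    fix t :: real assume "t \<in> {-1<..}"
    moreover have "q + t *\<^sub>R (0, snd q) = (fst q, (1 + t) *\<^sub>R snd q)"
      by (simp add: prod_eq_iff scaleR_add_left)
    ultimately show "(1 + t) * ?f q = ?f (q + t *\<^sub>R (0, snd q))"
      using fder_energy_homogeneous[OF c q, of "1 + t" w] by simp
  qed auto
  moreover have "((\<lambda>t. ?f (q + t *\<^sub>R (0, snd q))) has_real_derivative
      fder ?f (q + 0 *\<^sub>R (0, snd q)) (0, snd q)) (at 0)"
    by (rule smooth_on_has_real_derivative_along[OF f]) (use q in \<open>simp flip: zero_prod_def\<close>)
  ultimately have "fder ?f (q + 0 *\<^sub>R (0, snd q)) (0, snd q) = ?f q"
    by (rule DERIV_unique[symmetric])
  then show ?thesis by (simp add: gmet_def flip: zero_prod_def)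
qed

text \<open>The identity \<open>metric_radial\<close> is differentiated along \<open>(0, k)\<close>.
  The left side gives the wanted term plus the metric of \<open>k\<close> and \<open>w\<close>, and
  the right side is this metric by definition.\<close>

lemma dgmet_radial:
  assumes c: "c \<in> \<A>" and q: "q \<in> coords c"
  shows "dgmet c q (0, k) (snd q) w = 0"
proof -
  have s: "smooth_on (\<lambda>q. fder (energy c) q (0, w)) (coords c)"
    by (rule smooth_on_fder[OF smooth_energy[OF c]])
  have "snd differentiable (at q)"
    by (intro bounded_linear_imp_differentiable bounded_linear_snd)
  from has_derivative_linear_family[OF open_coords[OF c] q metric_linear1[OF c] smooth_metric[OF c] this]
  have 1: "((\<lambda>q. gmet c q (snd q) w) has_derivative
      (\<lambda>h. dgmet c q h (snd q) w + gmet c q (snd h) w)) (at q)"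
    by (simp add: dgmet_def fder_linear[OF linear_snd])
  have "((\<lambda>q. fder (energy c) q (0, w) / 2) has_derivative
      (\<lambda>h. fder (\<lambda>q. fder (energy c) q (0, w)) q h / 2)) (at q)"
    using has_derivative_mult_right[OF smooth_on_has_derivative[OF s q], of "1/2"] by simp
  then have 2: "((\<lambda>q. gmet c q (snd q) w) has_derivative
      (\<lambda>h. fder (\<lambda>q. fder (energy c) q (0, w)) q h / 2)) (at q)"
    by (rule has_derivative_transform_within_open[OF _ open_coords[OF c] q])
       (simp add: metric_radial[OF c])
  from fun_cong[OF has_derivative_unique[OF 1 2], of "(0, k)"]
  show ?thesis by (simp add: gmet_def)
qed

lemma dgmet_linear1: "c \<in> \<A> \<Longrightarrow> q \<in> coords c \<Longrightarrow> linear (\<lambda>\<xi>. dgmet c q \<xi> v w)"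
  unfolding dgmet_def using smooth_on_linear_fder[OF smooth_metric, of c q v w] by simp

lemma dgmet_sym:
  assumes "c \<in> \<A>" "q \<in> coords c"
  shows "dgmet c q \<xi> v w = dgmet c q \<xi> w v"
proof -
  have "fder (\<lambda>q. gmet c q v w) q = fder (\<lambda>q. gmet c q w v) q"
    by (rule fder_cong[OF open_coords[OF assms(1)] assms(2)]) (rule metric_sym[OF assms(1)])
  then show ?thesis by (simp add: dgmet_def)
qed

lemma dgmet_linear2:
  assumes c: "c \<in> \<A>" and q: "q \<in> coords c"
  shows "linear (\<lambda>v. dgmet c q \<xi> v w)"
proof (rule linearI)
  note d = smooth_on_has_derivative[OF smooth_metric[OF c] q]
  fix v v' and a :: real
  have "fder (\<lambda>q. gmet c q (v + v') w) q = fder (\<lambda>q. gmet c q v w + gmet c q v' w) q"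
    by (rule fder_cong[OF open_coords[OF c] q]) (rule linear_add[OF metric_linear1[OF c]])
  then show "dgmet c q \<xi> (v + v') w = dgmet c q \<xi> v w + dgmet c q \<xi> v' w"
    using fder_eq[OF has_derivative_add[OF d[of v w] d[of v' w]]] by (simp add: dgmet_def)
  have "fder (\<lambda>q. gmet c q (a *\<^sub>R v) w) q = fder (\<lambda>q. a *\<^sub>R gmet c q v w) q"
    by (rule fder_cong[OF open_coords[OF c] q]) (rule linear_scale[OF metric_linear1[OF c]])
  then show "dgmet c q \<xi> (a *\<^sub>R v) w = a *\<^sub>R dgmet c q \<xi> v w"
    using fder_eq[OF has_derivative_scaleR_right[OF d[of v w], of a]] by (simp add: dgmet_def)
qed

text \<open>The derivative of the metric is not tensorial: the second derivative \<open>S\<close> of the coordinate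
  change enters, both through the fibre coordinate and through the arguments.\<close>

definition "second c d u h v =
  fder (\<lambda>z. fder (coord_rep c (map_c d)) z v) (map_c c (fst u)) h"

text \<open>This symmetry is what makes the vanishing of the horizontal torsion independent of the
  chart.\<close>

lemma second_sym:
  assumes "c \<in> charts u" "d \<in> charts u"
  shows "second c d u h v = second c d u v h"
  unfolding second_def
  by (rule fder_fder_commute[OF overlap_open trans_smooth])
     (use charts_atD[OF assms(1)] charts_atD[OF assms(2)] in auto)

lemma second_zero:
  assumes "c \<in> charts u" "d \<in> charts u"
  shows "second c d u 0 v = 0"
  unfolding second_def
  by (rule linear_0[OF smooth_on_linear_fder[OF smooth_on_fder[OF trans_smooth]]])
     (use charts_atD[OF assms(1)] charts_atD[OF assms(2)] in auto)

lemma trans_deriv_slit_second: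
  assumes "u \<in> slit" "c \<in> charts u" "d \<in> charts u"
  shows "trans_deriv (sc c) (sc d) u (h, k)
    = (trans_deriv c d (fst u) h, second c d u h (snd u c) + trans_deriv c d (fst u) k)"
  using trans_deriv_slit[OF assms] by (simp add: second_def)

section \<open>The metric and its derivative under a change of chart\<close>

lemma metric_change:
  assumes u: "u \<in> slit" and c: "c \<in> charts u" and d: "d \<in> charts u"
  shows "gmet c (point c u) v w
    = gmet d (point d u) (trans_deriv c d (fst u) v) (trans_deriv c d (fst u) w)"
proof -
  let ?V = "coord_vec \<A> c (fst u)"
  have "gmet c (point c u) (?V v c) (?V w c) = gmet d (point d u) (?V v d) (?V w d)"
    using finsler_metric_rep[OF u c coord_vec_tangent[OF c] coord_vec_tangent[OF c]]
      finsler_metric_rep[OF u d coord_vec_tangent[OF c] coord_vec_tangent[OF c]] by simp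
  then show ?thesis using c d
    by (simp add: coord_vec_component[OF c]) (simp add: coord_vec_def)
qed

lemma smooth_trans_family:
  assumes "c \<in> \<A>" "d \<in> \<A>"
  shows "smooth_on (\<lambda>x. fder (coord_rep c (map_c d)) (fst x) a) (slit.overlap (sc c) (sc d))"
  unfolding slit_image[OF assms]
proof (rule smooth_on_compose[OF _ overlap_open[OF assms] _ smooth_on_fder[OF trans_smooth[OF assms]]])
  show o: "open (overlap c d \<times> (UNIV - {0::'e}))"
    by (intro open_Times overlap_open assms open_punctured)
  show "smooth_on fst (overlap c d \<times> (UNIV - {0::'e}))"
    by (rule smooth_on_linear[OF linear_fst o])
qed auto

lemma fder_trans_family:
  assumes u: "u \<in> slit" and c: "c \<in> charts u" and d: "d \<in> charts u"
  shows "fder (\<lambda>x. fder (coord_rep c (map_c d)) (fst x) a) (point c u) (h, k) = second c d u h a"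
proof -
  note cd = charts_atD[OF c] charts_atD[OF d]
  let ?f = "\<lambda>z. fder (coord_rep c (map_c d)) z a"
  have f: "(fst has_derivative fst) (at (point c u))"
    by (intro bounded_linear_imp_has_derivative bounded_linear_fst)
  have "(?f has_derivative fder ?f (fst (point c u))) (at (fst (point c u)))"
    by (rule smooth_on_has_derivative[OF smooth_on_fder[OF trans_smooth, of c d]])
       (use cd in \<open>auto simp: sc_simps\<close>)
  from fder_eq[OF diff_chain_at[OF f this]] show ?thesis
    by (simp add: o_def second_def sc_simps)
qed

text \<open>The tensor identity of \<open>metric_change\<close> is differentiated on the overlap.
  The base point moves by the derivative of the slit coordinate change, and the arguments
  \<open>J v\<close> and \<open>J w\<close>, which depend on the point, contribute the terms with
  \<open>S\<close>.\<close>

lemma dgmet_change: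
  assumes u: "u \<in> slit" and c: "c \<in> charts u" and d: "d \<in> charts u"
  defines "J \<equiv> trans_deriv c d (fst u)" and "S \<equiv> second c d u"
  shows "dgmet c (point c u) (h, k) v w
    = dgmet d (point d u) (J h, S h (snd u c) + J k) (J v) (J w)
      + gmet d (point d u) (S h v) (J w) + gmet d (point d u) (J v) (S h w)"
proof -
  have cd: "c \<in> \<A>" "d \<in> \<A>" "fst u \<in> dom_c c" "fst u \<in> dom_c d"
    using charts_atD[OF c] charts_atD[OF d] by auto
  define W where "W = slit.overlap (sc c) (sc d)"
  let ?\<tau> = "coord_rep c (map_c d)"
  let ?T = "rep c (map_c (sc d))"
  let ?q = "point c u"
  have o: "open W" unfolding W_def by (rule slit.overlap_open[OF sc_in[OF cd(1)] sc_in[OF cd(2)]])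
  have q: "?q \<in> W" using cd u by (auto simp: W_def sc_simps)
  have Tq: "?T ?q = point d u" by (rule rep_at[OF c u])
  have T_smooth: "smooth_on ?T W"
    unfolding W_def by (rule slit.trans_smooth[OF sc_in[OF cd(1)] sc_in[OF cd(2)]])
  have T_in: "?T x \<in> coords d" if "x \<in> W" for x
    using that slit.coord_rep_at[OF sc_in[OF cd(1)]] by (auto simp: W_def)
  have G: "smooth_on (\<lambda>x. gmet d (?T x) a b) W" for a b
    by (rule smooth_on_compose[OF o open_coords[OF cd(2)] T_smooth smooth_metric[OF cd(2)]])
       (use T_in in blast)
  have Y: "smooth_on (\<lambda>x. fder ?\<tau> (fst x) a) W" for a
    unfolding W_def by (rule smooth_trans_family[OF cd(1,2)])
  have Jq: "fder ?\<tau> (fst ?q) a = J a" for a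
    by (simp add: J_def trans_deriv_def sc_simps)
  have dY: "fder (\<lambda>x. fder ?\<tau> (fst x) a) ?q (h, k) = S h a" for a
    unfolding S_def by (rule fder_trans_family[OF u c d])
  have dG: "fder (\<lambda>x. gmet d (?T x) a b) ?q (h, k)
      = dgmet d (point d u) (J h, S h (snd u c) + J k) a b" for a b
  proof -
    have 1: "(?T has_derivative trans_deriv (sc c) (sc d) u) (at ?q)"
      by (rule slit.trans_has_derivative) (intro sc_charts_at c d u)+
    have 2: "((\<lambda>z. gmet d z a b) has_derivative fder (\<lambda>z. gmet d z a b) (?T ?q)) (at (?T ?q))"
      by (rule smooth_on_has_derivative[OF smooth_metric[OF cd(2)] T_in[OF q]])
    from fder_eq[OF diff_chain_at[OF 1 2]] show ?thesis
      by (simp add: o_def dgmet_def Tq trans_deriv_slit_second[OF u c d] J_def S_def)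
  qed
  have eq: "gmet c x v w = gmet d (?T x) (fder ?\<tau> (fst x) v) (fder ?\<tau> (fst x) w)" if x: "x \<in> W" for x
  proof -
    obtain u' where u': "u' \<in> slit" "c \<in> charts u'" "d \<in> charts u'" "x = point c u'"
      using x cd by (auto simp: W_def sc_simps charts_at_def)
    show ?thesis
      using metric_change[OF u'(1-3), of v w] rep_at[OF u'(2,1), of "map_c (sc d)"] u'(4)
      by (simp add: trans_deriv_def sc_simps(2)[of c])
  qed
  have "fder (\<lambda>x. gmet c x v w) ?q
      = fder (\<lambda>x. gmet d (?T x) (fder ?\<tau> (fst x) v) (fder ?\<tau> (fst x) w)) ?q"
    by (rule fder_cong[OF o q eq])
  also have "\<dots> = (\<lambda>\<xi>. fder (\<lambda>x. gmet d (?T x) (fder ?\<tau> (fst ?q) v) (fder ?\<tau> (fst ?q) w)) ?q \<xi>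
     + gmet d (?T ?q) (fder (\<lambda>x. fder ?\<tau> (fst x) v) ?q \<xi>) (fder ?\<tau> (fst ?q) w)
     + gmet d (?T ?q) (fder ?\<tau> (fst ?q) v) (fder (\<lambda>x. fder ?\<tau> (fst x) w) ?q \<xi>))"
    by (rule fder_eq, rule has_derivative_bilinear_family[OF o q _ _ G Y Y])
       (use metric_linear1[OF cd(2) T_in] metric_linear2[OF cd(2) T_in] in blast)+
  finally show ?thesis by (simp only: dgmet_def[of c] dG dY Jq Tq)
qed

end

section \<open>The coefficients in a chart and their transformation\<close>

locale finsler_form = finsler M \<A> L
  for M :: "'m topology" and \<A> :: "('m, 'e::euclidean_space) chart set" and L +
  fixes A :: "('m, 'e) tpt \<Rightarrow> ('m, 'e) tvec \<Rightarrow> real"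
  assumes form: "scalar_one_form \<A> A"
begin

definition "form_rep c q v = rep c (\<lambda>u. A u (coord_vec \<A> c (fst u) v)) q"

lemma form_rep_point:
  assumes "u \<in> slit" "c \<in> charts u" "v \<in> fibre u"
  shows "form_rep c (point c u) (v c) = A u v"
  by (simp add: form_rep_def rep_at[OF assms(2,1)] coord_vec_of_component[OF assms(2,3)])

lemma smooth_form_rep: "c \<in> \<A> \<Longrightarrow> smooth_on (\<lambda>q. form_rep c q v) (coords c)"
  using form by (simp add: scalar_one_form_def form_rep_def)

lemma linear_form_rep:
  assumes "c \<in> \<A>" "q \<in> coords c"
  shows "linear (form_rep c q)"
proof -
  obtain u where u: "u \<in> slit" "c \<in> charts u" "q = point c u"
    using coordsE[OF assms(2,1)] .
  have "form_rep c q (a *\<^sub>R v + b *\<^sub>R w) = a * form_rep c q v + b * form_rep c q w" for a b v w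
  proof -
    have "A u (vadd (vscale a (coord_vec \<A> c (fst u) v)) (vscale b (coord_vec \<A> c (fst u) w)))
       = a * A u (coord_vec \<A> c (fst u) v) + b * A u (coord_vec \<A> c (fst u) w)"
      using form u(1) coord_vec_tangent[OF u(2)] unfolding scalar_one_form_def by blast
    then show ?thesis
      by (simp add: form_rep_def u(3) rep_at[OF u(2,1)] coord_vec_linear[OF u(2)])
  qed
  from this[of 1 _ 1] this[of _ _ 0] show ?thesis by (intro linearI) simp_all
qed

lemma form_change:
  assumes u: "u \<in> slit" and c: "c \<in> charts u" and d: "d \<in> charts u"
  shows "form_rep c (point c u) v = form_rep d (point d u) (trans_deriv c d (fst u) v)"
  using form_rep_point[OF u c coord_vec_tangent[OF c], of v]
    form_rep_point[OF u d coord_vec_tangent[OF c], of v] c d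
  by (simp add: coord_vec_component[OF c]) (simp add: coord_vec_def)

lemma cartan_data_at:
  assumes "c \<in> \<A>" "q \<in> coords c"
  shows "cartan_data (gmet c q) (dgmet c q) (form_rep c q) (snd q)"
  unfolding cartan_data_def cartan_data_axioms_def
  using inner_form_metric[OF assms] dgmet_linear1[OF assms] dgmet_linear2[OF assms]
    dgmet_sym[OF assms] linear_form_rep[OF assms] dgmet_radial[OF assms] by blast

definition "coef c q = conn (gmet c q) (dgmet c q) (form_rep c q) (snd q)"

lemma smooth_coef:
  assumes "c \<in> \<A>"
  shows "smooth_on (\<lambda>q. coef c q \<xi> v) (coords c)"
  unfolding coef_def
  by (rule smooth_on_conn[OF open_coords[OF assms] cartan_data_at[OF assms] smooth_metric[OF assms]
        smooth_dgmet[OF assms] smooth_form_rep[OF assms]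
        smooth_on_linear[OF linear_snd open_coords[OF assms]]])

lemma bilinear_coef: "c \<in> \<A> \<Longrightarrow> q \<in> coords c \<Longrightarrow> bilinear (coef c q)"
  unfolding coef_def using cartan_data.bilinear_conn[OF cartan_data_at] by blast

text \<open>The coefficients of chart \<open>c\<close>, carried to chart \<open>d\<close> by the
  affine rule, satisfy \<open>cartan_cond\<close> there, so uniqueness identifies them with
  \<open>coef d\<close>. The explicit formulas behind \<open>coef\<close> are not touched.\<close>

lemma coef_change:
  assumes u: "u \<in> slit" and c: "c \<in> charts u" and d: "d \<in> charts u"
  defines "J \<equiv> trans_deriv c d (fst u)" and "S \<equiv> second c d u"
  shows "coef d (point d u) (J h, S h (snd u c) + J k) (J v) = J (coef c (point c u) (h, k) v) - S h v"
proof -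
  define Ji where "Ji = trans_deriv d c (fst u)"
  define y where "y = snd u c"
  note cd = charts_at_atlas[OF c] charts_at_atlas[OF d]
  note q = point_in_coords[OF c u] and q' = point_in_coords[OF d u]
  have lJ: "linear J" "linear Ji"
    unfolding J_def Ji_def by (rule linear_trans_deriv[OF c d], rule linear_trans_deriv[OF d c])
  have Ji: "Ji (J v) = v" "J (Ji v) = v" for v
    unfolding J_def Ji_def
    by (simp_all add: trans_deriv_comp[OF c d c] trans_deriv_comp[OF d c d] trans_deriv_id[OF c] trans_deriv_id[OF d])
  have S_sym: "S h v = S v h" for h v unfolding S_def by (rule second_sym[OF c d])
  have S1: "linear (\<lambda>h. S h v)" for v
    unfolding S_def second_def
    using smooth_on_linear_fder[OF smooth_on_fder[OF trans_smooth[OF cd]], of "map_c c (fst u)" v]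
      charts_atD[OF c] charts_atD[OF d] by auto
  have S2: "linear (S h)" for h
  proof -
    have "S h = (\<lambda>v. S v h)" by (rule ext) (rule S_sym)
    then show ?thesis using S1 by simp
  qed
  let ?B = "coef c (point c u)"
  have B1: "linear (\<lambda>\<xi>. ?B \<xi> v)" and B2: "linear (?B \<xi>)" for \<xi> v
    using bilinear_coef[OF cd(1) q] unfolding bilinear_def by blast+
  \<comment> \<open>The affine rule solved for its arguments by inverting \<open>(h, k)\<close> to
    \<open>(J h, S h y + J k)\<close>; the uniqueness statement asks for a bilinear map given on all
    arguments.\<close>
  define B' where "B' \<xi> v = J (?B (Ji (fst \<xi>), Ji (snd \<xi> - S (Ji (fst \<xi>)) y)) (Ji v)) - S (Ji (fst \<xi>)) (Ji v)"
    for \<xi> v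
  have 1: "linear (B' \<xi>)" for \<xi>
    by (rule linearI)
       (simp_all add: B'_def linear_add[OF lJ(1)] linear_add[OF lJ(2)] linear_add[OF B2] linear_add[OF S2]
         linear_scale[OF lJ(1)] linear_scale[OF lJ(2)] linear_scale[OF B2] linear_scale[OF S2]
         algebra_simps)
  have 2: "linear (\<lambda>\<xi>. B' \<xi> v)" for v
  proof -
    have "linear (\<lambda>\<xi>. (Ji (fst \<xi>), Ji (snd \<xi> - S (Ji (fst \<xi>)) y)))"
      by (rule linearI)
         (simp_all add: linear_add[OF lJ(2)] linear_diff[OF lJ(2)] linear_add[OF S1]
           linear_scale[OF lJ(2)] linear_scale[OF S1] algebra_simps)
    from linear_compose[OF linear_compose[OF this B1[of "Ji v"]] lJ(1)]
    have a: "linear (\<lambda>\<xi>. J (?B (Ji (fst \<xi>), Ji (snd \<xi> - S (Ji (fst \<xi>)) y)) (Ji v)))"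
      by (simp add: o_def)
    from linear_compose[OF linear_compose[OF linear_fst lJ(2)] S1[of "Ji v"]]
    have b: "linear (\<lambda>\<xi>. S (Ji (fst \<xi>)) (Ji v))" by (simp add: o_def)
    show ?thesis unfolding B'_def by (rule linear_compose_sub[OF a b])
  qed
  have B': "B' (J h, S h y + J k) (J v) = J (?B (h, k) v) - S h v" for h k v
    by (simp add: B'_def Ji)
  have "cartan_cond (gmet d (point d u)) (dgmet d (point d u)) (form_rep d (point d u)) (J y) B'"
  proof (rule cartan_cond_transform[where J = J and S = S and B = ?B])
    show "cartan_cond (gmet c (point c u)) (dgmet c (point c u)) (form_rep c (point c u)) y ?B"
      using cartan_data.cartan_cond_conn[OF cartan_data_at[OF cd(1) q]]
      by (simp add: coef_def y_def sc_simps)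
    show "surj J" "inj J" using Ji by (metis surjI, metis injI)
    show "inner_form (gmet d (point d u))" by (rule inner_form_metric[OF cd(2) q'])
    show "S 0 v = 0" for v unfolding S_def by (rule second_zero[OF c d])
    show "gmet c (point c u) v w = gmet d (point d u) (J v) (J w)" for v w
      unfolding J_def by (rule metric_change[OF u c d])
    show "form_rep c (point c u) v = form_rep d (point d u) (J v)" for v
      unfolding J_def by (rule form_change[OF u c d])
    show "dgmet c (point c u) (h, k) v w =
          dgmet d (point d u) (J h, S h y + J k) (J v) (J w)
          + gmet d (point d u) (S h v) (J w) + gmet d (point d u) (J v) (S h w)" for h k v w
      unfolding J_def S_def y_def by (rule dgmet_change[OF u c d])
  qed (fact lJ S_sym B')+
  moreover have "J y = snd (point d u)"
    using tangent_space_component[OF slit_snd[OF u] c d] by (simp add: J_def y_def sc_simps)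
  ultimately have "B' = coef d (point d u)"
    unfolding coef_def using cartan_data.cartan_cond_unique[OF cartan_data_at[OF cd(2) q'], of B'] 1 2
    by (simp add: bilinear_def)
  then show ?thesis using B'[of h k v] by (simp add: y_def)
qed

end

section \<open>Connections in coordinates\<close>

lemma (in atlas) dir_deriv_eq:
  assumes "c \<in> charts_at \<C> p" "\<xi> \<in> tangent_space \<C> p"
    and "(coord_rep c f has_derivative f') (at (map_c c p))"
  shows "dir_deriv \<C> p \<xi> f = f' (\<xi> c)"
  using dir_deriv_chart[OF assms(1,2) differentiableI[OF assms(3)]] fder_eq[OF assms(3)] by simp

context manifold
begin

definition "crep c Y = rep c (\<lambda>u. Y u c)"

lemma crep_point: "c \<in> charts u \<Longrightarrow> u \<in> slit \<Longrightarrow> crep c Y (point c u) = Y u c"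
  by (simp add: crep_def rep_at)

lemma smooth_crep: "Y \<in> sections \<Longrightarrow> c \<in> \<A> \<Longrightarrow> smooth_on (crep c Y) (coords c)"
  by (simp add: pi_sections_def crep_def)

lemma pi_section_tangent: "Y \<in> sections \<Longrightarrow> u \<in> slit \<Longrightarrow> Y u \<in> fibre u"
  by (simp add: pi_sections_def)

lemma pi_sectionI:
  assumes "\<And>u. u \<in> slit \<Longrightarrow> Y u \<in> fibre u" "\<And>u. u \<notin> slit \<Longrightarrow> Y u = vzero"
    and "\<And>c. c \<in> \<A> \<Longrightarrow> smooth_on (crep c Y) (coords c)"
  shows "Y \<in> sections"
  using assms by (simp add: pi_sections_def crep_def)

lemma pi_section_outside: "Y \<in> sections \<Longrightarrow> u \<notin> slit \<Longrightarrow> Y u = vzero"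
  by (cases u) (simp add: pi_sections_def)

lemma smooth_function_rep: "smooth_function \<S> f \<Longrightarrow> c \<in> \<A> \<Longrightarrow> smooth_on (rep c f) (coords c)"
  using sc_in by (simp add: smooth_function_def)

lemma smooth_functionI: "(\<And>c. c \<in> \<A> \<Longrightarrow> smooth_on (rep c f) (coords c)) \<Longrightarrow> smooth_function \<S> f"
  by (auto simp: smooth_function_def slit_atlas_def)

lemma pi_sections_vadd:
  assumes "Y \<in> sections" "Z \<in> sections"
  shows "(\<lambda>w. vadd (Y w) (Z w)) \<in> sections"
proof (rule pi_sectionI)
  fix c assume c: "c \<in> \<A>"
  have "crep c (\<lambda>w. vadd (Y w) (Z w)) = (\<lambda>q. crep c Y q + crep c Z q)"
    by (simp add: crep_def coord_rep_def fun_eq_iff)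
  then show "smooth_on (crep c (\<lambda>w. vadd (Y w) (Z w))) (coords c)"
    using smooth_on_add[OF open_coords[OF c] smooth_crep[OF assms(1) c] smooth_crep[OF assms(2) c]]
        by simp
qed (simp_all add: pi_section_tangent[OF assms(1)] pi_section_tangent[OF assms(2)] tangent_space_vadd
    pi_section_outside[OF assms(1)] pi_section_outside[OF assms(2)])

lemma pi_sections_vscale:
  assumes f: "smooth_function \<S> f" and Y: "Y \<in> sections"
  shows "(\<lambda>w. vscale (f w) (Y w)) \<in> sections"
proof (rule pi_sectionI)
  fix c assume c: "c \<in> \<A>"
  have "crep c (\<lambda>w. vscale (f w) (Y w)) = (\<lambda>q. rep c f q *\<^sub>R crep c Y q)"
    by (simp add: crep_def coord_rep_def fun_eq_iff)
  then show "smooth_on (crep c (\<lambda>w. vscale (f w) (Y w))) (coords c)"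
    using smooth_on_scaleR[OF open_coords[OF c] smooth_function_rep[OF f c] smooth_crep[OF Y c]] by simp
qed (simp_all add: pi_section_tangent[OF Y] tangent_space_vscale pi_section_outside[OF Y])

lemma pi_sections_vzero: "(\<lambda>w. vzero) \<in> sections"
  by (rule pi_sectionI) (simp_all add: tangent_space_vzero crep_def coord_rep_def o_def)

lemma crep_eta: "c \<in> \<A> \<Longrightarrow> q \<in> coords c \<Longrightarrow> crep c (eta \<A>) q = snd q"
  by (erule coordsE) (simp_all add: crep_point eta_def, simp add: sc_simps)

lemma eta_pi_section: "eta \<A> \<in> sections"
proof (rule pi_sectionI)
  show "smooth_on (crep c (eta \<A>)) (coords c)" if "c \<in> \<A>" for c
    by (rule smooth_on_eqI[OF open_coords[OF that] smooth_on_linear[OF linear_snd open_coords[OF that]]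
          crep_eta[OF that]])
qed (simp_all add: eta_def slit_snd)

text \<open>\<Phi> is a bump function of M composed with the projection, so \<open>K\<close> is a
  union of whole punctured fibres and closedness is inherited from M. The coordinate frame depends
  only on the base point too, hence extends to global sections.\<close>

lemma slit_bump:
  assumes u: "u \<in> slit" and c: "c \<in> charts u"
  obtains K \<Phi> where "K \<subseteq> dom_c (sc c)" "\<And>d. d \<in> \<A> \<Longrightarrow> open (map_c (sc d) ` (dom_c (sc d) - K))"
    "\<And>w. w \<notin> K \<Longrightarrow> \<Phi> w = (0::real)" "smooth_on (rep c \<Phi>) (coords c)" "\<Phi> u = 1"
    "fder (rep c \<Phi>) (point c u) = (\<lambda>h. 0)" "smooth_function \<S> \<Phi>"
    "\<And>v. (\<lambda>w. if w \<in> slit then vscale (\<Phi> w) (coord_vec \<A> c (fst w) v) else vzero) \<in> sections"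
proof -
  note cA = charts_at_atlas[OF c]
  obtain \<phi> :: "'m \<Rightarrow> real" and K where K: "K \<subseteq> dom_c c" "\<And>d. d \<in> \<A> \<Longrightarrow> open (map_c d ` (dom_c d - K))"
    and \<phi>: "\<And>q. q \<notin> K \<Longrightarrow> \<phi> q = 0" "smooth_on (coord_rep c \<phi>) (map_c c ` dom_c c)" "\<phi> (fst u) = 1"
    "fder (coord_rep c \<phi>) (map_c c (fst u)) = (\<lambda>h. 0)"
    by (rule bump_function[OF c]) (rule that; assumption)
  define \<Phi> where "\<Phi> w = (if w \<in> slit then \<phi> (fst w) else 0)" for w
  define K' where "K' = {w \<in> slit. fst w \<in> K}"
  have K'_sub: "K' \<subseteq> dom_c (sc c)" using K(1) by (auto simp: K'_def sc_simps)
  have K'_open: "open (map_c (sc d) ` (dom_c (sc d) - K'))" if d: "d \<in> \<A>" for d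
  proof -
    have e: "dom_c (sc d) - K' = {w \<in> slit. fst w \<in> dom_c d - K}" by (auto simp: K'_def sc_simps)
    show ?thesis
      unfolding e slit_image_over[OF d Diff_subset] by (intro open_Times K(2)[OF d] open_punctured)
  qed
  have \<Phi>0: "\<Phi> w = 0" if "w \<notin> K'" for w using that \<phi>(1) by (auto simp: \<Phi>_def K'_def)
  have rep\<Phi>: "rep c \<Phi> q = coord_rep c \<phi> (fst q)" if qc: "q \<in> coords c" for q
  proof -
    obtain w where "w \<in> slit" "c \<in> charts w" "q = point c w" using coordsE[OF qc cA] .
    then show ?thesis
      using rep_at[of c w \<Phi>] charts_atD[of c "fst w"] coord_rep_at[OF cA, of "fst w" \<phi>]
      by (simp add: \<Phi>_def sc_simps)
  qed
  have fst_smooth: "smooth_on fst (coords d)" if "d \<in> \<A>" for d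
    by (rule smooth_on_linear[OF linear_fst open_coords[OF that]])
  have fst_im: "fst ` coords d \<subseteq> map_c d ` dom_c d" if "d \<in> \<A>" for d
    by (auto simp: coords_eq[OF that])
  have lift: "smooth_on (\<lambda>q. G (fst q)) (coords d)" if "d \<in> \<A>" "smooth_on G (map_c d ` dom_c d)"
    for d and G :: "'e \<Rightarrow> 'b::real_normed_vector"
    by (rule smooth_on_compose[OF open_coords image_open fst_smooth that(2) fst_im]) (simp_all add: that(1))
  have \<Phi>_smooth: "smooth_on (rep c \<Phi>) (coords c)"
    by (rule smooth_on_eqI[OF open_coords[OF cA] lift[OF cA \<phi>(2)] rep\<Phi>])
  show thesis
  proof (rule that[OF K'_sub K'_open \<Phi>0 \<Phi>_smooth])
    show "\<Phi> u = 1" using u \<phi>(3) by (simp add: \<Phi>_def)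
    have "fder (rep c \<Phi>) (point c u) = fder (\<lambda>q. coord_rep c \<phi> (fst q)) (point c u)"
      by (rule fder_cong[OF open_coords[OF cA] point_in_coords[OF c u] rep\<Phi>])
    moreover have "((\<lambda>q. coord_rep c \<phi> (fst q)) has_derivative (\<lambda>h. 0)) (at (point c u))"
    proof -
      have 1: "(fst has_derivative fst) (at (point c u))"
        by (intro bounded_linear_imp_has_derivative bounded_linear_fst)
      have "(coord_rep c \<phi> has_derivative (\<lambda>h. 0)) (at (fst (point c u)))"
        using smooth_on_has_derivative[OF \<phi>(2), of "map_c c (fst u)"] charts_atD[OF c] \<phi>(4)
        by (simp add: sc_simps)
      from diff_chain_at[OF 1 this] show ?thesis by (simp add: o_def)
    qed
    ultimately show "fder (rep c \<Phi>) (point c u) = (\<lambda>h. 0)" using fder_eq by metis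
    show "smooth_function \<S> \<Phi>"
    proof (rule smooth_functionI)
      fix d assume d: "d \<in> \<A>"
      show "smooth_on (rep d \<Phi>) (coords d)"
        by (rule slit.smooth_extend[OF sc_in[OF cA] sc_in[OF d] K'_sub K'_open[OF d] smooth_on_subset[OF \<Phi>_smooth]])
           (auto simp: \<Phi>0)
    qed
    fix v
    let ?E = "\<lambda>w. if w \<in> slit then vscale (\<Phi> w) (coord_vec \<A> c (fst w) v) else vzero"
    show "?E \<in> sections"
    proof (rule pi_sectionI)
      fix w assume w: "w \<in> slit"
      show "?E w \<in> fibre w"
      proof (cases "fst w \<in> dom_c c")
        case True
        then show ?thesis using w coord_vec_tangent[OF charts_atI[OF cA]]
            by (simp add: tangent_space_vscale)
      next
        case False
        then have "\<Phi> w = 0" using K(1) by (intro \<Phi>0) (auto simp: K'_def)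
        then show ?thesis by (simp add: tangent_space_vzero)
      qed
    next
      fix d assume d: "d \<in> \<A>"
      have s: "smooth_on (coord_rep d (\<lambda>q. \<phi> q *\<^sub>R coord_vec \<A> c q v d)) (map_c d ` dom_c d)"
        by (rule smooth_coord_vec_extend[OF cA d K(1) K(2)[OF d] \<phi>(2,1)])
      show "smooth_on (crep d ?E) (coords d)"
      proof (rule smooth_on_eqI[OF open_coords[OF d] lift[OF d s]])
        fix q assume "q \<in> coords d"
        then obtain w where "w \<in> slit" "d \<in> charts w" "q = point d w" using coordsE[OF _ d] by blast
        then show "crep d ?E q = coord_rep d (\<lambda>q. \<phi> q *\<^sub>R coord_vec \<A> c q v d) (fst q)"
          using charts_atD[of d "fst w"] by (simp add: crep_point coord_rep_at[OF d] \<Phi>_def, simp add: sc_simps coord_rep_at[OF d])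
      qed
    qed simp
  qed
qed

definition represents where
  "represents D u c B \<longleftrightarrow> (\<forall>\<xi>\<in>tangents u. \<forall>Y\<in>sections.
     D u \<xi> Y c = fder (crep c Y) (point c u) (\<xi> (sc c)) + B (\<xi> (sc c)) (Y u c))"

lemma linear_connectionD:
  assumes D: "linear_connection \<A> D" and u: "u \<in> slit"
  shows "\<And>\<xi> Y. \<xi> \<in> tangents u \<Longrightarrow> Y \<in> sections \<Longrightarrow> D u \<xi> Y \<in> fibre u"
      (is "PROP ?A")
    and "\<And>\<xi> \<zeta> Y a b. \<xi> \<in> tangents u \<Longrightarrow> \<zeta> \<in> tangents u \<Longrightarrow> Y \<in> sections \<Longrightarrow>
        D u (vadd (vscale a \<xi>) (vscale b \<zeta>)) Y = vadd (vscale a (D u \<xi> Y)) (vscale b (D u \<zeta> Y))"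
      (is "PROP ?B")
    and "\<And>\<xi> Y Z. \<xi> \<in> tangents u \<Longrightarrow> Y \<in> sections \<Longrightarrow> Z \<in> sections \<Longrightarrow>
        D u \<xi> (\<lambda>w. vadd (Y w) (Z w)) = vadd (D u \<xi> Y) (D u \<xi> Z)"
      (is "PROP ?C")
    and "\<And>\<xi> Y f. \<xi> \<in> tangents u \<Longrightarrow> Y \<in> sections \<Longrightarrow> smooth_function \<S> f \<Longrightarrow>
        D u \<xi> (\<lambda>w. vscale (f w) (Y w)) =
          vadd (vscale (dir_deriv \<S> u \<xi> f) (Y u)) (vscale (f u) (D u \<xi> Y))"
      (is "PROP ?D")
proof -
  note D0 = D[unfolded linear_connection_def]
  note D1 = conjunct2[OF D0]
  note D2 = conjunct2[OF D1]
  note D3 = conjunct2[OF D2]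
  show "PROP ?A" "PROP ?B" "PROP ?C" "PROP ?D"
    using bspec[OF conjunct1[OF D0] u] bspec[OF conjunct1[OF D1] u] bspec[OF conjunct1[OF D2] u]
      bspec[OF conjunct1[OF D3] u] by simp_all
qed

lemma linear_connection_zero:
  assumes "linear_connection \<A> D" "u \<in> slit" "\<xi> \<in> tangents u"
  shows "D u \<xi> (\<lambda>w. vzero) = vzero"
proof -
  have "D u \<xi> (\<lambda>w. vzero) = vadd (D u \<xi> (\<lambda>w. vzero)) (D u \<xi> (\<lambda>w. vzero))"
    using linear_connectionD(3)[OF assms(1,2,3) pi_sections_vzero pi_sections_vzero] by simp
  then show ?thesis by (simp add: fun_eq_iff)
qed

lemma linear_connection_sum:
  assumes D: "linear_connection \<A> D" and u: "u \<in> slit" and \<xi>: "\<xi> \<in> tangents u"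
    and "finite I" "\<And>i. i \<in> I \<Longrightarrow> smooth_function \<S> (f i)" "\<And>i. i \<in> I \<Longrightarrow> E i \<in> sections"
  shows "(\<lambda>w c. \<Sum>i\<in>I. f i w *\<^sub>R E i w c) \<in> sections \<and>
    D u \<xi> (\<lambda>w c. \<Sum>i\<in>I. f i w *\<^sub>R E i w c)
      = (\<lambda>c. \<Sum>i\<in>I. dir_deriv \<S> u \<xi> (f i) *\<^sub>R E i u c + f i u *\<^sub>R D u \<xi> (E i) c)"
  using assms(4-)
proof (induction I rule: finite_induct)
  case empty
  then show ?case
    using linear_connection_zero[OF D u \<xi>] pi_sections_vzero by (simp add: vzero_def)
next
  case (insert i I)
  let ?Y = "\<lambda>w. vscale (f i w) (E i w)" and ?Z = "\<lambda>w c. \<Sum>i\<in>I. f i w *\<^sub>R E i w c"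
  have Y: "?Y \<in> sections" using insert.prems by (simp add: pi_sections_vscale)
  have Z: "?Z \<in> sections" "D u \<xi> ?Z =
      (\<lambda>c. \<Sum>i\<in>I. dir_deriv \<S> u \<xi> (f i) *\<^sub>R E i u c + f i u *\<^sub>R D u \<xi> (E i) c)"
    using insert.IH insert.prems by auto
  have eq: "(\<lambda>w c. \<Sum>i\<in>insert i I. f i w *\<^sub>R E i w c) = (\<lambda>w. vadd (?Y w) (?Z w))"
    using insert.hyps by (simp add: fun_eq_iff)
  have "D u \<xi> ?Y = vadd (vscale (dir_deriv \<S> u \<xi> (f i)) (E i u)) (vscale (f i u) (D u \<xi> (E i)))"
    by (rule linear_connectionD(4)[OF D u \<xi>]) (simp_all add: insert.prems)
  then show ?case
    unfolding eq using pi_sections_vadd[OF Y Z(1)] linear_connectionD(3)[OF D u \<xi> Y Z(1)] Z(2) insert.hyps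
    by (simp add: fun_eq_iff)
qed

text \<open>With a bump function \<open>\<Phi>\<close> that is \<open>1\<close> to first order at \<open>u\<close>, \<open>\<Phi>\<^sup>2 Y\<close> is a combination of the global
  sections extending the coordinate frame and has the same covariant derivative at \<open>u\<close> as \<open>Y\<close>.\<close>

lemma linear_connection_represents:
  assumes D: "linear_connection \<A> D" and u: "u \<in> slit" and c: "c \<in> charts u"
  obtains B where "bilinear B" "represents D u c B"
proof -
  note cA = charts_at_atlas[OF c]
  obtain \<Phi> K where K: "K \<subseteq> dom_c (sc c)" "\<And>d. d \<in> \<A> \<Longrightarrow> open (map_c (sc d) ` (dom_c (sc d) - K))"
    and \<Phi>: "\<And>w. w \<notin> K \<Longrightarrow> \<Phi> w = (0::real)" "smooth_on (rep c \<Phi>) (coords c)" "\<Phi> u = 1"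
    "fder (rep c \<Phi>) (point c u) = (\<lambda>h. 0)" "smooth_function \<S> \<Phi>"
    and E: "\<And>v. (\<lambda>w. if w \<in> slit then vscale (\<Phi> w) (coord_vec \<A> c (fst w) v) else vzero) \<in> sections"
    by (rule slit_bump[OF u c]) (rule that; assumption)
  define E where "E v w = (if w \<in> slit then vscale (\<Phi> w) (coord_vec \<A> c (fst w) v) else vzero)" for v w
  have E_sec: "E v \<in> sections" for v unfolding E_def[abs_def] by (rule E)
  have E_u: "E v u c = v" for v using u \<Phi>(3) by (simp add: E_def coord_vec_component[OF c])
  let ?q = "point c u"
  note q = point_in_coords[OF c u] and C = sc_charts_at[OF c u]
  have d\<Phi>: "(rep c \<Phi> has_derivative (\<lambda>h. 0)) (at ?q)"
    using smooth_on_has_derivative[OF \<Phi>(2) q] \<Phi>(4) by simp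
  have \<Phi>q: "rep c \<Phi> ?q = 1" by (simp add: rep_at[OF c u] \<Phi>(3))
  define B where "B \<xi> v = (\<Sum>b\<in>Basis. (v \<bullet> b) *\<^sub>R D u (coord_vec \<S> (sc c) u \<xi>) (E b) c)" for \<xi> v
  have "bilinear B"
  proof -
    have "D u (coord_vec \<S> (sc c) u (a *\<^sub>R \<xi> + a' *\<^sub>R \<zeta>)) (E b) c
        = a *\<^sub>R D u (coord_vec \<S> (sc c) u \<xi>) (E b) c + a' *\<^sub>R D u (coord_vec \<S> (sc c) u \<zeta>) (E b) c"
      for a a' \<xi> \<zeta> b
      by (simp add: slit.coord_vec_linear[OF C] E_sec
          linear_connectionD(2)[OF D u slit.coord_vec_tangent[OF C] slit.coord_vec_tangent[OF C]])
    from this[of 1 _ 1] this[of _ _ 0]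
    have 1: "linear (\<lambda>\<xi>. D u (coord_vec \<S> (sc c) u \<xi>) (E b) c)" for b
      by (intro linearI) simp_all
    show ?thesis unfolding B_def bilinear_def
      by (intro conjI allI linearI)
         (simp_all add: linear_add[OF 1] linear_scale[OF 1] inner_add_left scaleR_add_left
           scaleR_add_right sum.distrib scaleR_sum_right mult.commute)
  qed
  moreover have "represents D u c B"
    unfolding represents_def
  proof (intro ballI)
    fix \<xi> Y assume \<xi>: "\<xi> \<in> tangents u" and Y: "Y \<in> sections"
    \<comment> \<open>One factor \<Phi> makes the component of \<open>Y\<close> a global function,
      and the other sits in \<open>E b\<close> and makes the frame vector a global section; together
      they give the square.\<close>
    define f where "f b w = \<Phi> w * (Y w c \<bullet> b)" for b w
    have repf: "rep c (f b) = (\<lambda>q. rep c \<Phi> q * (crep c Y q \<bullet> b))" for b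
      by (simp add: f_def crep_def coord_rep_def fun_eq_iff)
    have f_smooth: "smooth_function \<S> (f b)" for b
    proof (rule smooth_functionI)
      fix d assume d: "d \<in> \<A>"
      have s: "smooth_on (rep c (f b)) (coords c)"
        unfolding repf by (intro smooth_on_mult smooth_on_inner smooth_on_const \<Phi>(2) smooth_crep[OF Y cA] open_coords[OF cA])
      show "smooth_on (rep d (f b)) (coords d)"
      proof (rule slit.smooth_extend[OF sc_in[OF cA] sc_in[OF d] K(1) K(2)[OF d] smooth_on_subset[OF s]])
        show "f b w = 0" if "w \<in> dom_c (sc d) - K" for w using that by (simp add: f_def \<Phi>(1))
      qed blast
    qed
    have df: "dir_deriv \<S> u \<xi> (f b) = fder (crep c Y) ?q (\<xi> (sc c)) \<bullet> b" for b
    proof -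
      have "(rep c (f b) has_derivative (\<lambda>h. fder (crep c Y) ?q h \<bullet> b)) (at ?q)"
        unfolding repf
        using has_derivative_mult[OF d\<Phi> has_derivative_inner_left[OF
              smooth_on_has_derivative[OF smooth_crep[OF Y cA] q], of b]] \<Phi>q by simp
      from slit.dir_deriv_eq[OF C \<xi> this] show ?thesis .
    qed
    have \<Phi>2_smooth: "smooth_function \<S> (\<lambda>w. \<Phi> w * \<Phi> w)"
    proof (rule smooth_functionI)
      fix d assume d: "d \<in> \<A>"
      have "smooth_on (\<lambda>q. rep d \<Phi> q * rep d \<Phi> q) (coords d)"
        by (intro smooth_on_mult open_coords d smooth_function_rep[OF \<Phi>(5)])
      then show "smooth_on (rep d (\<lambda>w. \<Phi> w * \<Phi> w)) (coords d)" by (simp add: coord_rep_def o_def)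
    qed
    have d\<Phi>2: "dir_deriv \<S> u \<xi> (\<lambda>w. \<Phi> w * \<Phi> w) = 0"
    proof -
      have "(rep c (\<lambda>w. \<Phi> w * \<Phi> w) has_derivative (\<lambda>h. 0)) (at ?q)"
        using has_derivative_mult[OF d\<Phi> d\<Phi>] by (simp add: coord_rep_def o_def)
      from slit.dir_deriv_eq[OF C \<xi> this] show ?thesis .
    qed
    have "(\<lambda>w. vscale (\<Phi> w * \<Phi> w) (Y w)) = (\<lambda>w c. \<Sum>b\<in>Basis. f b w *\<^sub>R E b w c)"
    proof (intro ext)
      fix w d
      show "vscale (\<Phi> w * \<Phi> w) (Y w) d = (\<Sum>b\<in>Basis. f b w *\<^sub>R E b w d)"
      proof (cases "w \<in> K")
        case False
        then show ?thesis by (simp add: \<Phi>(1) f_def)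
      next
        case True
        then have w: "w \<in> slit" "c \<in> charts w"
          using K(1) cA by (auto simp: sc_simps charts_at_def)
        have lin: "linear (\<lambda>v. coord_vec \<A> c (fst w) v d)"
          using coord_vec_linear[OF w(2), of 1 _ 1] coord_vec_linear[OF w(2), of _ _ 0]
          by (intro linearI) simp_all
        have "(\<Sum>b\<in>Basis. f b w *\<^sub>R E b w d)
            = (\<Phi> w * \<Phi> w) *\<^sub>R (\<Sum>b\<in>Basis. (Y w c \<bullet> b) *\<^sub>R coord_vec \<A> c (fst w) b d)"
          using w by (simp add: f_def E_def scaleR_sum_right mult_ac)
        also have "\<dots> = (\<Phi> w * \<Phi> w) *\<^sub>R coord_vec \<A> c (fst w) (Y w c) d"
          by (simp add: linear_basis_expansion[OF lin, of "Y w c"])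
        finally show ?thesis
          by (simp add: coord_vec_of_component[OF w(2) pi_section_tangent[OF Y w(1)]])
      qed
    qed
    then have "D u \<xi> (\<lambda>w. vscale (\<Phi> w * \<Phi> w) (Y w)) c
        = (\<Sum>b\<in>Basis. dir_deriv \<S> u \<xi> (f b) *\<^sub>R E b u c + f b u *\<^sub>R D u \<xi> (E b) c)"
      using linear_connection_sum[OF D u \<xi> finite_Basis, of f E] f_smooth E_sec by simp
    moreover have "D u \<xi> (\<lambda>w. vscale (\<Phi> w * \<Phi> w) (Y w)) = D u \<xi> Y"
      using linear_connectionD(4)[OF D u \<xi> Y \<Phi>2_smooth] d\<Phi>2 \<Phi>(3) by simp
    ultimately show "D u \<xi> Y c = fder (crep c Y) ?q (\<xi> (sc c)) + B (\<xi> (sc c)) (Y u c)"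
      by (simp add: df E_u f_def \<Phi>(3) sum.distrib euclidean_representation B_def
          slit.coord_vec_of_component[OF C \<xi>])
  qed
  ultimately show thesis by (rule that)
qed

end

section \<open>Regular connections and their torsion\<close>

lemma fst_fder:
  assumes "F differentiable (at x)"
  shows "fst (fder F x h) = fder (\<lambda>z. fst (F z)) x h"
  using fder_eq[OF has_derivative_fst[OF fder_works[OF assms]]] by simp

context manifold
begin

lemma section_through:
  assumes "u \<in> slit" "c \<in> charts u"
  obtains X where "X \<in> sections" "X u c = v"
proof (rule slit_bump[OF assms])
  fix \<Phi> :: "('m, 'e) tpt \<Rightarrow> real"
  assume "\<Phi> u = 1"
    "\<And>v. (\<lambda>w. if w \<in> slit then vscale (\<Phi> w) (coord_vec \<A> c (fst w) v) else vzero) \<in> sections"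
  then show thesis
    using that[of "\<lambda>w. if w \<in> slit then vscale (\<Phi> w) (coord_vec \<A> c (fst w) v) else vzero"] assms
    by (simp add: coord_vec_component)
qed

text \<open>In a slit chart the fundamental section is the coordinate projection \<open>snd\<close>,
  which is its own derivative.\<close>

lemma connection_map_rep:
  assumes u: "u \<in> slit" and c: "c \<in> charts u" and B: "represents D u c B"
    and \<xi>: "\<xi> \<in> tangents u"
  shows "connection_map \<A> D u \<xi> c = snd (\<xi> (sc c)) + B (\<xi> (sc c)) (snd u c)"
proof -
  note cA = charts_at_atlas[OF c]
  have "fder (crep c (eta \<A>)) (point c u) = fder snd (point c u)"
    by (rule fder_cong[OF open_coords[OF cA] point_in_coords[OF c u] crep_eta[OF cA]])
  also have "\<dots> = snd" by (rule fder_linear[OF linear_snd])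
  finally show ?thesis
    using B \<xi> eta_pi_section u by (simp add: represents_def connection_map_def eta_def)
qed

lemma horizontal_iff:
  assumes D: "linear_connection \<A> D" and u: "u \<in> slit" and c: "c \<in> charts u"
    and B: "represents D u c B"
  shows "\<xi> \<in> horizontal_space \<A> D u \<longleftrightarrow>
    \<xi> \<in> tangents u \<and> snd (\<xi> (sc c)) + B (\<xi> (sc c)) (snd u c) = 0"
proof -
  have "connection_map \<A> D u \<xi> = vzero \<longleftrightarrow> connection_map \<A> D u \<xi> c = 0"
    if "\<xi> \<in> tangents u"
    using tangent_space_eqI[OF _ tangent_space_vzero c, of "connection_map \<A> D u \<xi>"]
      linear_connectionD(1)[OF D u that eta_pi_section] by (auto simp: connection_map_def)
  then show ?thesis
    using connection_map_rep[OF u c B] by (auto simp: horizontal_space_def)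
qed

lemma vertical_iff:
  assumes u: "u \<in> slit" and c: "c \<in> charts u"
  shows "\<xi> \<in> vertical_space \<A> u \<longleftrightarrow> \<xi> \<in> tangents u \<and> fst (\<xi> (sc c)) = 0"
proof -
  have "rho \<A> u \<xi> = vzero \<longleftrightarrow> rho \<A> u \<xi> c = 0" if "\<xi> \<in> tangents u"
    using tangent_space_eqI[OF rho_tangent[OF u that] tangent_space_vzero c] by auto
  then show ?thesis
    using rho_component[OF u c] by (auto simp: vertical_space_def rho_def)
qed

section \<open>Regularity and the horizontal map\<close>

lemma regular_linear: "regular_connection \<A> D \<Longrightarrow> linear_connection \<A> D"
  by (simp add: regular_connection_def)

lemma vertical_horizontal:
  assumes "regular_connection \<A> D" "u \<in> slit" "\<xi> \<in> vertical_space \<A> u" "\<xi> \<in> horizontal_space \<A> D u"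
  shows "\<xi> = vzero"
proof -
  have "vertical_space \<A> u \<inter> horizontal_space \<A> D u = {vzero}"
    using assms(1,2) unfolding regular_connection_def by blast
  then show ?thesis using assms(3,4) by blast
qed

text \<open>Two horizontal vectors with the same image differ by a vector that is both vertical and
  horizontal, hence zero. For surjectivity, any lift of \<open>v\<close> is split by regularity, and
  its horizontal part has the same image. This gives meaning to the inverse in
  \<open>beta\<close>.\<close>

lemma bij_rho:
  assumes D: "regular_connection \<A> D" and u: "u \<in> slit"
  shows "bij_betw (rho \<A> u) (horizontal_space \<A> D u) (fibre u)"
proof -
  obtain c where c: "c \<in> charts u" using slit_chart_exists[OF u] by blast
  obtain B where B: "bilinear B" "represents D u c B"
    using linear_connection_represents[OF regular_linear[OF D] u c] .
  note hor = horizontal_iff[OF regular_linear[OF D] u c B(2)] and ver = vertical_iff[OF u c]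
    and C = sc_charts_at[OF c u]
  have lin: "linear (\<lambda>\<xi>. B \<xi> (snd u c))" using B(1) by (simp add: bilinear_def)
  have "inj_on (rho \<A> u) (horizontal_space \<A> D u)"
  proof (rule inj_onI)
    fix \<xi> \<zeta> assume \<xi>: "\<xi> \<in> horizontal_space \<A> D u" and \<zeta>: "\<zeta> \<in> horizontal_space \<A> D u"
      and eq: "rho \<A> u \<xi> = rho \<A> u \<zeta>"
    have t: "\<xi> \<in> tangents u" "\<zeta> \<in> tangents u" using \<xi> \<zeta> hor by blast+
    have k: "snd (\<xi> (sc c)) + B (\<xi> (sc c)) (snd u c) = 0" "snd (\<zeta> (sc c)) + B (\<zeta> (sc c)) (snd u c) = 0"
      using \<xi> \<zeta> hor by blast+
    have "fst (\<xi> (sc c)) = fst (\<zeta> (sc c))"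
      using eq rho_component[OF u c t(1)] rho_component[OF u c t(2)] by simp
    moreover have "vsub \<xi> \<zeta> \<in> tangents u" by (rule slit.tangent_space_vsub[OF t])
    moreover have "snd (vsub \<xi> \<zeta> (sc c)) + B (vsub \<xi> \<zeta> (sc c)) (snd u c) = 0"
    proof -
      have "snd (vsub \<xi> \<zeta> (sc c)) + B (vsub \<xi> \<zeta> (sc c)) (snd u c)
          = (snd (\<xi> (sc c)) + B (\<xi> (sc c)) (snd u c)) - (snd (\<zeta> (sc c)) + B (\<zeta> (sc c)) (snd u c))"
        by (simp add: linear_diff[OF lin] del: add_diff_eq)
      then show ?thesis using k by simp
    qed
    ultimately have "vsub \<xi> \<zeta> = vzero"
      by (intro vertical_horizontal[OF D u]) (simp_all add: ver hor)
    then show "\<xi> = \<zeta>" by (simp add: fun_eq_iff)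
  qed
  moreover have "rho \<A> u ` horizontal_space \<A> D u = fibre u"
  proof (intro equalityI subsetI)
    fix v assume "v \<in> rho \<A> u ` horizontal_space \<A> D u"
    then obtain \<xi> where "\<xi> \<in> horizontal_space \<A> D u" "v = rho \<A> u \<xi>" by blast
    then show "v \<in> fibre u" using rho_tangent[OF u] hor by blast
  next
    fix v assume v: "v \<in> fibre u"
    define \<xi> where "\<xi> = coord_vec \<S> (sc c) u (v c, 0)"
    have \<xi>: "\<xi> \<in> tangents u" "\<xi> (sc c) = (v c, 0)"
      unfolding \<xi>_def by (rule slit.coord_vec_tangent[OF C], rule slit.coord_vec_component[OF C])
    have "tangents u =
          {vadd \<xi> \<zeta> | \<xi> \<zeta>. \<xi> \<in> vertical_space \<A> u \<and> \<zeta> \<in> horizontal_space \<A> D u}"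
      using D u unfolding regular_connection_def by blast
    then obtain \<xi>1 \<xi>2 where s: "\<xi> = vadd \<xi>1 \<xi>2" "\<xi>1 \<in> vertical_space \<A> u" "\<xi>2 \<in> horizontal_space \<A> D u"
      using \<xi>(1) by blast
    have t2: "\<xi>2 \<in> tangents u" using s(3) hor by blast
    have "fst (\<xi>2 (sc c)) = v c" using s \<xi>(2) ver[of \<xi>1]
        by (auto simp: fst_add dest: arg_cong[where f = fst])
    then have "rho \<A> u \<xi>2 = v"
      by (intro tangent_space_eqI[OF rho_tangent[OF u t2] v c]) (simp add: rho_component[OF u c t2])
    then show "v \<in> rho \<A> u ` horizontal_space \<A> D u" using s(3) by blast
  qed
  ultimately show ?thesis by (simp add: bij_betw_def)
qed

lemma beta_horizontal:
  assumes "regular_connection \<A> D" "u \<in> slit" "v \<in> fibre u"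
  shows "beta \<A> D u v \<in> horizontal_space \<A> D u" "rho \<A> u (beta \<A> D u v) = v"
  using bij_rho[OF assms(1,2)] assms(3) unfolding beta_def bij_betw_def
  by (metis inv_into_into, metis f_inv_into_f)

lemma beta_component:
  assumes D: "regular_connection \<A> D" and u: "u \<in> slit" and v: "v \<in> fibre u"
    and c: "c \<in> charts u" and B: "represents D u c B"
  shows "beta \<A> D u v \<in> tangents u" "fst (beta \<A> D u v (sc c)) = v c"
    "snd (beta \<A> D u v (sc c)) + B (beta \<A> D u v (sc c)) (snd u c) = 0"
proof -
  note h = beta_horizontal[OF D u v]
  show t: "beta \<A> D u v \<in> tangents u"
    "snd (beta \<A> D u v (sc c)) + B (beta \<A> D u v (sc c)) (snd u c) = 0"
    using h(1) horizontal_iff[OF regular_linear[OF D] u c B] by blast+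
  show "fst (beta \<A> D u v (sc c)) = v c" using rho_component[OF u c t(1)] h(2) by simp
qed

lemma beta_eqI:
  assumes D: "regular_connection \<A> D" and u: "u \<in> slit" and v: "v \<in> fibre u"
    and c: "c \<in> charts u" and B: "represents D u c B"
    and k: "k + B (v c, k) (snd u c) = 0"
  shows "beta \<A> D u v (sc c) = (v c, k)"
proof -
  note C = sc_charts_at[OF c u]
  define \<xi> where "\<xi> = coord_vec \<S> (sc c) u (v c, k)"
  have \<xi>: "\<xi> \<in> tangents u" "\<xi> (sc c) = (v c, k)"
    unfolding \<xi>_def by (rule slit.coord_vec_tangent[OF C], rule slit.coord_vec_component[OF C])
  have "\<xi> \<in> horizontal_space \<A> D u"
    using horizontal_iff[OF regular_linear[OF D] u c B] \<xi> k by simp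
  moreover have "rho \<A> u \<xi> = v"
    by (rule tangent_space_eqI[OF rho_tangent[OF u \<xi>(1)] v c]) (simp add: rho_component[OF u c \<xi>(1)] \<xi>(2))
  ultimately have "beta \<A> D u v = \<xi>"
    using bij_rho[OF D u] unfolding beta_def bij_betw_def by (metis inv_into_f_f)
  then show ?thesis using \<xi>(2) by simp
qed

text \<open>In coordinates the horizontal lift solves a linear system with coefficients
  \<open>\<kappa> q\<close>, the connection map multiplied by a bump function; \<open>\<kappa> q (0, _)\<close> is injective by regularity,
  and the normal equations of the system are symmetric.\<close>

lemma smooth_beta:
  assumes D: "regular_connection \<A> D" and X: "X \<in> sections" and cA: "c \<in> \<A>"
  shows "smooth_on (rep c (\<lambda>u. beta \<A> D u (X u) (sc c))) (coords c)"
proof (rule smooth_on_local)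
  note DL = regular_linear[OF D]
  fix q0 assume "q0 \<in> coords c"
  then obtain u where u: "u \<in> slit" and c: "c \<in> charts u" and q0: "q0 = point c u"
    using coordsE[OF _ cA] by blast
  obtain K \<Phi> where K: "K \<subseteq> dom_c (sc c)" "\<And>d. d \<in> \<A> \<Longrightarrow> open (map_c (sc d) ` (dom_c (sc d) - K))"
    and \<Phi>: "\<And>w. w \<notin> K \<Longrightarrow> \<Phi> w = (0::real)" "smooth_on (rep c \<Phi>) (coords c)" "\<Phi> u = 1"
    by (rule slit_bump[OF u c]) (rule that; assumption)
  \<comment> \<open>The smoothness clause of a connection speaks of global vector fields, so the
    coordinate fields are cut off by \<Phi>.\<close>
  define V where "V \<xi> w = vscale (\<Phi> w) (coord_vec \<S> (sc c) w \<xi>)" for \<xi> w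
  have V: "V \<xi> \<in> vector_fields \<S>" for \<xi>
    unfolding vector_fields_def
  proof (intro CollectI conjI ballI)
    fix w
    show "V \<xi> w \<in> tangents w"
    proof (cases "w \<in> dom_c (sc c)")
      case True
      show ?thesis unfolding V_def
        by (intro slit.tangent_space_vscale slit.coord_vec_tangent slit.charts_atI sc_in cA True)
    next
      case False
      then have "\<Phi> w = 0" using K(1) by (intro \<Phi>(1)) blast
      then show ?thesis by (simp add: V_def slit.tangent_space_vzero)
    qed
  next
    fix C assume "C \<in> \<S>"
    then obtain d where d: "C = sc d" "d \<in> \<A>" by (auto simp: slit_atlas_def)
    show "smooth_on (coord_rep C (\<lambda>p. V \<xi> p C)) (map_c C ` dom_c C)"
      using slit.smooth_coord_vec_extend[OF sc_in[OF cA] sc_in[OF d(2)] K(1) K(2)[OF d(2)] \<Phi>(2,1), of \<xi>]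
      by (simp add: V_def d(1))
  qed
  define \<kappa> where "\<kappa> q \<xi> = crep c (\<lambda>w. if w \<in> slit then D w (V \<xi> w) (eta \<A>) else vzero) q" for q \<xi>
  have "(\<lambda>w. if w \<in> slit then D w (V \<xi> w) (eta \<A>) else vzero) \<in> sections" for \<xi>
    using DL V[of \<xi>] eta_pi_section unfolding linear_connection_def by blast
  then have \<kappa>_smooth: "smooth_on (\<lambda>q. \<kappa> q \<xi>) (coords c)" for \<xi>
    unfolding \<kappa>_def by (intro smooth_crep cA)
  have \<kappa>: "\<kappa> (point c w) \<xi> = \<Phi> w *\<^sub>R (snd \<xi> + B \<xi> (snd w c))"
    if w: "w \<in> slit" "c \<in> charts w" and B: "represents D w c B" for w B \<xi>
  proof -
    note C = sc_charts_at[OF w(2,1)]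
    have "D w (V \<xi> w) (eta \<A>) = vscale (\<Phi> w) (D w (coord_vec \<S> (sc c) w \<xi>) (eta \<A>))"
      using linear_connectionD(2)[OF DL w(1) slit.coord_vec_tangent[OF C] slit.coord_vec_tangent[OF C]
          eta_pi_section, of "\<Phi> w" \<xi> 0 \<xi>] by (simp add: V_def)
    then show ?thesis
      using connection_map_rep[OF w(1,2) B slit.coord_vec_tangent[OF C], of \<xi>] w
      by (simp add: \<kappa>_def crep_point connection_map_def slit.coord_vec_component[OF C])
  qed
  \<comment> \<open>Where \<Phi> is positive, \<open>\<kappa>\<close> vanishes exactly where the
    connection map does, so no information is lost by the cut-off.\<close>
  define U where "U = coords c \<inter> rep c \<Phi> -` {0<..}"
  have U: "open U" unfolding U_def
    by (rule continuous_open_preimage[OF smooth_on_continuous[OF \<Phi>(2)] open_coords[OF cA]]) simp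
  have UE: "\<exists>w B. w \<in> slit \<and> c \<in> charts w \<and> q = point c w \<and> \<Phi> w > 0 \<and>
      bilinear B \<and> represents D w c B" if "q \<in> U" for q
  proof -
    have "q \<in> coords c" using that by (simp add: U_def)
    then obtain w where w: "w \<in> slit" "c \<in> charts w" "q = point c w"
      using coordsE[OF _ cA] by blast
    obtain B where "bilinear B" "represents D w c B" using linear_connection_represents[OF DL w(1,2)] .
    moreover have "\<Phi> w > 0" using that by (simp add: U_def w(3) rep_at[OF w(2,1)])
    ultimately show ?thesis using w by blast
  qed
  have \<kappa>_lin: "linear (\<kappa> q)" if q: "q \<in> U" for q
  proof -
    obtain w B where w: "w \<in> slit" "c \<in> charts w" "q = point c w"
      and B: "bilinear B" "represents D w c B"
      using UE[OF q] by blast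
    have lin: "linear (\<lambda>\<xi>. B \<xi> (snd w c))" using B(1) by (simp add: bilinear_def)
    show ?thesis
      by (intro linearI)
         (simp_all add: w(3) \<kappa>[OF w(1,2) B(2)] linear_add[OF lin] linear_scale[OF lin] algebra_simps)
  qed
  let ?g = "\<lambda>q k l. \<kappa> q (0, k) \<bullet> \<kappa> q (0, l)"
  have inner: "inner_form (?g q)" if q: "q \<in> U" for q
  proof (rule inner_form.intro)
    have pair: "(0::'e, k + l) = (0, k) + (0, l)" "(0::'e, a *\<^sub>R k) = a *\<^sub>R (0, k)"
        for k l :: 'e and a :: real
      by simp_all
    show "linear (\<lambda>k. ?g q k l)" for l
      by (rule linearI)
         (simp_all only: pair linear_add[OF \<kappa>_lin[OF q]] linear_scale[OF \<kappa>_lin[OF q]] inner_add_left inner_scaleR_left real_scaleR_def)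
    show "?g q k l = ?g q l k" for k l by (rule inner_commute)
    fix k :: 'e assume k: "k \<noteq> 0"
    obtain w B where w: "w \<in> slit" "c \<in> charts w" "q = point c w" "\<Phi> w > 0"
      and B: "bilinear B" "represents D w c B"
      using UE[OF q] by blast
    note C = sc_charts_at[OF w(2,1)]
    have "\<kappa> q (0, k) \<noteq> 0"
    proof
      assume "\<kappa> q (0, k) = 0"
      then have "k + B (0, k) (snd w c) = 0" using \<kappa>[OF w(1,2) B(2), of "(0, k)"] w(3,4) by simp
      then have "coord_vec \<S> (sc c) w (0, k) \<in> horizontal_space \<A> D w"
        using horizontal_iff[OF DL w(1,2) B(2)] slit.coord_vec_tangent[OF C]
        by (simp add: slit.coord_vec_component[OF C])
      moreover have "coord_vec \<S> (sc c) w (0, k) \<in> vertical_space \<A> w"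
        using vertical_iff[OF w(1,2)] slit.coord_vec_tangent[OF C]
        by (simp add: slit.coord_vec_component[OF C])
      ultimately have "coord_vec \<S> (sc c) w (0, k) = vzero" by (intro vertical_horizontal[OF D w(1)])
      then have "(0, k) = (0 :: 'e \<times> 'e)" using slit.coord_vec_component[OF C, of "(0, k)"] by simp
      then show False using k by (simp add: zero_prod_def)
    qed
    then show "?g q k k > 0" by simp
  qed
  have \<kappa>_U: "smooth_on (\<lambda>q. \<kappa> q \<xi>) U" for \<xi> by (rule smooth_on_subset[OF \<kappa>_smooth]) (auto simp: U_def)
  let ?b = "rep c (\<lambda>u. beta \<A> D u (X u) (sc c))"
  have X_U: "smooth_on (crep c X) U" by (rule smooth_on_subset[OF smooth_crep[OF X cA]]) (auto simp: U_def)
  have b: "fst (?b q) = crep c X q" "\<kappa> q (0, snd (?b q)) = - \<kappa> q (crep c X q, 0)" if q: "q \<in> U" for q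
  proof -
    obtain w B where w: "w \<in> slit" "c \<in> charts w" "q = point c w"
      and B: "bilinear B" "represents D w c B"
      using UE[OF q] by blast
    note t = beta_component[OF D w(1) pi_section_tangent[OF X w(1)] w(2) B(2)]
    show 1: "fst (?b q) = crep c X q" using t(2)
        by (simp add: w(3) rep_at[OF w(2,1)] crep_point[OF w(2,1)])
    have "\<kappa> q (?b q) = 0" using t(3) by (simp add: w(3) \<kappa>[OF w(1,2) B(2)] rep_at[OF w(2,1)])
    moreover have "?b q = (crep c X q, 0) + (0, snd (?b q))" using 1 by (simp add: prod_eq_iff)
    ultimately have "\<kappa> q (crep c X q, 0) + \<kappa> q (0, snd (?b q)) = 0"
      using linear_add[OF \<kappa>_lin[OF q], of "(crep c X q, 0)" "(0, snd (?b q))"] by simp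
    then show "\<kappa> q (0, snd (?b q)) = - \<kappa> q (crep c X q, 0)"
        by (simp add: eq_neg_iff_add_eq_0 add.commute)
  qed
  \<comment> \<open>Pairing \<open>b(2)\<close> with \<open>\<kappa> q (0, Z)\<close> expresses
    \<open>?g\<close> of the unknown fibre component by smooth quantities.\<close>
  have snd_smooth: "smooth_on (\<lambda>q. snd (?b q)) U"
  proof (rule smooth_on_of_form[OF U inner])
    show "smooth_on (\<lambda>q. ?g q k l) U" for k l by (intro smooth_on_inner U \<kappa>_U)
    fix Z
    have "smooth_on (\<lambda>q. \<kappa> q (crep c X q, 0)) U"
      by (rule smooth_on_linear_family[OF U \<kappa>_lin \<kappa>_U smooth_on_Pair[OF U X_U smooth_on_const]])
    then have s: "smooth_on (\<lambda>q. - \<kappa> q (crep c X q, 0) \<bullet> \<kappa> q (0, Z)) U"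
      by (intro smooth_on_inner smooth_on_minus U \<kappa>_U)
    show "smooth_on (\<lambda>q. ?g q (snd (?b q)) Z) U"
      by (rule smooth_on_eqI[OF U s]) (simp add: b(2))
  qed
  have "smooth_on ?b U"
    by (rule smooth_on_eqI[OF U smooth_on_Pair[OF U X_U snd_smooth]]) (simp add: prod_eq_iff b(1))
  moreover have "q0 \<in> U"
    using point_in_coords[OF c u] \<Phi>(3) by (simp add: U_def q0 rep_at[OF c u])
  ultimately show "\<exists>U. open U \<and> q0 \<in> U \<and> smooth_on ?b U" using U by blast
qed

text \<open>The map \<open>\<rho>\<close> is evaluated in the chosen chart. Working in this chart makes it unnecessary to know
  that the bracket of two vector fields is a tangent vector.\<close>

lemma chosen_chart:
  assumes u: "u \<in> slit"
  obtains c where "c \<in> charts u" "some_chart_at \<S> u = sc c"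
proof -
  obtain c where "c \<in> charts u" using slit_chart_exists[OF u] by blast
  from slit.some_chart_at[OF sc_charts_at[OF this u]]
  have "some_chart_at \<S> u \<in> charts_at \<S> u" .
  then show thesis using that by (elim charts_at_slitE) simp
qed

text \<open>Only the component of \<open>\<zeta>\<close> in the chosen chart enters
  \<open>rho\<close>, so \<open>\<zeta>\<close> may be replaced by the genuine tangent vector with
  that component.\<close>

lemma rho_chosen:
  assumes u: "u \<in> slit" and c: "c \<in> charts u" "some_chart_at \<S> u = sc c"
  shows "rho \<A> u \<zeta> \<in> fibre u" "rho \<A> u \<zeta> c = fst (\<zeta> (sc c))"
proof -
  note C = sc_charts_at[OF c(1) u]
  define \<xi> where "\<xi> = coord_vec \<S> (sc c) u (\<zeta> (sc c))"
  have \<xi>: "\<xi> \<in> tangents u" "\<xi> (sc c) = \<zeta> (sc c)"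
    unfolding \<xi>_def by (rule slit.coord_vec_tangent[OF C], rule slit.coord_vec_component[OF C])
  have "rho \<A> u \<zeta> = rho \<A> u \<xi>" unfolding rho_def tangent_map_def Let_def c(2) \<xi>(2) ..
  then show "rho \<A> u \<zeta> \<in> fibre u" "rho \<A> u \<zeta> c = fst (\<zeta> (sc c))"
    using rho_tangent[OF u \<xi>(1)] rho_component[OF u c(1) \<xi>(1)] \<xi>(2) by simp_all
qed

text \<open>The first component of the bracket differentiates only the first components of the two
  fields. For horizontal lifts these are the components of the lifted sections, and for vertical
  fields they are zero.\<close>

lemma rho_bracket:
  assumes u: "u \<in> slit" and c: "c \<in> charts u" "some_chart_at \<S> u = sc c"
    and X: "rep c (\<lambda>q. X q (sc c)) differentiable at (point c u)"
    and Y: "rep c (\<lambda>q. Y q (sc c)) differentiable at (point c u)"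
    and a: "\<And>q. q \<in> coords c \<Longrightarrow> fst (rep c (\<lambda>q. X q (sc c)) q) = a q"
    and b: "\<And>q. q \<in> coords c \<Longrightarrow> fst (rep c (\<lambda>q. Y q (sc c)) q) = b q"
  shows "rho \<A> u (lie_bracket \<S> X Y u) c
    = fder b (point c u) (X u (sc c)) - fder a (point c u) (Y u (sc c))"
proof -
  note cA = charts_at_atlas[OF c(1)]
  note cong = fder_cong[OF open_coords[OF cA] point_in_coords[OF c(1) u]]
  have "rho \<A> u (lie_bracket \<S> X Y u) c = fst (lie_bracket \<S> X Y u (sc c))"
    by (rule rho_chosen[OF u c])
  also have "\<dots> = fst (fder (rep c (\<lambda>q. Y q (sc c))) (point c u) (X u (sc c)))
      - fst (fder (rep c (\<lambda>q. X q (sc c))) (point c u) (Y u (sc c)))"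
    using sc_charts_at[OF c(1) u] by (simp add: lie_bracket_def)
  also have "\<dots> = fder b (point c u) (X u (sc c)) - fder a (point c u) (Y u (sc c))"
    unfolding fst_fder[OF X] fst_fder[OF Y] using cong[OF a] cong[OF b] by simp
  finally show ?thesis .
qed

lemma rep_beta_fst:
  assumes D: "regular_connection \<A> D" and Y: "Y \<in> sections" and c: "c \<in> \<A>" "q \<in> coords c"
  shows "fst (rep c (\<lambda>u. beta \<A> D u (Y u) (sc c)) q) = crep c Y q"
proof -
  obtain w where w: "w \<in> slit" "c \<in> charts w" "q = point c w"
    using coordsE[OF c(2,1)] .
  obtain B where "represents D w c B"
    using linear_connection_represents[OF regular_linear[OF D] w(1,2)] .
  then show ?thesis
    using beta_component(2)[OF D w(1) pi_section_tangent[OF Y w(1)] w(2)]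
    by (simp add: w(3) rep_at[OF w(2,1)] crep_point[OF w(2,1)])
qed

lemma rho_field_beta:
  assumes D: "regular_connection \<A> D" and Y: "Y \<in> sections"
  shows "rho_field \<A> (\<lambda>u. beta \<A> D u (Y u)) = Y"
proof
  fix u show "rho_field \<A> (\<lambda>u. beta \<A> D u (Y u)) u = Y u"
    using beta_horizontal(2)[OF D _ pi_section_tangent[OF Y]] pi_section_outside[OF Y]
    by (simp add: rho_field_def)
qed

lemma rho_field_gamma:
  assumes X: "X \<in> sections"
  shows "rho_field \<A> (\<lambda>u. gamma \<A> u (X u)) = (\<lambda>u. vzero)"
proof
  fix u show "rho_field \<A> (\<lambda>u. gamma \<A> u (X u)) u = vzero"
  proof (cases "u \<in> slit")
    case True
    then obtain c where c: "c \<in> charts u" using slit_chart_exists by blast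
    note t = gamma_tangent[OF True pi_section_tangent[OF X True]]
    have "rho \<A> u (gamma \<A> u (X u)) = vzero"
      by (rule tangent_space_eqI[OF rho_tangent[OF True t] tangent_space_vzero c])
         (simp add: rho_component[OF True c t] gamma_component[OF True c])
    then show ?thesis by (simp add: rho_field_def True)
  qed (simp add: rho_field_def)
qed

text \<open>As \<open>rho\<close> undoes the horizontal lift, D differentiates \<open>X\<close> and
  \<open>Y\<close> themselves; these derivatives are the ones produced by the bracket and cancel,
  which leaves the terms with \<open>B\<close>.\<close>

lemma hh_torsion_rep:
  assumes D: "regular_connection \<A> D" and u: "u \<in> slit"
    and c: "c \<in> charts u" "some_chart_at \<S> u = sc c" and B: "represents D u c B"
    and X: "X \<in> sections" and Y: "Y \<in> sections"
  shows "hh_torsion \<A> D X Y u \<in> fibre u"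
    "hh_torsion \<A> D X Y u c
      = B (beta \<A> D u (X u) (sc c)) (Y u c) - B (beta \<A> D u (Y u) (sc c)) (X u c)"
proof -
  note cA = charts_at_atlas[OF c(1)]
  note q = point_in_coords[OF c(1) u] and DL = regular_linear[OF D]
  note bX = beta_component(1)[OF D u pi_section_tangent[OF X u] c(1) B]
    and bY = beta_component(1)[OF D u pi_section_tangent[OF Y u] c(1) B]
  note dif = smooth_on_differentiable[OF smooth_beta[OF D _ cA] q]
  let ?L = "lie_bracket \<S> (\<lambda>u. beta \<A> D u (X u)) (\<lambda>u. beta \<A> D u (Y u)) u"
  have T: "hh_torsion \<A> D X Y u = vsub (vsub (D u (beta \<A> D u (X u)) Y) (D u (beta \<A> D u (Y u)) X)) (rho \<A> u ?L)"
    by (simp add: hh_torsion_def torsion_def rho_field_beta[OF D X] rho_field_beta[OF D Y])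
  show "hh_torsion \<A> D X Y u \<in> fibre u"
    unfolding T
    by (intro tangent_space_vsub linear_connectionD(1)[OF DL u] bX bY X Y rho_chosen[OF u c])
  have "rho \<A> u ?L c = fder (crep c Y) (point c u) (beta \<A> D u (X u) (sc c))
      - fder (crep c X) (point c u) (beta \<A> D u (Y u) (sc c))"
    by (rule rho_bracket[where X = "\<lambda>u. beta \<A> D u (X u)" and Y = "\<lambda>u. beta \<A> D u (Y u)",
        OF u c dif[OF X] dif[OF Y] rep_beta_fst[OF D X cA] rep_beta_fst[OF D Y cA]])
  then show "hh_torsion \<A> D X Y u c
      = B (beta \<A> D u (X u) (sc c)) (Y u c) - B (beta \<A> D u (Y u) (sc c)) (X u c)"
    using B bX bY X Y by (simp add: T represents_def)
qed

text \<open>Vertical fields are killed by \<open>rho\<close>, so the second covariant derivative is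
  that of the zero section, and the bracket cancels the derivative of \<open>Y\<close> in the
  first.\<close>

lemma hhv_torsion_rep:
  assumes D: "regular_connection \<A> D" and u: "u \<in> slit"
    and c: "c \<in> charts u" "some_chart_at \<S> u = sc c" and B: "represents D u c B"
    and X: "X \<in> sections" and Y: "Y \<in> sections"
  shows "hhv_torsion \<A> D X Y u \<in> fibre u"
    "hhv_torsion \<A> D X Y u c = B (0, X u c) (Y u c)"
proof -
  note cA = charts_at_atlas[OF c(1)]
  note q = point_in_coords[OF c(1) u] and DL = regular_linear[OF D]
  note gX = gamma_tangent[OF u pi_section_tangent[OF X u]]
    and bY = beta_component(1)[OF D u pi_section_tangent[OF Y u] c(1) B]
  let ?G = "rep c (\<lambda>u. gamma \<A> u (X u) (sc c))"
  have G: "?G q = (0, crep c X q)" if "q \<in> coords c" for q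
    using that by (rule coordsE[OF _ cA]) (simp add: rep_at crep_point gamma_component)
  have "smooth_on ?G (coords c)"
    by (rule smooth_on_eqI[OF open_coords[OF cA] smooth_on_Pair[OF open_coords[OF cA]
            smooth_on_const smooth_crep[OF X cA]] G])
  then have difX: "?G differentiable at (point c u)" by (rule smooth_on_differentiable[OF _ q])
  have difY: "rep c (\<lambda>u. beta \<A> D u (Y u) (sc c)) differentiable at (point c u)"
    by (rule smooth_on_differentiable[OF smooth_beta[OF D Y cA] q])
  let ?L = "lie_bracket \<S> (\<lambda>u. gamma \<A> u (X u)) (\<lambda>u. beta \<A> D u (Y u)) u"
  have T: "hhv_torsion \<A> D X Y u = vsub (D u (gamma \<A> u (X u)) Y) (rho \<A> u ?L)"
    by (simp add: hhv_torsion_def torsion_def rho_field_beta[OF D Y] rho_field_gamma[OF X]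
        linear_connection_zero[OF DL u bY])
  show "hhv_torsion \<A> D X Y u \<in> fibre u"
    unfolding T
    by (intro tangent_space_vsub linear_connectionD(1)[OF DL u] gX Y rho_chosen[OF u c])
  have "rho \<A> u ?L c = fder (crep c Y) (point c u) (gamma \<A> u (X u) (sc c))
      - fder (\<lambda>q. 0) (point c u) (beta \<A> D u (Y u) (sc c))"
    by (rule rho_bracket[where X = "\<lambda>u. gamma \<A> u (X u)" and Y = "\<lambda>u. beta \<A> D u (Y u)",
        OF u c difX difY _ rep_beta_fst[OF D Y cA]]) (simp add: G)
  then show "hhv_torsion \<A> D X Y u c = B (0, X u c) (Y u c)"
    using B gX Y by (simp add: T represents_def gamma_component[OF u c(1)])
qed

end

section \<open>The conditions (C1)-(C4) read in a chart\<close>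

context finsler
begin

text \<open>In the product rule for the function \<open>g(Y, Z)\<close> the derivatives of
  \<open>Y\<close> and \<open>Z\<close> cancel against those inside D, so only values at
  \<open>u\<close> remain.\<close>

lemma cov_deriv_metric:
  assumes u: "u \<in> slit" and c: "c \<in> charts u" and D: "linear_connection \<A> D"
    and B: "represents D u c B" and \<xi>: "\<xi> \<in> tangents u"
    and Y: "Y \<in> sections" and Z: "Z \<in> sections"
  shows "cov_deriv_form \<A> D (finsler_metric L) u \<xi> Y Z
    = dgmet c (point c u) (\<xi> (sc c)) (Y u c) (Z u c)
      - gmet c (point c u) (B (\<xi> (sc c)) (Y u c)) (Z u c)
      - gmet c (point c u) (Y u c) (B (\<xi> (sc c)) (Z u c))"
proof -
  note cA = charts_at_atlas[OF c]
  let ?q = "point c u"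
  note q = point_in_coords[OF c u] and C = sc_charts_at[OF c u]
    and Yu = pi_section_tangent[OF Y u] and Zu = pi_section_tangent[OF Z u]
    and DY = linear_connectionD(1)[OF D u \<xi> Y] and DZ = linear_connectionD(1)[OF D u \<xi> Z]
  interpret inner_form "gmet c ?q" by (rule inner_form_metric[OF cA q])
  have rep: "rep c (\<lambda>w. finsler_metric L w (Y w) (Z w)) q = gmet c q (crep c Y q) (crep c Z q)"
    if qc: "q \<in> coords c" for q
  proof -
    obtain w where w: "w \<in> slit" "c \<in> charts w" "q = point c w"
      using coordsE[OF qc cA] .
    show ?thesis
      using finsler_metric_rep[OF w(1,2) pi_section_tangent[OF Y w(1)] pi_section_tangent[OF Z w(1)]]
      by (simp add: w(3) rep_at[OF w(2,1)] crep_point[OF w(2,1)])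
  qed
  have "((\<lambda>q. gmet c q (crep c Y q) (crep c Z q)) has_derivative
      (\<lambda>h. fder (\<lambda>q. gmet c q (crep c Y ?q) (crep c Z ?q)) ?q h
         + gmet c ?q (fder (crep c Y) ?q h) (crep c Z ?q)
         + gmet c ?q (crep c Y ?q) (fder (crep c Z) ?q h))) (at ?q)"
    by (rule has_derivative_bilinear_family[OF open_coords[OF cA] q metric_linear1[OF cA]
          metric_linear2[OF cA] smooth_metric[OF cA] smooth_crep[OF Y cA] smooth_crep[OF Z cA]])
  then have "(rep c (\<lambda>w. finsler_metric L w (Y w) (Z w)) has_derivative
      (\<lambda>h. fder (\<lambda>q. gmet c q (crep c Y ?q) (crep c Z ?q)) ?q h
         + gmet c ?q (fder (crep c Y) ?q h) (crep c Z ?q)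
         + gmet c ?q (crep c Y ?q) (fder (crep c Z) ?q h))) (at ?q)"
    by (rule has_derivative_transform_within_open[OF _ open_coords[OF cA] q]) (simp add: rep)
  from slit.dir_deriv_eq[OF C \<xi> this]
  have "dir_deriv \<S> u \<xi> (\<lambda>w. finsler_metric L w (Y w) (Z w))
     = dgmet c ?q (\<xi> (sc c)) (Y u c) (Z u c)
         + gmet c ?q (fder (crep c Y) ?q (\<xi> (sc c))) (Z u c)
         + gmet c ?q (Y u c) (fder (crep c Z) ?q (\<xi> (sc c)))"
    by (simp add: dgmet_def crep_point[OF c u])
  moreover have "finsler_metric L u (D u \<xi> Y) (Z u)
      = gmet c ?q (fder (crep c Y) ?q (\<xi> (sc c)) + B (\<xi> (sc c)) (Y u c)) (Z u c)"
    "finsler_metric L u (Y u) (D u \<xi> Z)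
      = gmet c ?q (Y u c) (fder (crep c Z) ?q (\<xi> (sc c)) + B (\<xi> (sc c)) (Z u c))"
    using finsler_metric_rep[OF u c DY Zu] finsler_metric_rep[OF u c Yu DZ] B \<xi> Y Z
    by (simp_all add: represents_def)
  ultimately show ?thesis by (simp add: cov_deriv_form_def g_simps)
qed

end

context finsler_form
begin

definition conditions where
  "conditions D u \<longleftrightarrow> (\<forall>X\<in>sections. \<forall>Y\<in>sections. \<forall>Z\<in>sections.
       cov_deriv_form \<A> D (finsler_metric L) u (beta \<A> D u (X u)) Y Z
         = A u (X u) * finsler_metric L u (Y u) (Z u) \<and>
       cov_deriv_form \<A> D (finsler_metric L) u (gamma \<A> u (X u)) Y Z = 0 \<and>
       hh_torsion \<A> D X Y u = vzero \<and>
       finsler_metric L u (hhv_torsion \<A> D X Y u) (Z u)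
         = finsler_metric L u (hhv_torsion \<A> D X Z u) (Y u))"

text \<open>Every term of the conditions has been reduced to values of the sections at
  \<open>u\<close>, and sections take arbitrary values there. By \<open>beta_eqI\<close> a solution
  of \<open>k + B (h, k) y = 0\<close> is the fibre component of the horizontal lift of
  \<open>h\<close>, so the quantifiers of \<open>cartan_cond\<close> match those over sections. The
  chart is the one in which \<open>rho\<close> is evaluated.\<close>

lemma conditions_iff_cartan_cond:
  assumes D: "regular_connection \<A> D" and u: "u \<in> slit"
    and c: "c \<in> charts u" "some_chart_at \<S> u = sc c" and B: "represents D u c B"
  shows "conditions D u \<longleftrightarrow>
    cartan_cond (gmet c (point c u)) (dgmet c (point c u)) (form_rep c (point c u)) (snd u c) B"
proof -
  let ?q = "point c u" and ?y = "snd u c"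
  let ?g = "gmet c ?q" and ?dg = "dgmet c ?q" and ?A = "form_rep c ?q"
  let ?b = "\<lambda>X. beta \<A> D u (X u) (sc c)"
  note DL = regular_linear[OF D]
  have bt: "beta \<A> D u (X u) \<in> tangents u" "fst (?b X) = X u c" "snd (?b X) + B (?b X) ?y = 0"
    if "X \<in> sections" for X
    using beta_component[OF D u pi_section_tangent[OF that u] c(1) B] by blast+
  have 1: "cov_deriv_form \<A> D (finsler_metric L) u (beta \<A> D u (X u)) Y Z
         = A u (X u) * finsler_metric L u (Y u) (Z u) \<longleftrightarrow>
      ?dg (?b X) (Y u c) (Z u c) - ?g (B (?b X) (Y u c)) (Z u c) - ?g (Y u c) (B (?b X) (Z u c))
         = ?A (X u c) * ?g (Y u c) (Z u c)"
    if "X \<in> sections" "Y \<in> sections" "Z \<in> sections" for X Y Z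
    using cov_deriv_metric[OF u c(1) DL B bt(1)[OF that(1)] that(2,3)]
      form_rep_point[OF u c(1) pi_section_tangent[OF that(1) u]]
      finsler_metric_rep[OF u c(1) pi_section_tangent[OF that(2) u] pi_section_tangent[OF that(3) u]]
    by simp
  have 2: "cov_deriv_form \<A> D (finsler_metric L) u (gamma \<A> u (X u)) Y Z =
      ?dg (0, X u c) (Y u c) (Z u c) - ?g (B (0, X u c) (Y u c)) (Z u c) - ?g (Y u c) (B (0, X u c) (Z u c))"
    if "X \<in> sections" "Y \<in> sections" "Z \<in> sections" for X Y Z
    using cov_deriv_metric[OF u c(1) DL B gamma_tangent[OF u pi_section_tangent[OF that(1) u]] that(2,3)]
    by (simp add: gamma_component[OF u c(1)])
  have 3: "hh_torsion \<A> D X Y u = vzero \<longleftrightarrow> B (?b X) (Y u c) = B (?b Y) (X u c)"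
    if "X \<in> sections" "Y \<in> sections" for X Y
    using hh_torsion_rep[OF D u c B that]
      tangent_space_eqI[OF hh_torsion_rep(1)[OF D u c B that] tangent_space_vzero c(1)] by auto
  have 4: "finsler_metric L u (hhv_torsion \<A> D X Y u) (Z u) = ?g (B (0, X u c) (Y u c)) (Z u c)"
    if "X \<in> sections" "Y \<in> sections" "Z \<in> sections" for X Y Z
    using finsler_metric_rep[OF u c(1) hhv_torsion_rep(1)[OF D u c B that(1,2)] pi_section_tangent[OF that(3) u]]
      hhv_torsion_rep(2)[OF D u c B that(1,2)] by simp
  have sec: "\<exists>X\<in>sections. X u c = v" for v
    using section_through[OF u c(1)] by metis
  have hor: "?b X = (X u c, k)" if "X \<in> sections" "k + B (X u c, k) ?y = 0" for X k
    by (rule beta_eqI[OF D u pi_section_tangent[OF that(1) u] c(1) B that(2)])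
  show ?thesis
  proof
    assume cond: "conditions D u"
    show "cartan_cond ?g ?dg ?A ?y B"
      unfolding cartan_cond_def
    proof (intro conjI allI impI)
      fix h k v w
      obtain X Y Z where s: "X \<in> sections" "Y \<in> sections" "Z \<in> sections"
        "X u c = h" "Y u c = v" "Z u c = w" using sec by metis
      assume "k + B (h, k) ?y = 0"
      then have "?b X = (h, k)" using hor[OF s(1)] s(4) by simp
      then show "?dg (h, k) v w - ?g (B (h, k) v) w - ?g v (B (h, k) w) = ?A h * ?g v w"
        using cond 1[OF s(1-3)] s unfolding conditions_def by simp
    next
      fix k v w
      obtain X Y Z where s: "X \<in> sections" "Y \<in> sections" "Z \<in> sections"
        "X u c = k" "Y u c = v" "Z u c = w" using sec by metis
      show "?dg (0, k) v w - ?g (B (0, k) v) w - ?g v (B (0, k) w) = 0"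
        using cond 2[OF s(1-3)] s unfolding conditions_def by simp
      have "finsler_metric L u (hhv_torsion \<A> D X Y u) (Z u)
          = finsler_metric L u (hhv_torsion \<A> D X Z u) (Y u)"
        using cond s(1-3) unfolding conditions_def by blast
      then show "?g (B (0, k) v) w = ?g (B (0, k) w) v"
        using 4[OF s(1-3)] 4[OF s(1,3,2)] s(4-6) by simp
    next
      fix h k h' k'
      obtain X Y where s: "X \<in> sections" "Y \<in> sections" "X u c = h" "Y u c = h'"
        using sec by metis
      assume "k + B (h, k) ?y = 0" "k' + B (h', k') ?y = 0"
      then have "?b X = (h, k)" "?b Y = (h', k')" using hor[OF s(1)] hor[OF s(2)] s(3,4) by simp_all
      moreover have "hh_torsion \<A> D X Y u = vzero" using cond s(1,2) unfolding conditions_def by blast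
      ultimately show "B (h, k) h' = B (h', k') h" using 3[OF s(1,2)] s(3,4) by simp
    qed
  next
    assume cond: "cartan_cond ?g ?dg ?A ?y B"
    have c: "\<And>h k v w. k + B (h, k) ?y = 0 \<Longrightarrow>
        ?dg (h, k) v w - ?g (B (h, k) v) w - ?g v (B (h, k) w) = ?A h * ?g v w"
      "\<And>k v w. ?dg (0, k) v w - ?g (B (0, k) v) w - ?g v (B (0, k) w) = 0"
      "\<And>h k h' k'. k + B (h, k) ?y = 0 \<Longrightarrow> k' + B (h', k') ?y = 0 \<Longrightarrow> B (h, k) h' = B (h', k') h"
      "\<And>k v w. ?g (B (0, k) v) w = ?g (B (0, k) w) v"
      using cond unfolding cartan_cond_def by blast+
    have bX: "\<exists>k. ?b X = (X u c, k) \<and> k + B (X u c, k) ?y = 0" if "X \<in> sections" for X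
      using bt(2,3)[OF that] by (cases "?b X") auto
    show "conditions D u"
      unfolding conditions_def
    proof (intro ballI)
      fix X Y Z assume s: "X \<in> sections" "Y \<in> sections" "Z \<in> sections"
      obtain k where k: "?b X = (X u c, k)" "k + B (X u c, k) ?y = 0" using bX[OF s(1)] by blast
      obtain l where l: "?b Y = (Y u c, l)" "l + B (Y u c, l) ?y = 0" using bX[OF s(2)] by blast
      show "cov_deriv_form \<A> D (finsler_metric L) u (beta \<A> D u (X u)) Y Z
         = A u (X u) * finsler_metric L u (Y u) (Z u) \<and>
       cov_deriv_form \<A> D (finsler_metric L) u (gamma \<A> u (X u)) Y Z = 0 \<and>
       hh_torsion \<A> D X Y u = vzero \<and>
       finsler_metric L u (hhv_torsion \<A> D X Y u) (Z u)
         = finsler_metric L u (hhv_torsion \<A> D X Z u) (Y u)"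
        using c(1)[OF k(2)] c(2) c(3)[OF k(2) l(2)] c(4)
        unfolding 1[OF s] 2[OF s] 3[OF s(1,2)] 4[OF s] 4[OF s(1,3,2)] k(1) l(1) by blast
    qed
  qed
qed

lemma regular_conditions_coef:
  assumes D: "regular_connection \<A> D" and u: "u \<in> slit" and cond: "conditions D u"
    and c: "c \<in> charts u" "some_chart_at \<S> u = sc c"
  shows "represents D u c (coef c (point c u))"
proof -
  note cA = charts_at_atlas[OF c(1)]
  obtain B where B: "bilinear B" "represents D u c B"
    using linear_connection_represents[OF regular_linear[OF D] u c(1)] .
  have "cartan_cond (gmet c (point c u)) (dgmet c (point c u)) (form_rep c (point c u)) (snd (point c u)) B"
    using conditions_iff_cartan_cond[OF D u c B(2)] cond by (simp add: sc_simps)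
  from cartan_data.cartan_cond_unique[OF cartan_data_at[OF cA point_in_coords[OF c(1) u]] B(1) this]
  show ?thesis using B(2) by (simp add: coef_def)
qed

lemma connection_unique:
  assumes "regular_connection \<A> D" "\<And>u. u \<in> slit \<Longrightarrow> conditions D u"
    and "regular_connection \<A> D'" "\<And>u. u \<in> slit \<Longrightarrow> conditions D' u"
  shows "D = D'"
proof (rule ext, rule ext, rule ext)
  fix u \<xi> Y
  \<comment> \<open>Off its domain a connection is fixed to be zero; this is needed for equality as
    functions.\<close>
  have z: "E u \<xi> Y = vzero" if "regular_connection \<A> E"
      "\<not> (u \<in> slit \<and> \<xi> \<in> tangents u \<and> Y \<in> sections)" for E
    using regular_linear[OF that(1)] that(2) unfolding linear_connection_def by blast
  show "D u \<xi> Y = D' u \<xi> Y"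
  proof (cases "u \<in> slit \<and> \<xi> \<in> tangents u \<and> Y \<in> sections")
    case True
    then have u: "u \<in> slit" and \<xi>: "\<xi> \<in> tangents u" and Y: "Y \<in> sections" by auto
    obtain c where c: "c \<in> charts u" "some_chart_at \<S> u = sc c" using chosen_chart[OF u] .
    have "D u \<xi> Y c = D' u \<xi> Y c"
      using regular_conditions_coef[OF assms(1) u assms(2)[OF u] c]
        regular_conditions_coef[OF assms(3) u assms(4)[OF u] c] \<xi> Y
      by (simp add: represents_def)
    then show ?thesis
      using tangent_space_eqI[OF linear_connectionD(1)[OF regular_linear[OF assms(1)] u \<xi> Y]
          linear_connectionD(1)[OF regular_linear[OF assms(3)] u \<xi> Y] c(1)] by simp
  next
    case False
    then show ?thesis using z[OF assms(1)] z[OF assms(3)] by simp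
  qed
qed

end

section \<open>Existence\<close>

context finsler_form
begin

definition "local_conn c u \<xi> Y
  = fder (crep c Y) (point c u) (\<xi> (sc c)) + coef c (point c u) (\<xi> (sc c)) (Y u c)"

text \<open>One chart at each base point defines the value; \<open>local_conn_change\<close> shows
  that the choice does not matter.\<close>

definition cartan_conn :: "('m, 'e) pi_connection" where
  "cartan_conn u \<xi> Y = (if u \<in> slit \<and> \<xi> \<in> tangents u \<and> Y \<in> sections
     then coord_vec \<A> (some_chart_at \<A> (fst u)) (fst u) (local_conn (some_chart_at \<A> (fst u)) u \<xi> Y)
     else vzero)"

text \<open>Neither summand of \<open>local_conn\<close> is tensorial. Differentiating the
  components of \<open>Y\<close> in the new chart produces \<open>S h (Y u c)\<close>, and
  \<open>coef_change\<close> subtracts the same term.\<close>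

lemma local_conn_change:
  assumes u: "u \<in> slit" and c: "c \<in> charts u" and d: "d \<in> charts u"
    and \<xi>: "\<xi> \<in> tangents u" and Y: "Y \<in> sections"
  shows "trans_deriv c d (fst u) (local_conn c u \<xi> Y) = local_conn d u \<xi> Y"
proof -
  note cd = charts_at_atlas[OF c] charts_at_atlas[OF d]
  note C = sc_charts_at[OF c u] and D = sc_charts_at[OF d u]
  let ?J = "trans_deriv c d (fst u)" and ?S = "second c d u" and ?q = "point c u"
  let ?\<tau> = "coord_rep c (map_c d)"
  define W where "W = slit.overlap (sc c) (sc d)"
  have W: "open W" unfolding W_def by (rule slit.overlap_open[OF sc_in[OF cd(1)] sc_in[OF cd(2)]])
  have q: "?q \<in> W" unfolding W_def using slit.charts_atD[OF C] slit.charts_atD[OF D] by blast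
  have J: "linear ?J" by (rule linear_trans_deriv[OF c d])
  obtain h k where hk: "\<xi> (sc c) = (h, k)" by fastforce
  have \<xi>d: "\<xi> (sc d) = trans_deriv (sc c) (sc d) u (\<xi> (sc c))"
    by (rule slit.tangent_space_component[OF \<xi> C D])
  have Yd: "Y u d = ?J (Y u c)" by (rule tangent_space_component[OF pi_section_tangent[OF Y u] c d])
  have coef: "coef d (point d u) (\<xi> (sc d)) (Y u d)
      = ?J (coef c ?q (\<xi> (sc c)) (Y u c)) - ?S h (Y u c)"
    unfolding \<xi>d Yd hk trans_deriv_slit_second[OF u c d] by (rule coef_change[OF u c d])
  have Wp: "\<exists>w. w \<in> slit \<and> c \<in> charts w \<and> d \<in> charts w \<and> x = point c w" if "x \<in> W" for x
  proof -
    from that obtain w where w: "w \<in> dom_c (sc c)" "w \<in> dom_c (sc d)" "x = point c w"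
      unfolding W_def by blast
    then have "w \<in> slit" "c \<in> charts w" "d \<in> charts w"
      using cd by (simp_all add: sc_simps(1) charts_at_def)
    then show ?thesis using w(3) by blast
  qed
  have eq: "rep c (\<lambda>u. Y u d) x = fder ?\<tau> (fst x) (crep c Y x)" and lin: "linear (fder ?\<tau> (fst x))"
    if x: "x \<in> W" for x
  proof -
    obtain w where w: "w \<in> slit" "c \<in> charts w" "d \<in> charts w" "x = point c w"
      using Wp[OF x] by blast
    have t: "trans_deriv c d (fst w) = fder ?\<tau> (fst x)" by (simp add: trans_deriv_def w(4) sc_simps)
    show "rep c (\<lambda>u. Y u d) x = fder ?\<tau> (fst x) (crep c Y x)"
      using tangent_space_component[OF pi_section_tangent[OF Y w(1)] w(2,3)]
      unfolding t w(4) rep_at[OF w(2,1)] crep_point[OF w(2,1)] .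
    show "linear (fder ?\<tau> (fst x))" using linear_trans_deriv[OF w(2,3)] t by simp
  qed
  have "((\<lambda>x. fder ?\<tau> (fst x) (crep c Y x)) has_derivative
      (\<lambda>\<zeta>. fder (\<lambda>x. fder ?\<tau> (fst x) (crep c Y ?q)) ?q \<zeta> + fder ?\<tau> (fst ?q) (fder (crep c Y) ?q \<zeta>))) (at ?q)"
    by (rule has_derivative_linear_family[where F = "\<lambda>x. fder ?\<tau> (fst x)", OF W q lin _
          smooth_on_differentiable[OF smooth_crep[OF Y cd(1)] point_in_coords[OF c u]]])
       (simp_all add: W_def smooth_trans_family[OF cd])
  then have "(rep c (\<lambda>u. Y u d) has_derivative
      (\<lambda>\<zeta>. fder (\<lambda>x. fder ?\<tau> (fst x) (crep c Y ?q)) ?q \<zeta> + fder ?\<tau> (fst ?q) (fder (crep c Y) ?q \<zeta>))) (at ?q)"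
    by (rule has_derivative_transform_within_open[OF _ W q]) (simp add: eq)
  from fun_cong[OF fder_eq[OF this], of "(h, k)"] have 1: "fder (rep c (\<lambda>u. Y u d)) ?q (h, k)
      = ?S h (Y u c) + ?J (fder (crep c Y) ?q (h, k))"
    unfolding crep_point[OF c u] fder_trans_family[OF u c d] by (simp add: trans_deriv_def sc_simps)
  have "rep d (\<lambda>u. Y u d) differentiable at (point d u)"
    using smooth_on_differentiable[OF smooth_crep[OF Y cd(2)] point_in_coords[OF d u]]
    by (simp add: crep_def)
  from fder_eq[OF slit.coord_rep_chain[OF C D this]]
  have "fder (crep d Y) (point d u) (\<xi> (sc d)) = fder (rep c (\<lambda>u. Y u d)) ?q (h, k)"
    by (simp add: crep_def \<xi>d hk)
  then show ?thesis by (simp add: local_conn_def coef 1 linear_add[OF J] hk)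
qed

lemma cartan_conn_component:
  assumes u: "u \<in> slit" and d: "d \<in> charts u"
    and \<xi>: "\<xi> \<in> tangents u" and Y: "Y \<in> sections"
  shows "cartan_conn u \<xi> Y \<in> fibre u" "cartan_conn u \<xi> Y d = local_conn d u \<xi> Y"
proof -
  note c = some_chart_at[OF d]
  show "cartan_conn u \<xi> Y \<in> fibre u"
    using u \<xi> Y coord_vec_tangent[OF c] by (simp add: cartan_conn_def)
  show "cartan_conn u \<xi> Y d = local_conn d u \<xi> Y"
    using u \<xi> Y d local_conn_change[OF u c d \<xi> Y] by (simp add: cartan_conn_def coord_vec_def)
qed

lemma cartan_conn_represents:
  "u \<in> slit \<Longrightarrow> c \<in> charts u \<Longrightarrow> represents cartan_conn u c (coef c (point c u))"
  by (simp add: represents_def cartan_conn_component local_conn_def)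

lemma cartan_conn_eqI:
  assumes u: "u \<in> slit" and \<xi>: "\<xi> \<in> tangents u" and Y: "Y \<in> sections"
    and v: "v \<in> fibre u" "\<And>c. c \<in> charts u \<Longrightarrow> local_conn c u \<xi> Y = v c"
  shows "cartan_conn u \<xi> Y = v"
proof -
  obtain c where c: "c \<in> charts u" using slit_chart_exists[OF u] by blast
  show ?thesis
    by (rule tangent_space_eqI[OF cartan_conn_component(1)[OF u c \<xi> Y] v(1) c])
       (simp add: cartan_conn_component(2)[OF u c \<xi> Y] v(2)[OF c])
qed

lemma linear_crep:
  "Y \<in> sections \<Longrightarrow> u \<in> slit \<Longrightarrow> c \<in> charts u \<Longrightarrow> linear (fder (crep c Y) (point c u))"
  using smooth_on_linear_fder[OF smooth_crep point_in_coords] charts_at_atlas by blast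

lemma linear_coef:
  assumes "c \<in> \<A>" "q \<in> coords c"
  shows "linear (coef c q \<xi>)" "linear (\<lambda>\<xi>. coef c q \<xi> v)"
  using bilinear_coef[OF assms] by (simp_all only: bilinear_def)

lemma linear_connection_cartan_conn: "linear_connection \<A> cartan_conn"
proof -
  note comp = cartan_conn_component
  have tan: "cartan_conn u \<xi> Y \<in> fibre u"
    if "u \<in> slit" "\<xi> \<in> tangents u" "Y \<in> sections" for u \<xi> Y
    using slit_chart_exists[OF that(1)] comp(1)[OF that(1) _ that(2,3)] by blast
  have lin_dir: "cartan_conn u (vadd (vscale a \<xi>) (vscale b \<zeta>)) Y
      = vadd (vscale a (cartan_conn u \<xi> Y)) (vscale b (cartan_conn u \<zeta> Y))"
    if u: "u \<in> slit" and \<xi>: "\<xi> \<in> tangents u" and \<zeta>: "\<zeta> \<in> tangents u"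
      and Y: "Y \<in> sections" for u \<xi> \<zeta> Y a b
  proof (rule cartan_conn_eqI[OF u _ Y])
    fix c assume c: "c \<in> charts u"
    note 1 = linear_crep[OF Y u c] and 2 = linear_coef(2)[OF charts_at_atlas[OF c] point_in_coords[OF c u]]
    show "local_conn c u (vadd (vscale a \<xi>) (vscale b \<zeta>)) Y
        = vadd (vscale a (cartan_conn u \<xi> Y)) (vscale b (cartan_conn u \<zeta> Y)) c"
      by (simp add: comp(2)[OF u c _ Y] \<xi> \<zeta> local_conn_def linear_add[OF 1] linear_add[OF 2]
          linear_scale[OF 1] linear_scale[OF 2] scaleR_add_right)
  qed (intro slit.tangent_space_vadd slit.tangent_space_vscale tangent_space_vadd tangent_space_vscale
      tan u \<xi> \<zeta> Y)+
  have add: "cartan_conn u \<xi> (\<lambda>w. vadd (Y w) (Z w)) = vadd (cartan_conn u \<xi> Y) (cartan_conn u \<xi> Z)"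
    if u: "u \<in> slit" and \<xi>: "\<xi> \<in> tangents u" and Y: "Y \<in> sections" and Z: "Z \<in> sections"
    for u \<xi> Y Z
  proof (rule cartan_conn_eqI[OF u \<xi> pi_sections_vadd[OF Y Z]])
    show "vadd (cartan_conn u \<xi> Y) (cartan_conn u \<xi> Z) \<in> fibre u"
      by (intro tangent_space_vadd tan u \<xi> Y Z)
    fix c assume c: "c \<in> charts u"
    note cA = charts_at_atlas[OF c] and q = point_in_coords[OF c u]
    have "crep c (\<lambda>w. vadd (Y w) (Z w)) = (\<lambda>q. crep c Y q + crep c Z q)"
      by (simp add: crep_def coord_rep_def fun_eq_iff)
    then have "fder (crep c (\<lambda>w. vadd (Y w) (Z w))) (point c u)
        = (\<lambda>h. fder (crep c Y) (point c u) h + fder (crep c Z) (point c u) h)"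
      using fder_eq[OF has_derivative_add[OF smooth_on_has_derivative[OF smooth_crep[OF Y cA] q]
            smooth_on_has_derivative[OF smooth_crep[OF Z cA] q]]] by simp
    then show "local_conn c u \<xi> (\<lambda>w. vadd (Y w) (Z w)) = vadd (cartan_conn u \<xi> Y) (cartan_conn u \<xi> Z) c"
      by (simp add: comp(2)[OF u c \<xi>] Y Z local_conn_def linear_add[OF linear_coef(1)[OF cA q]])
  qed
  have leibniz: "cartan_conn u \<xi> (\<lambda>w. vscale (f w) (Y w))
      = vadd (vscale (dir_deriv \<S> u \<xi> f) (Y u)) (vscale (f u) (cartan_conn u \<xi> Y))"
    if u: "u \<in> slit" and \<xi>: "\<xi> \<in> tangents u" and Y: "Y \<in> sections" and f: "smooth_function \<S> f"
    for u \<xi> Y f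
  proof (rule cartan_conn_eqI[OF u \<xi> pi_sections_vscale[OF f Y]])
    show "vadd (vscale (dir_deriv \<S> u \<xi> f) (Y u)) (vscale (f u) (cartan_conn u \<xi> Y)) \<in> fibre u"
      by (intro tangent_space_vadd tangent_space_vscale tan u \<xi> Y pi_section_tangent)
    fix c assume c: "c \<in> charts u"
    note cA = charts_at_atlas[OF c] and q = point_in_coords[OF c u]
    note df = smooth_on_has_derivative[OF smooth_function_rep[OF f cA] q]
    have "crep c (\<lambda>w. vscale (f w) (Y w)) = (\<lambda>q. rep c f q *\<^sub>R crep c Y q)"
      by (simp add: crep_def coord_rep_def fun_eq_iff)
    then have "fder (crep c (\<lambda>w. vscale (f w) (Y w))) (point c u)
        = (\<lambda>h. f u *\<^sub>R fder (crep c Y) (point c u) h + fder (rep c f) (point c u) h *\<^sub>R Y u c)"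
      using fder_eq[OF has_derivative_scaleR[OF df smooth_on_has_derivative[OF smooth_crep[OF Y cA] q]]]
      by (simp add: rep_at[OF c u] crep_point[OF c u])
    then show "local_conn c u \<xi> (\<lambda>w. vscale (f w) (Y w))
        = vadd (vscale (dir_deriv \<S> u \<xi> f) (Y u)) (vscale (f u) (cartan_conn u \<xi> Y)) c"
      by (simp add: comp(2)[OF u c \<xi> Y] local_conn_def scaleR_add_right
          slit.dir_deriv_eq[OF sc_charts_at[OF c u] \<xi> df] linear_scale[OF linear_coef(1)[OF cA q]])
  qed
  have smooth: "(\<lambda>u. if u \<in> slit then cartan_conn u (X u) Y else vzero) \<in> sections"
    if X: "X \<in> vector_fields \<S>" and Y: "Y \<in> sections" for X Y
  proof (rule pi_sectionI)
    have Xt: "X u \<in> tangents u" if u: "u \<in> slit" for u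
    proof -
      obtain c where "c \<in> charts u" using slit_chart_exists[OF u] by blast
      from slit.charts_atD[OF sc_charts_at[OF this u]] show ?thesis
        using X unfolding vector_fields_def by blast
    qed
    show "(if u \<in> slit then cartan_conn u (X u) Y else vzero) \<in> fibre u" if "u \<in> slit" for u
      using tan[OF that Xt[OF that] Y] that by simp
    fix c assume cA: "c \<in> \<A>"
    let ?X = "rep c (\<lambda>u. X u (sc c))"
    note o = open_coords[OF cA]
    have Xs: "smooth_on ?X (coords c)"
      using X sc_in[OF cA] by (simp add: vector_fields_def)
    \<comment> \<open>The two moving arguments of \<open>coef\<close> are treated in turn: the
      section for a fixed direction, then the direction.\<close>
    have "smooth_on (\<lambda>q. coef c q \<eta> (crep c Y q)) (coords c)" for \<eta>
      by (rule smooth_on_linear_family[OF o linear_coef(1)[OF cA] smooth_coef[OF cA] smooth_crep[OF Y cA]])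
    then have coef: "smooth_on (\<lambda>q. coef c q (?X q) (crep c Y q)) (coords c)"
      by (intro smooth_on_linear_family[where F = "\<lambda>q \<eta>. coef c q \<eta> (crep c Y q)", OF o _ _ Xs]
          linear_coef(2)[OF cA])
    show "smooth_on (crep c (\<lambda>u. if u \<in> slit then cartan_conn u (X u) Y else vzero)) (coords c)"
    proof (rule smooth_on_eqI[OF o smooth_on_add[OF o smooth_on_fder_apply[OF o smooth_crep[OF Y cA] Xs] coef]])
      fix q assume "q \<in> coords c"
      then obtain u where u: "u \<in> slit" "c \<in> charts u" "q = point c u"
        using coordsE[OF _ cA] by blast
      show "crep c (\<lambda>u. if u \<in> slit then cartan_conn u (X u) Y else vzero) q
          = fder (crep c Y) q (?X q) + coef c q (?X q) (crep c Y q)"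
        by (simp add: u(3) crep_point[OF u(2,1)] rep_at[OF u(2,1)] u(1) comp(2)[OF u(1,2) Xt[OF u(1)] Y] local_conn_def)
    qed
  qed simp
  have outside: "cartan_conn u \<xi> Y = vzero"
    if "\<not> (u \<in> slit \<and> \<xi> \<in> tangents u \<and> Y \<in> sections)" for u \<xi> Y
    by (rule trans[OF cartan_conn_def if_not_P[OF that]])
  show ?thesis
    unfolding linear_connection_def
    using tan lin_dir add leibniz smooth outside by (intro conjI ballI allI impI) simp_all
qed

lemma regular_cartan_conn: "regular_connection \<A> cartan_conn"
proof -
  note DL = linear_connection_cartan_conn
  have "tangents u =
          {vadd \<xi> \<zeta> | \<xi> \<zeta>. \<xi> \<in> vertical_space \<A> u \<and> \<zeta> \<in> horizontal_space \<A> cartan_conn u} \<and>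
        vertical_space \<A> u \<inter> horizontal_space \<A> cartan_conn u = {vzero}" if u: "u \<in> slit" for u
  proof -
    obtain c where c: "c \<in> charts u" using slit_chart_exists[OF u] by blast
    note cA = charts_at_atlas[OF c]
    note C = sc_charts_at[OF c u]
    let ?B = "coef c (point c u)" and ?y = "snd u c"
    interpret cartan_data "gmet c (point c u)" "dgmet c (point c u)" "form_rep c (point c u)" ?y
      using cartan_data_at[OF cA point_in_coords[OF c u]] by (simp add: sc_simps)
    have B: "?B = conn (gmet c (point c u)) (dgmet c (point c u)) (form_rep c (point c u)) ?y"
      by (simp add: coef_def sc_simps)
    have B0: "?B (0, k) ?y = 0" for k unfolding B by (rule conn_vert_y)
    have By: "?B (h, k) ?y = ?B (h, l) ?y" for h k l unfolding B conn_y ..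
    note hor = horizontal_iff[OF DL u c cartan_conn_represents[OF u c]] and ver = vertical_iff[OF u c]
    show ?thesis
    proof (intro conjI equalityI subsetI)
      fix \<xi> assume \<xi>: "\<xi> \<in> tangents u"
      obtain h k where hk: "\<xi> (sc c) = (h, k)" by fastforce
      \<comment> \<open>By \<open>By\<close> the value on y ignores the fibre part, so the
        horizontal lift of \<open>h\<close> can be written down directly.\<close>
      define \<zeta> where "\<zeta> = coord_vec \<S> (sc c) u (h, - ?B (h, 0) ?y)"
      have \<zeta>: "\<zeta> \<in> tangents u" "\<zeta> (sc c) = (h, - ?B (h, 0) ?y)"
        unfolding \<zeta>_def by (rule slit.coord_vec_tangent[OF C], rule slit.coord_vec_component[OF C])
      have "\<zeta> \<in> horizontal_space \<A> cartan_conn u"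
        using \<zeta> By[of h "- ?B (h, 0) ?y" 0] by (simp add: hor)
      moreover have "vsub \<xi> \<zeta> \<in> vertical_space \<A> u"
        using slit.tangent_space_vsub[OF \<xi> \<zeta>(1)] by (simp add: ver \<zeta>(2) hk)
      moreover have "\<xi> = vadd (vsub \<xi> \<zeta>) \<zeta>" by (simp add: fun_eq_iff)
      ultimately show "\<xi> \<in> {vadd \<xi> \<zeta> | \<xi> \<zeta>. \<xi> \<in> vertical_space \<A> u
          \<and> \<zeta> \<in> horizontal_space \<A> cartan_conn u}"
        by blast
    next
      fix \<xi> assume "\<xi> \<in> {vadd \<xi> \<zeta> | \<xi> \<zeta>. \<xi> \<in> vertical_space \<A> u \<and> \<zeta> \<in> horizontal_space \<A> cartan_conn u}"
      then show "\<xi> \<in> tangents u" using hor ver slit.tangent_space_vadd by blast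
    next
      fix \<xi> assume "\<xi> \<in> vertical_space \<A> u \<inter> horizontal_space \<A> cartan_conn u"
      then have \<xi>: "\<xi> \<in> tangents u" "fst (\<xi> (sc c)) = 0" "snd (\<xi> (sc c)) + ?B (\<xi> (sc c)) ?y = 0"
        using hor ver by blast+
      obtain k where k: "\<xi> (sc c) = (0, k)" using \<xi>(2) by (metis prod.collapse)
      then have "\<xi> (sc c) = vzero (sc c)" using \<xi>(3) B0[of k] by (simp add: zero_prod_def)
      then show "\<xi> \<in> {vzero}"
        using slit.tangent_space_eqI[OF \<xi>(1) slit.tangent_space_vzero C] by simp
    next
      fix \<xi> assume "\<xi> \<in> {vzero :: ('m, 'e) tslit}"
      then show "\<xi> \<in> vertical_space \<A> u \<inter> horizontal_space \<A> cartan_conn u"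
        using B0[of 0] by (simp_all add: ver hor slit.tangent_space_vzero zero_prod_def)
    qed
  qed
  then show ?thesis using DL unfolding regular_connection_def by blast
qed

lemma cartan_conn_conditions:
  assumes u: "u \<in> slit"
  shows "conditions cartan_conn u"
proof -
  obtain c where c: "c \<in> charts u" "some_chart_at \<S> u = sc c" using chosen_chart[OF u] .
  note cA = charts_at_atlas[OF c(1)]
  show ?thesis
    using cartan_data.cartan_cond_conn[OF cartan_data_at[OF cA point_in_coords[OF c(1) u]]]
      conditions_iff_cartan_cond[OF regular_cartan_conn u c cartan_conn_represents[OF u c(1)]]
    by (simp add: coef_def sc_simps)
qed

end

theorem theorem3p4:
  fixes M :: "'m topology"
    and \<A> :: "('m, 'e::euclidean_space) chart set"
    and L :: "('m, 'e) tpt \<Rightarrow> real"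
    and A :: "('m, 'e) tpt \<Rightarrow> ('m, 'e) tvec \<Rightarrow> real"
  assumes "finsler_manifold M \<A> L"
    and "scalar_one_form \<A> A"
  shows "\<exists>!D. regular_connection \<A> D \<and>
    (\<forall>X\<in>pi_sections \<A>. \<forall>Y\<in>pi_sections \<A>. \<forall>Z\<in>pi_sections \<A>. \<forall>u\<in>slit_bundle \<A>.
       cov_deriv_form \<A> D (finsler_metric L) u (beta \<A> D u (X u)) Y Z
         = A u (X u) * finsler_metric L u (Y u) (Z u) \<and>
       cov_deriv_form \<A> D (finsler_metric L) u (gamma \<A> u (X u)) Y Z = 0 \<and>
       hh_torsion \<A> D X Y u = vzero \<and>
       finsler_metric L u (hhv_torsion \<A> D X Y u) (Z u)
         = finsler_metric L u (hhv_torsion \<A> D X Z u) (Y u))"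
    (is "\<exists>!D. regular_connection \<A> D \<and> ?P D")
proof -
  interpret finsler_form M \<A> L A
    by unfold_locales (fact assms)+
  have P: "?P D \<longleftrightarrow> (\<forall>u\<in>slit_bundle \<A>. conditions D u)" for D
    unfolding conditions_def by blast
  show ?thesis
    unfolding P
  proof (rule ex1I)
    show "regular_connection \<A> cartan_conn \<and> (\<forall>u\<in>slit_bundle \<A>. conditions cartan_conn u)"
      using regular_cartan_conn cartan_conn_conditions by blast
    show "D = cartan_conn" if "regular_connection \<A> D \<and> (\<forall>u\<in>slit_bundle \<A>. conditions D u)" for D
      by (rule connection_unique) (use that regular_cartan_conn cartan_conn_conditions in blast)+
  qed
qed

end
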